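(* Let $c_0>0$ be fixed and let $L_0=L_0(n)=\log n/(2\log\log n)$. Consider either the directed or the undirected complete graph on $n$ vertices with i.i.d. exponential mean-$1$ edge weights. For every $\varepsilon>0$, for all sufficiently large $n$, the collection of $c_0$-light cycles of length at most $L_0$ (viewed as the point process $\Xi_n$ defined in the context) is within total variation distance $\varepsilon$ of a Poisson process $\Pi_n$ whose intensity is the expected number of such cycles (i.e. whose intensity measure is the mean measure of $\Xi_n$). In particular, $\Xi_n$ and $\Pi_n$ can be coupled so that, except with probability $\varepsilon$, for all $k\le L_0$ and all $c\le c_0$, the number of $c$-light cycles of length $k$ equals the number of points of $\Pi_n$ in the corresponding region $\{(C,x): C \text{ has length } k,\ x\le c\}$.
   Context: The directed complete graph on $n$ vertices has one arc for each ordered pair of distinct vertices; its cycles are simple directed cycles, of length at least $2$. The undirected complete graph has one edge for each unordered pair of distinct vertices; its cycles are simple cycles, of length at least $3$. Edge (arc) weights are i.i.d. exponential with mean $1$. The mean weight of a cycle $C$ is its total weight $w(C)$ divided by its length (number of edges). A cycle is $c$-light if its mean weight is at most $c/n$. The collection of $c_0$-light cycles of length at most $L_0$ is encoded as the point process $\Xi_n$ on $\{\text{cycles } C \text{ of length}\le L_0\}\times(0,c_0]$ having a point at $(C,x)$ whenever $C$ has mean weight exactly $x/n$ with $0<x\le c_0$. The mean measure of $\Xi_n$ assigns to $\{C\}\times(a,b]$ the probability that $C$ is $b$-light but not $a$-light. Total variation distance means the total variation distance between the laws of the two point processes. Logarithms are natural. *)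

theory Defs
  imports "HOL-Probability.Probability" "Graph_Theory.Kuratowski"
begin

section \<open>Complete graphs and their cycles\<close>

definition complete_graph :: "nat \<Rightarrow> nat pair_pre_digraph" where
  "complete_graph n = \<lparr> pverts = {..<n}, parcs = {(u, v). u < n \<and> v < n \<and> u \<noteq> v} \<rparr>"

lemma complete_digraph_complete_graph: "K\<^bsub>n\<^esub> (with_proj (complete_graph n))"
  unfolding complete_digraph_pair_def by (auto simp: complete_graph_def)

text \<open>
  A cycle is identified with the set of its edges, so that its length is the cardinality of the
  set and the library's arc lists that differ only in their starting point are identified.
  Undirected edges are two-element vertex sets; the undirected graph is the symmetric digraph above
  with the two orientations of each edge merged.
\<close>

definition directed_edges :: "nat \<Rightarrow> (nat \<times> nat) set" where
  "directed_edges n = parcs (complete_graph n)"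

definition directed_cycles :: "nat \<Rightarrow> (nat \<times> nat) set set" where
  "directed_cycles n = {set p |p. pre_digraph.cycle (with_proj (complete_graph n)) p}"

definition undirected_edges :: "nat \<Rightarrow> nat set set" where
  "undirected_edges n = (\<lambda>(u, v). {u, v}) ` parcs (complete_graph n)"

definition undirected_cycles :: "nat \<Rightarrow> nat set set set" where
  "undirected_cycles n =
     {(\<lambda>(u, v). {u, v}) ` set p |p.
        pre_digraph.cycle (with_proj (complete_graph n)) p \<and> length p \<ge> 3}"


section \<open>Point processes\<close>

text \<open>
  Only finite point configurations are needed (all intensities below are finite), so a
  configuration is a finite multiset, and a point process on \<open>S\<close> is given by its law, a
  probability measure on \<open>config_space S\<close>.
\<close>

definition points :: "'a set \<Rightarrow> 'a multiset \<Rightarrow> nat" where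
  "points B N = size (filter_mset (\<lambda>p. p \<in> B) N)"

definition config_space :: "'a measure \<Rightarrow> 'a multiset measure" where
  "config_space S =
     sigma {N. set_mset N \<subseteq> space S}
       {{N. set_mset N \<subseteq> space S \<and> points B N = k} |B k. B \<in> sets S}"

definition mean_measure :: "'a measure \<Rightarrow> 'a multiset measure \<Rightarrow> 'a measure" where
  "mean_measure S P =
     measure_of (space S) (sets S) (\<lambda>B. \<integral>\<^sup>+ N. of_nat (points B N) \<partial>P)"

text \<open>
  The probability mass is written out instead of using \<^const>\<open>poisson_pmf\<close>, which requires a
  positive rate: sets of intensity \<open>0\<close> are covered because \<open>0 ^ 0 = 1\<close>.
\<close>

definition poisson_process :: "'a measure \<Rightarrow> 'a multiset measure \<Rightarrow> bool" where
  "poisson_process \<Lambda> P \<longleftrightarrow>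
     finite_measure \<Lambda> \<and> prob_space P \<and> sets P = sets (config_space \<Lambda>) \<and>
     (\<forall>B\<in>sets \<Lambda>. \<forall>k.
        measure P {N \<in> space P. points B N = k} =
          measure \<Lambda> B ^ k / fact k * exp (- measure \<Lambda> B)) \<and>
     (\<forall>(m::nat) B. (\<forall>i<m. B i \<in> sets \<Lambda>) \<and> disjoint_family_on B {..<m} \<longrightarrow>
        prob_space.indep_vars P (\<lambda>_. count_space UNIV) (\<lambda>i. points (B i)) {..<m})"

definition total_variation :: "'a measure \<Rightarrow> 'a measure \<Rightarrow> real" where
  "total_variation P Q = (SUP A\<in>sets P. \<bar>measure P A - measure Q A\<bar>)"

definition coupling :: "'a measure \<Rightarrow> 'b measure \<Rightarrow> ('a \<times> 'b) measure \<Rightarrow> bool" where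
  "coupling P Q K \<longleftrightarrow>
     sets K = sets (P \<Otimes>\<^sub>M Q) \<and> distr K P fst = P \<and> distr K Q snd = Q"


section \<open>Light cycles\<close>

text \<open>
  The following notions are parametrised by the edge set \<open>E\<close> and the set \<open>Cs\<close> of cycles of the
  graph, to serve both the directed and the undirected case; \<open>n\<close> is the number of vertices.
\<close>

definition weights :: "'e set \<Rightarrow> ('e \<Rightarrow> real) measure" where
  "weights E = PiM E (\<lambda>_. density lborel (exponential_density 1))"

definition mean_weight :: "('e \<Rightarrow> real) \<Rightarrow> 'e set \<Rightarrow> real" where
  "mean_weight w C = (\<Sum>e\<in>C. w e) / real (card C)"

definition light :: "nat \<Rightarrow> ('e \<Rightarrow> real) \<Rightarrow> real \<Rightarrow> 'e set \<Rightarrow> bool" where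
  "light n w c C \<longleftrightarrow> mean_weight w C \<le> c / real n"

definition L0 :: "nat \<Rightarrow> real" where
  "L0 n = ln (real n) / (2 * ln (ln (real n)))"

definition short_cycles :: "nat \<Rightarrow> 'e set set \<Rightarrow> 'e set set" where
  "short_cycles n Cs = {C \<in> Cs. real (card C) \<le> L0 n}"

definition state_space :: "nat \<Rightarrow> 'e set set \<Rightarrow> real \<Rightarrow> ('e set \<times> real) measure" where
  "state_space n Cs c0 = count_space (short_cycles n Cs) \<Otimes>\<^sub>M restrict_space borel {0<..c0}"

definition light_points ::
  "nat \<Rightarrow> 'e set set \<Rightarrow> real \<Rightarrow> ('e \<Rightarrow> real) \<Rightarrow> ('e set \<times> real) multiset" where
  "light_points n Cs c0 w =
     mset_set {(C, x). C \<in> short_cycles n Cs \<and> 0 < x \<and> x \<le> c0 \<and> mean_weight w C = x / real n}"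

text \<open>
  The process is a function of the weights, so a coupling of \<open>weights E\<close> with the law of another
  point process is in particular a coupling of \<open>light_process n E Cs c0\<close> with it.
\<close>

definition light_process ::
  "nat \<Rightarrow> 'e set \<Rightarrow> 'e set set \<Rightarrow> real \<Rightarrow> ('e set \<times> real) multiset measure" where
  "light_process n E Cs c0 =
     distr (weights E) (config_space (state_space n Cs c0)) (light_points n Cs c0)"

definition light_intensity ::
  "nat \<Rightarrow> 'e set \<Rightarrow> 'e set set \<Rightarrow> real \<Rightarrow> ('e set \<times> real) measure" where
  "light_intensity n E Cs c0 = mean_measure (state_space n Cs c0) (light_process n E Cs c0)"


section \<open>Consistency facts\<close>

lemma finite_edges: "finite (directed_edges n)" "finite (undirected_edges n)"
proof -
  have "parcs (complete_graph n) \<subseteq> {..<n} \<times> {..<n}" by (auto simp: complete_graph_def)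
  then have "finite (parcs (complete_graph n))" by (rule finite_subset) auto
  then show "finite (directed_edges n)" "finite (undirected_edges n)"
    by (auto simp: directed_edges_def undirected_edges_def)
qed

lemma cycles_subset_edges:
  "C \<in> directed_cycles n \<Longrightarrow> C \<subseteq> directed_edges n"
  "D \<in> undirected_cycles n \<Longrightarrow> D \<subseteq> undirected_edges n"
  by (auto simp: directed_cycles_def directed_edges_def undirected_cycles_def undirected_edges_def
      pre_digraph.cycle_def pre_digraph.awalk_def)

lemma finite_cycles: "finite (directed_cycles n)" "finite (undirected_cycles n)"
proof -
  have "directed_cycles n \<subseteq> Pow (directed_edges n)" "undirected_cycles n \<subseteq> Pow (undirected_edges n)"
    using cycles_subset_edges by blast+
  then show "finite (directed_cycles n)" "finite (undirected_cycles n)"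
    using finite_edges by (meson finite_Pow_iff finite_subset)+
qed

lemma directed_cycle_length_ge_2:
  assumes "C \<in> directed_cycles n"
  shows "card C \<ge> 2"
proof -
  interpret graph "with_proj (complete_graph n)"
    using complete_digraph_complete_graph[of n] by (simp add: complete_digraph_def)
  from assms obtain p where p: "C = set p" "cycle p" by (auto simp: directed_cycles_def)
  then have "distinct p" "2 \<le> length p"
    using cycle_conv[of p] cycle_digraph_conv[of p] by auto
  with p show ?thesis by (simp add: distinct_card)
qed

lemma space_config_space: "space (config_space S) = {N. set_mset N \<subseteq> space S}"
  unfolding config_space_def by (rule space_measure_of) auto

lemma measurable_points:
  assumes "B \<in> sets S"
  shows "points B \<in> config_space S \<rightarrow>\<^sub>M count_space UNIV"
proof (rule measurable_count_space_eq2_countable[THEN iffD2])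
  show "points B \<in> space (config_space S) \<rightarrow> UNIV \<and>
      (\<forall>a\<in>UNIV. points B -` {a} \<inter> space (config_space S) \<in> sets (config_space S))"
  proof (intro conjI ballI)
    fix k
    have "points B -` {k} \<inter> space (config_space S) =
        {N. set_mset N \<subseteq> space S \<and> points B N = k}"
      by (auto simp: space_config_space)
    also have "\<dots> \<in> sets (config_space S)"
      unfolding config_space_def using assms by (intro in_measure_of) auto
    finally show "points B -` {k} \<inter> space (config_space S) \<in> sets (config_space S)" .
  qed auto
qed

lemma points_eq_sum: "(of_nat (points B N) :: ennreal) = (\<Sum>p\<in>#N. indicator B p)"
  by (induction N) (auto simp: points_def)

lemma points_suminf:
  fixes A :: "nat \<Rightarrow> 'a set"
  assumes "disjoint_family A"
  shows "(of_nat (points (\<Union>i. A i) N) :: ennreal) = (\<Sum>i. of_nat (points (A i) N))"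
proof (induction N)
  case empty
  then show ?case by (simp add: points_def)
next
  case (add p N)
  have "(\<Sum>i. indicator (A i) p + of_nat (points (A i) N) :: ennreal) =
      indicator (\<Union>i. A i) p + of_nat (points (\<Union>i. A i) N)"
    by (subst suminf_add[symmetric]) (auto simp: add.IH suminf_indicator[OF assms])
  moreover have "of_nat (points B (add_mset p N)) =
      (indicator B p + of_nat (points B N) :: ennreal)" for B
    by (simp add: points_eq_sum)
  ultimately show ?case by simp
qed

lemma emeasure_mean_measure:
  assumes [measurable_cong]: "sets P = sets (config_space S)" and "B \<in> sets S"
  shows "emeasure (mean_measure S P) B = (\<integral>\<^sup>+ N. of_nat (points B N) \<partial>P)"
  unfolding mean_measure_def
proof (rule emeasure_measure_of_sigma)
  show "sigma_algebra (space S) (sets S)" ..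
  show "positive (sets S) (\<lambda>B. \<integral>\<^sup>+ N. of_nat (points B N) \<partial>P)"
    by (simp add: positive_def points_def)
  show "countably_additive (sets S) (\<lambda>B. \<integral>\<^sup>+ N. of_nat (points B N) \<partial>P)"
  proof (rule countably_additiveI)
    fix A :: "nat \<Rightarrow> 'a set" assume A: "range A \<subseteq> sets S" "disjoint_family A"
    have [measurable]: "points (A i) \<in> P \<rightarrow>\<^sub>M count_space UNIV" for i
      using measurable_points[of "A i" S] A(1) by (simp add: measurable_cong_sets[OF assms(1) refl] range_subsetD)
    show "(\<Sum>i. \<integral>\<^sup>+ N. of_nat (points (A i) N) \<partial>P) =
        (\<integral>\<^sup>+ N. of_nat (points (\<Union>i. A i) N) \<partial>P)"
      unfolding points_suminf[OF A(2)]
      by (rule nn_integral_suminf[symmetric]) measurable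
  qed
qed fact

lemma prob_space_weights: "prob_space (weights E)"
  unfolding weights_def by (intro prob_space_PiM prob_space_exponential_density) auto

lemma light_points_eq_image:
  assumes "n > 0"
  shows "light_points n Cs c0 w =
    mset_set ((\<lambda>C. (C, real n * mean_weight w C)) `
      {C \<in> short_cycles n Cs. 0 < real n * mean_weight w C \<and> real n * mean_weight w C \<le> c0})"
  unfolding light_points_def using assms
  by (intro arg_cong[where f=mset_set]) (auto simp: field_simps)

lemma points_light_points:
  assumes "n > 0" "finite Cs"
  shows "points B (light_points n Cs c0 w) =
    card {C \<in> short_cycles n Cs. 0 < real n * mean_weight w C \<and> real n * mean_weight w C \<le> c0 \<and>
      (C, real n * mean_weight w C) \<in> B}" (is "_ = card ?R")
proof -
  let ?f = "\<lambda>C. (C, real n * mean_weight w C)"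
  let ?A = "{C \<in> short_cycles n Cs. 0 < real n * mean_weight w C \<and> real n * mean_weight w C \<le> c0}"
  have "finite ?A" using assms by (auto simp: short_cycles_def)
  hence "points B (light_points n Cs c0 w) = card {p \<in> ?f ` ?A. p \<in> B}"
    unfolding light_points_eq_image[OF assms(1)] points_def by simp
  also have "{p \<in> ?f ` ?A. p \<in> B} = ?f ` ?R" by auto
  also have "card \<dots> = card ?R" by (rule card_image) (auto simp: inj_on_def)
  finally show ?thesis .
qed

lemma measurable_mean_weight:
  assumes "C \<subseteq> E"
  shows "(\<lambda>w. mean_weight w C) \<in> borel_measurable (weights E)"
proof -
  have "(\<lambda>w. w e) \<in> borel_measurable (weights E)" if "e \<in> C" for e
    using measurable_component_singleton[of e E "\<lambda>_. density lborel (exponential_density 1)"] that assms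
    by (auto simp: weights_def)
  thus ?thesis
    unfolding mean_weight_def
    by (intro borel_measurable_divide borel_measurable_sum borel_measurable_const)
qed

lemma space_state_space: "space (state_space n Cs c0) = short_cycles n Cs \<times> {0<..c0}"
  by (simp add: state_space_def space_pair_measure space_restrict_space)

lemma measurable_light_points:
  assumes "n > 0" "finite Cs" "\<And>C. C \<in> Cs \<Longrightarrow> C \<subseteq> E"
  shows "light_points n Cs c0 \<in> weights E \<rightarrow>\<^sub>M config_space (state_space n Cs c0)"
  unfolding config_space_def
proof (rule measurable_measure_of)
  let ?S = "state_space n Cs c0"
  have fin: "finite (short_cycles n Cs)" using assms by (auto simp: short_cycles_def)
  have in_space: "set_mset (light_points n Cs c0 w) \<subseteq> space ?S" for w
    using fin by (auto simp: light_points_eq_image[OF assms(1)] space_state_space)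
  show "light_points n Cs c0 \<in> space (weights E) \<rightarrow> {N. set_mset N \<subseteq> space ?S}"
    using in_space by auto
  fix A assume "A \<in> {{N. set_mset N \<subseteq> space ?S \<and> points B N = k} |B k. B \<in> sets ?S}"
  then obtain B k where A: "A = {N. set_mset N \<subseteq> space ?S \<and> points B N = k}" and B: "B \<in> sets ?S"
    by auto
  have mw: "(\<lambda>w. real n * mean_weight w C) \<in> borel_measurable (weights E)"
    if "C \<in> short_cycles n Cs" for C
    using that assms(3)[of C] by (intro borel_measurable_times measurable_mean_weight)
      (auto simp: short_cycles_def)
  have P: "Measurable.pred (weights E) (\<lambda>w. 0 < real n * mean_weight w C \<and>
      real n * mean_weight w C \<le> c0 \<and> (C, real n * mean_weight w C) \<in> B)"
    if C: "C \<in> short_cycles n Cs" for C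
  proof -
    have "Pair C -` B \<in> sets (restrict_space borel {0<..c0})"
      using sets_Pair1[of B "count_space (short_cycles n Cs)"] B by (simp add: state_space_def)
    then have X: "Pair C -` B \<in> sets borel" 
      by (auto simp: sets_restrict_space)
    note [measurable] = X mw[OF C]
    have "Measurable.pred (weights E) (\<lambda>w. 0 < real n * mean_weight w C \<and>
        real n * mean_weight w C \<le> c0 \<and> real n * mean_weight w C \<in> Pair C -` B)"
      by measurable
    thus ?thesis by simp
  qed
  have "light_points n Cs c0 -` A \<inter> space (weights E) =
      {w \<in> space (weights E). points B (light_points n Cs c0 w) = k}"
    using in_space by (auto simp: A)
  also have "\<dots> = {w \<in> space (weights E). (\<Sum>C\<in>short_cycles n Cs.
      if 0 < real n * mean_weight w C \<and> real n * mean_weight w C \<le> c0 \<and>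
        (C, real n * mean_weight w C) \<in> B then 1 else 0) = k}"
    unfolding points_light_points[OF assms(1,2)]
    using fin by (simp add: sum.If_cases Int_def)
  also have "\<dots> \<in> sets (weights E)"
  proof -
    have [measurable]: "(\<lambda>w. \<Sum>C\<in>short_cycles n Cs.
      if 0 < real n * mean_weight w C \<and> real n * mean_weight w C \<le> c0 \<and>
        (C, real n * mean_weight w C) \<in> B then 1 else (0::nat)) \<in> weights E \<rightarrow>\<^sub>M count_space UNIV"
      using P by (intro measurable_sum_nat measurable_If) auto
    show ?thesis by measurable
  qed
  finally show "light_points n Cs c0 -` A \<inter> space (weights E) \<in> sets (weights E)" .
qed auto

text \<open>
  The mean measure gives \<open>{C} \<times> {a<..b}\<close> the probability that \<open>C\<close> is \<open>b\<close>-light but not \<open>a\<close>-light.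
\<close>

lemma emeasure_light_intensity:
  assumes "n > 0" "finite Cs" "\<And>C. C \<in> Cs \<Longrightarrow> C \<subseteq> E"
    and C: "C \<in> short_cycles n Cs" and ab: "0 \<le> a" "a \<le> b" "b \<le> c0"
  shows "emeasure (light_intensity n E Cs c0) ({C} \<times> {a<..b}) =
    emeasure (weights E) {w \<in> space (weights E). light n w b C \<and> \<not> light n w a C}"
proof -
  let ?S = "state_space n Cs c0" and ?B = "{C} \<times> {a<..b}"
  have B: "?B \<in> sets ?S"
    unfolding state_space_def using C ab
    by (intro pair_measureI) (auto simp: sets_restrict_space_iff subset_iff)
  have [measurable]: "points ?B \<in> config_space ?S \<rightarrow>\<^sub>M count_space UNIV"
    by (rule measurable_points[OF B])
  note [measurable] = measurable_light_points[OF assms(1-3)]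
  have [measurable]: "(\<lambda>w. mean_weight w C) \<in> borel_measurable (weights E)"
    using C assms(3)[of C] by (intro measurable_mean_weight) (auto simp: short_cycles_def)
  have eq: "of_nat (points ?B (light_points n Cs c0 w)) =
      (indicator {w \<in> space (weights E). light n w b C \<and> \<not> light n w a C} w :: ennreal)"
    if w: "w \<in> space (weights E)" for w
  proof -
    have "{D \<in> short_cycles n Cs. 0 < real n * mean_weight w D \<and>
        real n * mean_weight w D \<le> c0 \<and> (D, real n * mean_weight w D) \<in> ?B} =
        (if light n w b C \<and> \<not> light n w a C then {C} else {})"
      using C ab assms(1) unfolding light_def by (auto simp: field_simps)
    thus ?thesis using w unfolding points_light_points[OF assms(1,2)] by simp
  qed
  have "emeasure (light_intensity n E Cs c0) ?B =
      (\<integral>\<^sup>+ w. of_nat (points ?B (light_points n Cs c0 w)) \<partial>weights E)"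
    unfolding light_intensity_def using B
    by (subst emeasure_mean_measure) (auto simp: light_process_def nn_integral_distr)
  also have "\<dots> = (\<integral>\<^sup>+ w. indicator {w \<in> space (weights E). light n w b C \<and> \<not> light n w a C} w
      \<partial>weights E)"
    by (rule nn_integral_cong) (rule eq)
  also have "\<dots> = emeasure (weights E) {w \<in> space (weights E). light n w b C \<and> \<not> light n w a C}"
    unfolding light_def by (intro nn_integral_indicator) measurable
  finally show ?thesis .
qed

end

theory Submission
  imports Defs "HOL-Real_Asymp.Real_Asymp"
begin

text \<open>
  The total variation distance is bounded by a direct comparison of densities. Under the
  Poisson law, a configuration consists of single points on pairwise vertex-disjoint cycles
  \<open>S\<close>, up to an error \<open>b = \<Sum> p C * p D\<close> over pairs of intersecting cycles; such configurations have
  weight \<open>exp (- mass)\<close> times the law of the weights of the cycles in \<open>S\<close>. For the light cycles, the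
  same configuration arises when the cycles in \<open>S\<close> are light and no other cycle is. The events
  "\<open>D\<close> is not light" are increasing in the edge weights, so Harris' inequality bounds the
  probability that no cycle disjoint from \<open>S\<close> is light below by \<open>\<Prod> (1 - p D)\<close>, even given the weights on
  \<open>S\<close>, and \<open>\<Prod> (1 - p D) \<ge> exp (- mass) * (1 - b)\<close>. A cycle \<open>D\<close> intersecting \<open>S\<close> is light, given that
  those in \<open>S\<close> are, with probability at most \<open>exp (c0 * k) * n\<^sup>-\<^sup>m\<close>, where \<open>k\<close> is its length and \<open>m\<close> the
  number of its edges outside \<open>S\<close>. Writing cycles as closed walks that enter \<open>S\<close> through an edge outside
  \<open>S\<close>, the sum of these bounds is controlled by powers of a matrix with row sums at most 3. With
  \<open>K = 3 * exp c0\<close>, all errors are of order \<open>K powr (2 * L0 n) / n\<close> up to powers of \<open>L0 n\<close>.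
\<close>

section \<open>Harris inequality and exponential weights\<close>

text \<open>One inequality suffices: a bound \<open>Q A \<le> P A + discrepancy\<close> for all
  events \<open>A\<close> gives total variation by complements and a coupling directly. So the light
  process is only bounded below, by events that keep configurations on disjoint cycles, and the
  Poisson law only above. Since \<open>A\<close> may depend on the exact positions of points,
  Harris' inequality must hold with the weights on \<open>S\<close> frozen: one event may depend on
  them arbitrarily, the other must ignore them. Overlaps are dangerous because a cycle using edges
  of \<open>S\<close> has few edges of its own. They stay cheap because the closing edge of its walk
  is outside \<open>S\<close> and costs \<open>1 / n\<close>, while any other step has at most two
  continuations of weight 1 inside \<open>S\<close> and at most \<open>n\<close> of weight
  \<open>1 / n\<close> outside, which gives the 3. Hence each vertex of \<open>S\<close> attracts
  cost of order \<open>K powr L0 n / n\<close>, and the expected total length of light cycles is of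
  order \<open>K powr L0 n\<close>; every error is a product of the two. The choice of
  \<open>L0\<close> makes \<open>K powr (2 * L0 n)\<close> equal to
  \<open>n powr (ln K / ln (ln n))\<close>, which is \<open>n\<close> to a power tending to 0 for
  each fixed \<open>K\<close>.\<close>

lemma distr_PiM_mix:
  assumes fin: "finite I" and prob: "\<And>i. prob_space (M i)"
  shows "distr (PiM I M \<Otimes>\<^sub>M PiM I M) (PiM I M)
    (\<lambda>(x, y). \<lambda>i\<in>I. if i \<in> G then x i else y i) = PiM I M"
proof -
  interpret product_prob_space M I
    by (intro product_prob_spaceI prob)
  interpret P: prob_space "PiM I M" by (rule prob_space_PiM) (rule prob)
  let ?f = "\<lambda>(x, y). \<lambda>i\<in>I. if i \<in> G then x i else y i"
  have f [measurable]: "?f \<in> PiM I M \<Otimes>\<^sub>M PiM I M \<rightarrow>\<^sub>M PiM I M"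
    by measurable
  show ?thesis
  proof (rule PiM_eqI[OF fin])
    fix A assume A: "\<And>i. i \<in> I \<Longrightarrow> A i \<in> sets (M i)"
    \<comment> \<open>Each coordinate of the mixture reads only one of the two copies, so the
      preimage of a box is a product of two boxes, and in each coordinate one of the two factors has
      measure 1.\<close>
    let ?A = "\<lambda>i. if i \<in> G then A i else space (M i)"
    let ?B = "\<lambda>i. if i \<in> G then space (M i) else A i"
    have sub: "A i \<subseteq> space (M i)" if "i \<in> I" for i
      using sets.sets_into_space[OF A[OF that]] .
    have eq: "?f -` (\<Pi>\<^sub>E i\<in>I. A i) \<inter> space (PiM I M \<Otimes>\<^sub>M PiM I M) = (\<Pi>\<^sub>E i\<in>I. ?A i) \<times> (\<Pi>\<^sub>E i\<in>I. ?B i)"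
    proof (intro set_eqI, clarify)
      fix x y :: "'a \<Rightarrow> 'b"
      have "\<forall>i\<in>I. \<forall>t. t \<in> A i \<longrightarrow> t \<in> space (M i)" using sub by blast
      then show "(x, y) \<in> ?f -` (\<Pi>\<^sub>E i\<in>I. A i) \<inter> space (PiM I M \<Otimes>\<^sub>M PiM I M) \<longleftrightarrow>
          (x, y) \<in> (\<Pi>\<^sub>E i\<in>I. ?A i) \<times> (\<Pi>\<^sub>E i\<in>I. ?B i)"
        by (simp add: space_pair_measure space_PiM PiE_iff) blast
    qed
    have "emeasure (distr (PiM I M \<Otimes>\<^sub>M PiM I M) (PiM I M) ?f) (Pi\<^sub>E I A) =
        emeasure (PiM I M \<Otimes>\<^sub>M PiM I M) ((\<Pi>\<^sub>E i\<in>I. ?A i) \<times> (\<Pi>\<^sub>E i\<in>I. ?B i))"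
      using A fin by (subst emeasure_distr) (auto simp: eq)
    also have "\<dots> = emeasure (PiM I M) (\<Pi>\<^sub>E i\<in>I. ?A i) * emeasure (PiM I M) (\<Pi>\<^sub>E i\<in>I. ?B i)"
      using A fin by (intro P.emeasure_pair_measure_Times sets_PiM_I_finite) auto
    also have "\<dots> = (\<Prod>i\<in>I. emeasure (M i) (?A i)) * (\<Prod>i\<in>I. emeasure (M i) (?B i))"
      using A fin by (subst (1 2) emeasure_PiM) auto
    also have "\<dots> = (\<Prod>i\<in>I. emeasure (M i) (?A i) * emeasure (M i) (?B i))"
      by (rule prod.distrib[symmetric])
    also have "\<dots> = (\<Prod>i\<in>I. emeasure (M i) (A i))"
      by (intro prod.cong) (auto simp: prob_space.emeasure_space_1[OF prob])
    finally show "emeasure (distr (PiM I M \<Otimes>\<^sub>M PiM I M) (PiM I M) ?f) (Pi\<^sub>E I A) =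
        (\<Prod>i\<in>I. emeasure (M i) (A i))" .
  qed simp
qed

text \<open>Independence of the coordinates in \<open>G\<close> from the rest, without splitting the
  index set: by \<open>dep\<close>, evaluating \<open>h\<close> twice at the mixture of two
  independent copies is the same as evaluating it at the pair of copies.\<close>

lemma nn_integral_PiM_decouple:
  assumes fin: "finite I" and prob: "\<And>i. prob_space (M i)"
    and h: "(\<lambda>(x, y). h x y) \<in> borel_measurable (PiM I M \<Otimes>\<^sub>M PiM I M)"
    and dep: "\<And>x y x' y'. (\<And>i. i \<in> I \<inter> G \<Longrightarrow> x i = x' i) \<Longrightarrow> (\<And>i. i \<in> I - G \<Longrightarrow> y i = y' i) \<Longrightarrow>
      h x y = h x' y'"
  shows "(\<integral>\<^sup>+ x. h x x \<partial>PiM I M) = (\<integral>\<^sup>+ x. \<integral>\<^sup>+ y. h x y \<partial>PiM I M \<partial>PiM I M)"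
proof -
  interpret P: prob_space "PiM I M" by (rule prob_space_PiM) (rule prob)
  interpret PP: pair_prob_space "PiM I M" "PiM I M" ..
  let ?f = "\<lambda>(x, y). \<lambda>i\<in>I. if i \<in> G then x i else y i"
  note [measurable] = h
  have "(\<lambda>x. case_prod h (x, x)) \<in> borel_measurable (PiM I M)"
    by measurable
  then have [measurable]: "(\<lambda>x. h x x) \<in> borel_measurable (PiM I M)" by simp
  have "(\<integral>\<^sup>+ x. h x x \<partial>PiM I M) =
      (\<integral>\<^sup>+ x. h x x \<partial>distr (PiM I M \<Otimes>\<^sub>M PiM I M) (PiM I M) ?f)"
    by (simp only: distr_PiM_mix[OF fin prob])
  also have "\<dots> = (\<integral>\<^sup>+ z. h (?f z) (?f z) \<partial>(PiM I M \<Otimes>\<^sub>M PiM I M))"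
    by (rule nn_integral_distr) measurable
  also have "\<dots> = (\<integral>\<^sup>+ z. h (fst z) (snd z) \<partial>(PiM I M \<Otimes>\<^sub>M PiM I M))"
    by (intro nn_integral_cong) (auto intro!: dep split: prod.splits)
  also have "\<dots> = (\<integral>\<^sup>+ x. \<integral>\<^sup>+ y. h x y \<partial>PiM I M \<partial>PiM I M)"
    using P.nn_integral_fst[of "\<lambda>z. h (fst z) (snd z)" "PiM I M"] h by (simp add: case_prod_beta)
  finally show ?thesis .
qed

text \<open>Twice the covariance is the integral of \<open>(f x - f y) * (g x - g y)\<close> over
  two independent copies, and this integrand is nonnegative.\<close>

lemma (in prob_space) chebyshev_correlation:
  fixes f g :: "'a \<Rightarrow> real"
  assumes [measurable]: "f \<in> borel_measurable M" "g \<in> borel_measurable M"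
    and f: "\<And>x. 0 \<le> f x" "\<And>x. f x \<le> 1" and g: "\<And>x. 0 \<le> g x" "\<And>x. g x \<le> 1"
    and fg: "\<And>x y. 0 \<le> (f x - f y) * (g x - g y)"
  shows "expectation f * expectation g \<le> expectation (\<lambda>x. f x * g x)"
proof -
  have [simp]: "integrable M f" "integrable M g"
    using f g by (auto intro!: integrable_const_bound[where B=1])
  have [simp]: "integrable M (\<lambda>x. f x * g x)"
    using f g by (intro integrable_const_bound[where B=1]) (auto simp: abs_mult intro!: mult_le_one)
  have "0 \<le> (\<integral>y. (\<integral>x. (f x - f y) * (g x - g y) \<partial>M) \<partial>M)"
    by (intro integral_nonneg_AE AE_I2 fg)
  also have "\<dots> = (\<integral>y. expectation (\<lambda>x. f x * g x) - g y * expectation f - f y * expectation g + f y * g y \<partial>M)"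
  proof (rule Bochner_Integration.integral_cong[OF refl])
    fix y
    have "(\<lambda>x. (f x - f y) * (g x - g y)) = (\<lambda>x. f x * g x - g y * f x - f y * g x + f y * g y)"
      by (auto simp: algebra_simps)
    then show "(\<integral>x. (f x - f y) * (g x - g y) \<partial>M) =
        expectation (\<lambda>x. f x * g x) - g y * expectation f - f y * expectation g + f y * g y"
      by (simp add: prob_space)
  qed
  also have "\<dots> = 2 * (expectation (\<lambda>x. f x * g x) - expectation f * expectation g)"
    by (simp add: prob_space algebra_simps)
  finally show ?thesis by simp
qed

text \<open>Coordinates are integrated out one at a time. In each, either both sections are
  increasing and \<open>chebyshev_correlation\<close> applies, or the coordinate lies in
  \<open>G\<close> and the section of \<open>g\<close> is constant. Leaving \<open>f\<close>
  arbitrary on \<open>G\<close> makes this the conditional form of the inequality, so that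
  \<open>f\<close> can carry any event about the weights on \<open>S\<close>.\<close>

lemma Harris_inequality:
  fixes M :: "'i \<Rightarrow> real measure" and f g :: "('i \<Rightarrow> real) \<Rightarrow> real"
  assumes fin: "finite I" and prob: "\<And>i. prob_space (M i)" and space: "\<And>i. space (M i) = UNIV"
    and "f \<in> borel_measurable (PiM I M)" "g \<in> borel_measurable (PiM I M)"
    and "\<And>w. 0 \<le> f w" "\<And>w. f w \<le> 1" and "\<And>w. 0 \<le> g w" "\<And>w. g w \<le> 1"
    and "\<And>i x y w. i \<in> I - G \<Longrightarrow> w \<in> extensional I \<Longrightarrow> x \<le> y \<Longrightarrow> f (w(i := x)) \<le> f (w(i := y))"
    and "\<And>i x y w. i \<in> I - G \<Longrightarrow> w \<in> extensional I \<Longrightarrow> x \<le> y \<Longrightarrow> g (w(i := x)) \<le> g (w(i := y))"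
    and "\<And>i x y w. i \<in> I \<inter> G \<Longrightarrow> w \<in> extensional I \<Longrightarrow> g (w(i := x)) = g (w(i := y))"
  shows "(\<integral>w. f w \<partial>PiM I M) * (\<integral>w. g w \<partial>PiM I M) \<le> (\<integral>w. f w * g w \<partial>PiM I M)"
  using fin assms(4-)
proof (induction I arbitrary: f g rule: finite_induct)
  case empty
  interpret P: prob_space "PiM {} M" by (rule prob_space_PiM) (rule prob)
  have eq: "(\<integral>w. h w \<partial>PiM {} M) = h (\<lambda>_. undefined)" for h :: "('i \<Rightarrow> real) \<Rightarrow> real"
  proof -
    have "(\<integral>w. h w \<partial>PiM {} M) = (\<integral>w. h (\<lambda>_. undefined) \<partial>PiM {} M)"
      by (intro Bochner_Integration.integral_cong) (auto simp: space_PiM)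
    then show ?thesis by (simp add: P.prob_space)
  qed
  show ?case by (simp only: eq)
next
  case (insert i I)
  interpret Mi: prob_space "M i" by (rule prob)
  interpret PI: prob_space "PiM I M" by (rule prob_space_PiM) (rule prob)
  interpret product_prob_space M I
    by (intro product_prob_spaceI prob)
  interpret PiI: prob_space "PiM (insert i I) M" by (rule prob_space_PiM) (rule prob)
  note f = insert.prems(3,4) and g = insert.prems(5,6)
  have meas: "f \<in> borel_measurable (PiM (insert i I) M)" "g \<in> borel_measurable (PiM (insert i I) M)"
    "(\<lambda>w. f w * g w) \<in> borel_measurable (PiM (insert i I) M)"
    using insert.prems(1,2) by auto
  have fg: "0 \<le> f w * g w" "f w * g w \<le> 1" for w
    using f g by (auto intro!: mult_le_one)
  have ext: "w \<in> extensional I \<longleftrightarrow> w \<in> space (PiM I M)" for w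
    by (auto simp: space_PiM space PiE_def)
  have ext_upd: "w(j := x) \<in> extensional I" if "w \<in> extensional I" "j \<in> I" for w j and x :: real
    using that by (auto simp: extensional_def)
  have ext_ins: "w \<in> extensional (insert i I)" if "w \<in> extensional I" for w :: "'i \<Rightarrow> real"
    using that by (auto simp: extensional_def)
  have slice: "integrable (M i) (\<lambda>x. h (w(i := x)))"
    if h: "h \<in> borel_measurable (PiM (insert i I) M)" "\<And>w. 0 \<le> h w" "\<And>w. h w \<le> 1"
      and w: "w \<in> extensional I"
    for w and h :: "('i \<Rightarrow> real) \<Rightarrow> real"
  proof -
    have "(\<lambda>x. w(i := x)) \<in> M i \<rightarrow>\<^sub>M PiM (insert i I) M"
      using w unfolding ext by (intro measurable_fun_upd[where J=I]) auto
    from measurable_compose[OF this h(1)] show ?thesis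
      using h by (intro Mi.integrable_const_bound[where B=1]) auto
  qed
  have joint: "(\<lambda>w. \<integral>x. h (w(i := x)) \<partial>M i) \<in> borel_measurable (PiM I M)"
    if "h \<in> borel_measurable (PiM (insert i I) M)" for h :: "('i \<Rightarrow> real) \<Rightarrow> real"
  proof (rule Mi.borel_measurable_lebesgue_integral)
    show "(\<lambda>(w, x). h (w(i := x))) \<in> borel_measurable (PiM I M \<Otimes>\<^sub>M M i)"
      using measurable_compose[OF measurable_add_dim that] by (simp add: case_prod_beta)
  qed
  \<comment> \<open>The bounds 0 and 1 are required at every function, but sections are known to be
    measurable only at extensional ones; the value 0 elsewhere keeps the hypotheses of the induction
    satisfied.\<close>
  define F where "F w = (if w \<in> extensional I then \<integral>x. f (w(i := x)) \<partial>M i else 0)" for w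
  define H where "H w = (if w \<in> extensional I then \<integral>x. g (w(i := x)) \<partial>M i else 0)" for w
  have F_meas: "F \<in> borel_measurable (PiM I M)"
    unfolding F_def ext by (subst measurable_cong[where g="\<lambda>w. \<integral>x. f (w(i := x)) \<partial>M i"]) (auto intro: joint meas)
  have H_meas: "H \<in> borel_measurable (PiM I M)"
    unfolding H_def ext by (subst measurable_cong[where g="\<lambda>w. \<integral>x. g (w(i := x)) \<partial>M i"]) (auto intro: joint meas)
  have bound: "0 \<le> (\<integral>x. h (w(i := x)) \<partial>M i)" "(\<integral>x. h (w(i := x)) \<partial>M i) \<le> 1"
    if "h \<in> borel_measurable (PiM (insert i I) M)" "\<And>w. 0 \<le> h w" "\<And>w. h w \<le> 1" "w \<in> extensional I"
    for w and h :: "('i \<Rightarrow> real) \<Rightarrow> real"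
  proof -
    show "0 \<le> (\<integral>x. h (w(i := x)) \<partial>M i)" using that by (intro integral_nonneg_AE) auto
    have "(\<integral>x. h (w(i := x)) \<partial>M i) \<le> (\<integral>x. 1 \<partial>M i)"
      using that slice[of h w] by (intro integral_mono) auto
    then show "(\<integral>x. h (w(i := x)) \<partial>M i) \<le> 1" by (simp add: Mi.prob_space)
  qed
  have IH: "(\<integral>w. F w \<partial>PiM I M) * (\<integral>w. H w \<partial>PiM I M) \<le> (\<integral>w. F w * H w \<partial>PiM I M)"
  proof (rule insert.IH[OF F_meas H_meas])
    show "0 \<le> F w" "F w \<le> 1" "0 \<le> H w" "H w \<le> 1" for w
      by (auto simp: F_def H_def intro!: bound meas f g)
  next
    fix j and x y :: real and w :: "'i \<Rightarrow> real"
    assume j: "j \<in> I - G" and w: "w \<in> extensional I" and xy: "x \<le> y"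
    then have ji: "j \<noteq> i" "j \<in> I" using insert.hyps by auto
    have upd: "w(j := z, i := t) = (w(i := t))(j := z)" for z t
      using ji by (auto simp: fun_eq_iff)
    have ext': "w(i := t) \<in> extensional (insert i I)" for t
      using w by (auto simp: extensional_def)
    have "f (w(j := x, i := t)) \<le> f (w(j := y, i := t))"
      "g (w(j := x, i := t)) \<le> g (w(j := y, i := t))" for t
      unfolding upd using j by (intro insert.prems(7,8) ext' xy; auto)+
    then show "F (w(j := x)) \<le> F (w(j := y))" "H (w(j := x)) \<le> H (w(j := y))"
      using ext_upd[OF w ji(2)] unfolding F_def H_def
      by (auto simp del: fun_upd_apply intro!: integral_mono slice meas f g)
  next
    fix j and x y :: real and w :: "'i \<Rightarrow> real"
    assume j: "j \<in> I \<inter> G" and w: "w \<in> extensional I"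
    then have ji: "j \<noteq> i" "j \<in> I" using insert.hyps by auto
    have upd: "w(j := z, i := t) = (w(i := t))(j := z)" for z t
      using ji by (auto simp: fun_eq_iff)
    have ext': "w(i := t) \<in> extensional (insert i I)" for t
      using w by (auto simp: extensional_def)
    have "g (w(j := x, i := t)) = g (w(j := y, i := t))" for t
      unfolding upd using j by (intro insert.prems(9) ext'; auto)
    then show "H (w(j := x)) = H (w(j := y))"
      using ext_upd[OF w ji(2)] unfolding H_def by simp
  qed
  have step: "F w * H w \<le> (\<integral>x. f (w(i := x)) * g (w(i := x)) \<partial>M i)" if w: "w \<in> extensional I" for w
  proof -
    have cov: "0 \<le> (f (w(i := x)) - f (w(i := y))) * (g (w(i := x)) - g (w(i := y)))" for x y
    proof (cases "i \<in> G")
      case True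
      then have "g (w(i := x)) = g (w(i := y))"
        by (intro insert.prems(9) ext_ins w) auto
      then show ?thesis by simp
    next
      case False
      then have i: "i \<in> insert i I - G" by auto
      show ?thesis
      proof (cases "x \<le> y")
        case True
        note m = insert.prems(7,8)[OF i ext_ins[OF w] True]
        show ?thesis by (intro mult_nonpos_nonpos) (simp_all only: diff_le_0_iff_le m)
      next
        case False
        then have "y \<le> x" by simp
        note m = insert.prems(7,8)[OF i ext_ins[OF w] this]
        show ?thesis by (intro mult_nonneg_nonneg) (simp_all only: diff_ge_0_iff_ge m)
      qed
    qed
    show ?thesis
      using w unfolding F_def H_def
      by (auto intro!: Mi.chebyshev_correlation f g cov
          borel_measurable_integrable[OF slice] meas)
  qed
  have int: "integrable (PiM (insert i I) M) h"
    if "h \<in> borel_measurable (PiM (insert i I) M)" "\<And>w. 0 \<le> h w" "\<And>w. h w \<le> 1"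
    for h :: "('i \<Rightarrow> real) \<Rightarrow> real"
    using that by (intro PiI.integrable_const_bound[where B=1]) auto
  have fold: "(\<integral>w. h w \<partial>PiM (insert i I) M) = (\<integral>w. \<integral>x. h (w(i := x)) \<partial>M i \<partial>PiM I M)"
    if "h \<in> borel_measurable (PiM (insert i I) M)" "\<And>w. 0 \<le> h w" "\<And>w. h w \<le> 1"
    for h :: "('i \<Rightarrow> real) \<Rightarrow> real"
    using insert.hyps int[OF that] by (intro product_integral_insert) auto
  have FH: "0 \<le> F w" "F w \<le> 1" "0 \<le> H w" "H w \<le> 1" for w
    by (auto simp: F_def H_def intro!: bound meas f g)
  have "(\<integral>w. f w \<partial>PiM (insert i I) M) * (\<integral>w. g w \<partial>PiM (insert i I) M) =
      (\<integral>w. F w \<partial>PiM I M) * (\<integral>w. H w \<partial>PiM I M)"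
    unfolding fold[OF meas(1) f] fold[OF meas(2) g]
    by (intro arg_cong2[where f="(*)"] Bochner_Integration.integral_cong) (auto simp: F_def H_def ext)
  also note IH
  also have "(\<integral>w. F w * H w \<partial>PiM I M) \<le> (\<integral>w. \<integral>x. f (w(i := x)) * g (w(i := x)) \<partial>M i \<partial>PiM I M)"
  proof (rule integral_mono)
    show "integrable (PiM I M) (\<lambda>w. F w * H w)"
      using F_meas H_meas FH
      by (intro PI.integrable_const_bound[where B=1]) (auto simp: abs_mult intro!: mult_le_one)
    show "integrable (PiM I M) (\<lambda>w. \<integral>x. f (w(i := x)) * g (w(i := x)) \<partial>M i)"
      using joint[OF meas(3)] bound[OF meas(3) fg]
      by (intro PI.integrable_const_bound[where B=1]) (auto simp: ext[symmetric])
  qed (use step in \<open>auto simp: ext\<close>)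
  also have "\<dots> = (\<integral>w. f w * g w \<partial>PiM (insert i I) M)"
    by (rule fold[OF meas(3) fg, symmetric])
  finally show ?case .
qed

section \<open>Small sums of exponential weights\<close>

lemma measurable_weights_component:
  "e \<in> E \<Longrightarrow> (\<lambda>w. w e) \<in> borel_measurable (weights E)"
  using measurable_component_singleton[of e E "\<lambda>_. density lborel (exponential_density 1)"]
  by (simp add: weights_def)

text \<open>A nonempty sum of \<open>m\<close> independent exponentials has the Erlang density,
  which is at most \<open>x ^ (m - 1) / fact (m - 1)\<close> because its exponential factor is at
  most 1; integrating this majorant gives the power.\<close>

lemma measure_weights_sum_le:
  assumes fin: "finite E" and H: "H \<subseteq> E" and t: "0 \<le> t"
  shows "measure (weights E) {w \<in> space (weights E). (\<Sum>e\<in>H. w e) \<le> t} \<le> t ^ card H / fact (card H)"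
proof (cases "H = {}")
  case True
  interpret prob_space "weights E" by (rule prob_space_weights)
  from True show ?thesis by simp
next
  case False
  interpret prob_space "weights E" by (rule prob_space_weights)
  let ?D = "density lborel (exponential_density 1)"
  have D: "prob_space ?D" by (rule prob_space_exponential_density) simp
  have comp: "distr (weights E) borel (\<lambda>w. w e) = ?D" if "e \<in> E" for e
  proof -
    have "distr (weights E) borel (\<lambda>w. w e) = distr (weights E) ?D (\<lambda>w. w e)"
      by (intro distr_cong) auto
    also have "\<dots> = ?D" unfolding weights_def using D that by (intro distr_PiM_component)
    finally show ?thesis .
  qed
  have "indep_vars (\<lambda>_. borel) (\<lambda>e w. w e) E"
  proof (subst indep_vars_iff_distr_eq_PiM')
    show "E \<noteq> {}" using False H by auto
    have "distr (weights E) (PiM E (\<lambda>_. borel)) (\<lambda>w. \<lambda>e\<in>E. w e) = distr (weights E) (weights E) (\<lambda>w. w)"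
      by (intro distr_cong) (auto simp: weights_def space_PiM intro!: sets_PiM_cong)
    also have "\<dots> = weights E" by simp
    also have "\<dots> = PiM E (\<lambda>e. distr (weights E) borel (\<lambda>w. w e))"
      unfolding weights_def by (intro PiM_cong) (auto simp: comp[unfolded weights_def])
    finally show "distr (weights E) (PiM E (\<lambda>_. borel)) (\<lambda>w. \<lambda>e\<in>E. w e) =
      PiM E (\<lambda>e. distr (weights E) borel (\<lambda>w. w e))" .
  qed (auto intro: measurable_weights_component)
  then have ind: "indep_vars (\<lambda>_. borel) (\<lambda>e w. w e) H"
    using H by (rule indep_vars_subset)
  have "distributed (weights E) lborel (\<lambda>w. \<Sum>e\<in>H. w e) (erlang_density (card H - 1) 1)"
  proof (rule exponential_distributed_sum[OF _ False _ _ ind])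
    show "finite H" using fin H by (rule finite_subset[rotated])
    fix e assume "e \<in> H"
    then have e: "e \<in> E" using H by auto
    show "distributed (weights E) lborel (\<lambda>w. w e) (exponential_density 1)"
      unfolding distributed_def using comp[OF e] e
      by (auto simp: measurable_lborel1 measurable_weights_component cong: distr_cong)
  qed simp
  then have "emeasure (weights E) ((\<lambda>w. \<Sum>e\<in>H. w e) -` {..t} \<inter> space (weights E)) =
      (\<integral>\<^sup>+x. ennreal (erlang_density (card H - 1) 1 x) * indicator {..t} x \<partial>lborel)"
    by (rule distributed_emeasure) simp
  also have "\<dots> \<le> (\<integral>\<^sup>+x. ennreal (x ^ (card H - 1) / fact (card H - 1)) * indicator {0..t} x \<partial>lborel)"
    by (intro nn_integral_mono)
      (auto simp: erlang_density_def divide_right_mono mult_left_le split: split_indicator intro!: ennreal_leI)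
  also have "\<dots> = ennreal (t ^ card H / fact (card H) - 0 ^ card H / fact (card H))"
  proof (rule nn_integral_FTC_Icc)
    obtain m where m: "card H = Suc m"
      using False finite_subset[OF H fin] by (cases "card H") auto
    show "((\<lambda>x. x ^ card H / fact (card H)) has_real_derivative x ^ (card H - 1) / fact (card H - 1)) (at x)"
      for x :: real
    proof -
      have "real (Suc m) * x ^ m / fact (Suc m) = x ^ m / fact m"
        by (simp add: fact_Suc del: of_nat_Suc)
      moreover have "((\<lambda>x. x ^ Suc m / fact (Suc m)) has_real_derivative real (Suc m) * x ^ m / fact (Suc m)) (at x)"
        using DERIV_pow[of "Suc m" x UNIV] by (intro DERIV_cdivide) (simp del: of_nat_Suc)
      ultimately show ?thesis unfolding m by simp
    qed
  qed (use t in auto)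
  also have "\<dots> = ennreal (t ^ card H / fact (card H))"
    using False finite_subset[OF H fin] by (simp add: zero_power card_gt_0_iff)
  finally have "emeasure (weights E) {w \<in> space (weights E). (\<Sum>e\<in>H. w e) \<le> t} \<le>
      ennreal (t ^ card H / fact (card H))"
    by (simp add: vimage_def Int_def conj_commute)
  then show ?thesis
    using t by (simp add: emeasure_eq_measure)
qed

text \<open>Positions of points lie in \<open>{0<..c0}\<close>, so a light cycle is a point of the
  process only if its weight is positive. This makes the distinction a null event.\<close>

lemma AE_weights_pos:
  assumes "finite E"
  shows "AE w in weights E. \<forall>e\<in>E. 0 < w e"
proof -
  have "AE x in density lborel (exponential_density 1). 0 < x"
    by (subst AE_density) (auto simp: exponential_density_def erlang_density_def AE_lborel_singleton
      intro: AE_mp[OF AE_lborel_singleton[of 0]])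
  then show ?thesis
    unfolding weights_def using assms
    by (intro AE_ball_countable[THEN iffD2] countable_finite ballI AE_PiM_component
        prob_space_exponential_density) auto
qed

section \<open>Existence of Poisson processes\<close>

lemma config_space_cong: "sets S = sets T \<Longrightarrow> config_space S = config_space T"
  unfolding config_space_def by (simp add: sets_eq_imp_space_eq[of S T])

lemma measurable_config_spaceI:
  assumes "\<And>x. x \<in> space M \<Longrightarrow> set_mset (f x) \<subseteq> space S"
    and "\<And>B. B \<in> sets S \<Longrightarrow> (\<lambda>x. points B (f x)) \<in> M \<rightarrow>\<^sub>M count_space UNIV"
  shows "f \<in> M \<rightarrow>\<^sub>M config_space S"
  unfolding config_space_def
proof (rule measurable_measure_of)
  show "f \<in> space M \<rightarrow> {N. set_mset N \<subseteq> space S}" using assms(1) by auto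
  fix A assume "A \<in> {{N. set_mset N \<subseteq> space S \<and> points B N = k} |B k. B \<in> sets S}"
  then obtain B k where A: "A = {N. set_mset N \<subseteq> space S \<and> points B N = k}" and B: "B \<in> sets S"
    by auto
  have "f -` A \<inter> space M = (\<lambda>x. points B (f x)) -` {k} \<inter> space M"
    using assms(1) by (auto simp: A)
  then show "f -` A \<inter> space M \<in> sets M"
    using measurable_sets[OF assms(2)[OF B]] by simp
qed auto

lemma sets_counts:
  assumes J: "finite J" and B: "\<And>i. i \<in> J \<Longrightarrow> B i \<in> sets S"
  shows "{N \<in> space (config_space S). \<forall>i\<in>J. points (B i) N = k i} \<in> sets (config_space S)"
proof -
  note [measurable] = measurable_points[OF B]
  have [measurable]: "Measurable.pred (config_space S) (\<lambda>N. points (B i) N = k i)" if "i \<in> J" for i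
    using that by measurable
  show ?thesis using J by measurable
qed

lemma points_empty [simp]: "points B {#} = 0"
  by (simp add: points_def)

lemma points_add_mset: "points B (add_mset z N) = (if z \<in> B then 1 else 0) + points B N"
  by (simp add: points_def)

lemma measurable_add_mset [measurable]:
  "(\<lambda>(z, N). add_mset z N) \<in> S \<Otimes>\<^sub>M config_space S \<rightarrow>\<^sub>M config_space S"
proof (rule measurable_config_spaceI)
  fix B assume [measurable]: "B \<in> sets S"
  note [measurable] = measurable_points[OF \<open>B \<in> sets S\<close>]
  show "(\<lambda>x. points B (case x of (z, N) \<Rightarrow> add_mset z N)) \<in> S \<Otimes>\<^sub>M config_space S \<rightarrow>\<^sub>M count_space UNIV"
    unfolding case_prod_beta points_add_mset by measurable
qed (auto simp: space_pair_measure space_config_space)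

lemma measurable_add_mset' [measurable (raw)]:
  "f \<in> M \<rightarrow>\<^sub>M S \<Longrightarrow> g \<in> M \<rightarrow>\<^sub>M config_space S \<Longrightarrow> (\<lambda>x. add_mset (f x) (g x)) \<in> M \<rightarrow>\<^sub>M config_space S"
  using measurable_compose[OF measurable_Pair measurable_add_mset, of f M S g] by simp

text \<open>
  \<open>poisson_layer \<Lambda> m\<close> is the image of the \<open>m\<close>-th power of \<open>\<Lambda>\<close> on multisets. It is not normalised, so
  that \<open>\<Lambda> = 0\<close> needs no separate treatment.
\<close>

fun poisson_layer :: "'a measure \<Rightarrow> nat \<Rightarrow> 'a multiset measure" where
  "poisson_layer \<Lambda> 0 = return (config_space \<Lambda>) {#}"
| "poisson_layer \<Lambda> (Suc m) = distr (\<Lambda> \<Otimes>\<^sub>M poisson_layer \<Lambda> m) (config_space \<Lambda>) (\<lambda>(z, N). add_mset z N)"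

text \<open>For finite \<open>\<Lambda>\<close>, a Poisson number of independent points with the
  normalised law: the layer has total mass \<open>measure \<Lambda> (space \<Lambda>) ^ m\<close>,
  which supplies the power missing from the Poisson probabilities.\<close>

definition poisson_law :: "'a measure \<Rightarrow> 'a multiset measure" where
  "poisson_law \<Lambda> = measure_of (space (config_space \<Lambda>)) (sets (config_space \<Lambda>))
     (\<lambda>A. \<Sum>m. ennreal (exp (- measure \<Lambda> (space \<Lambda>)) / fact m) * emeasure (poisson_layer \<Lambda> m) A)"

lemma sets_poisson_layer [simp, measurable_cong]: "sets (poisson_layer \<Lambda> m) = sets (config_space \<Lambda>)"
  by (cases m) auto

lemma space_poisson_layer [simp]: "space (poisson_layer \<Lambda> m) = space (config_space \<Lambda>)"
  by (rule sets_eq_imp_space_eq) simp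

lemma sets_poisson_law [simp, measurable_cong]: "sets (poisson_law \<Lambda>) = sets (config_space \<Lambda>)"
  unfolding poisson_law_def by simp

lemma space_poisson_law [simp]: "space (poisson_law \<Lambda>) = space (config_space \<Lambda>)"
  by (rule sets_eq_imp_space_eq) simp

lemma emeasure_poisson_law:
  assumes "A \<in> sets (config_space \<Lambda>)"
  shows "emeasure (poisson_law \<Lambda>) A =
    (\<Sum>m. ennreal (exp (- measure \<Lambda> (space \<Lambda>)) / fact m) * emeasure (poisson_layer \<Lambda> m) A)"
  unfolding poisson_law_def
proof (rule emeasure_measure_of_sigma[OF _ _ _ assms])
  let ?\<mu> = "\<lambda>A. \<Sum>m. ennreal (exp (- measure \<Lambda> (space \<Lambda>)) / fact m) * emeasure (poisson_layer \<Lambda> m) A"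
  show "sigma_algebra (space (config_space \<Lambda>)) (sets (config_space \<Lambda>))" ..
  show "positive (sets (config_space \<Lambda>)) ?\<mu>" by (simp add: positive_def)
  show "countably_additive (sets (config_space \<Lambda>)) ?\<mu>"
  proof (rule countably_additiveI)
    fix A :: "nat \<Rightarrow> 'a multiset set" assume A: "range A \<subseteq> sets (config_space \<Lambda>)" "disjoint_family A"
    let ?c = "\<lambda>m. ennreal (exp (- measure \<Lambda> (space \<Lambda>)) / fact m)"
    have "(\<Sum>i. ?\<mu> (A i)) = (\<Sum>m. \<Sum>i. ?c m * emeasure (poisson_layer \<Lambda> m) (A i))"
      unfolding nn_integral_count_space_nat[symmetric]
      by (rule pair_sigma_finite.Fubini')
        (auto intro!: pair_sigma_finite.intro sigma_finite_measure_count_space simp: case_prod_beta)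
    also have "\<dots> = ?\<mu> (\<Union>i. A i)"
      using A by (intro suminf_cong) (simp add: suminf_emeasure)
    finally show "(\<Sum>i. ?\<mu> (A i)) = ?\<mu> (\<Union>i. A i)" .
  qed
qed

context finite_measure
begin

lemma finite_poisson_layer: "finite_measure (poisson_layer M m)"
proof (induction m)
  case 0
  interpret prob_space "return (config_space M) {#}"
    by (rule prob_space_return) (simp add: space_config_space)
  show ?case by simp unfold_locales
next
  case (Suc m)
  interpret L: finite_measure "poisson_layer M m" by fact
  interpret P: pair_sigma_finite M "poisson_layer M m" ..
  have "finite_measure (M \<Otimes>\<^sub>M poisson_layer M m)"
    using emeasure_finite[of "space M"] L.emeasure_finite[of "space (poisson_layer M m)"]
    by (intro finite_measureI)
      (simp add: space_pair_measure L.emeasure_pair_measure_Times ennreal_mult_eq_top_iff less_top)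
  then show ?case
    by (auto intro!: finite_measure.finite_measure_distr)
qed

text \<open>The recursion on the newest point. Both the counts in blocks and the bound for separated
  configurations are obtained by induction along it.\<close>

lemma emeasure_poisson_layer_Suc:
  assumes A: "A \<in> sets (config_space M)"
  shows "emeasure (poisson_layer M (Suc m)) A =
    (\<integral>\<^sup>+ z. emeasure (poisson_layer M m) {N \<in> space (config_space M). add_mset z N \<in> A} \<partial>M)"
proof -
  interpret L: finite_measure "poisson_layer M m" by (rule finite_poisson_layer)
  let ?X = "(\<lambda>(z, N). add_mset z N) -` A \<inter> space (M \<Otimes>\<^sub>M poisson_layer M m)"
  have f: "(\<lambda>(z, N). add_mset z N) \<in> M \<Otimes>\<^sub>M poisson_layer M m \<rightarrow>\<^sub>M config_space M"
    by measurable
  have "emeasure (poisson_layer M (Suc m)) A = emeasure (M \<Otimes>\<^sub>M poisson_layer M m) ?X"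
    using A f by (simp add: emeasure_distr)
  also have "\<dots> = (\<integral>\<^sup>+ z. emeasure (poisson_layer M m) (Pair z -` ?X) \<partial>M)"
    by (rule L.emeasure_pair_measure_alt) (use measurable_sets[OF f A] in simp)
  also have "\<dots> = (\<integral>\<^sup>+ z. emeasure (poisson_layer M m) {N \<in> space (config_space M). add_mset z N \<in> A} \<partial>M)"
    by (intro nn_integral_cong arg_cong[where f="emeasure (poisson_layer M m)"])
      (auto simp: space_pair_measure)
  finally show ?thesis .
qed

text \<open>The induction step of a multinomial count. A new point falls into block
  \<open>i\<close>, of mass \<open>b i\<close>, and uses up one of the \<open>k i\<close> points
  there, or into the rest, of mass \<open>r\<close>. Since \<open>b i\<close> times the lowered
  coefficient is \<open>k i * c k\<close>, only a relation for \<open>q\<close> remains.\<close>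

lemma poisson_coefficient_step:
  fixes b :: "'i \<Rightarrow> real" and r :: real and k :: "'i \<Rightarrow> nat"
  assumes J: "finite J"
  defines "c \<equiv> \<lambda>k :: 'i \<Rightarrow> nat. \<Prod>i\<in>J. b i ^ k i / fact (k i)"
    and "q \<equiv> \<lambda>m K. if K \<le> m then r ^ (m - K) / fact (m - K) else 0"
  shows "(\<Sum>i\<in>J. b i * (if k i = 0 then 0 else fact m * c (k(i := k i - 1)) * q m (sum (k(i := k i - 1)) J)))
      + r * (fact m * c k * q m (sum k J))
    = fact (Suc m) * c k * q (Suc m) (sum k J)"
proof -
  let ?K = "sum k J"
  have summand: "b i * (if k i = 0 then 0 else fact m * c (k(i := k i - 1)) * q m (sum (k(i := k i - 1)) J))
      = fact m * c k * (real (k i) * q m (?K - 1))" if i: "i \<in> J" for i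
  proof (cases "k i = 0")
    case False
    then obtain l where l: "k i = Suc l" by (cases "k i") auto
    have c: "c h = b i ^ h i / fact (h i) * (\<Prod>j\<in>J - {i}. b j ^ h j / fact (h j))" for h
      unfolding c_def using J i by (rule prod.remove)
    have "(\<Prod>j\<in>J - {i}. b j ^ (k(i := k i - 1)) j / fact ((k(i := k i - 1)) j)) =
        (\<Prod>j\<in>J - {i}. b j ^ k j / fact (k j))"
      by (intro prod.cong) auto
    then have "b i * c (k(i := k i - 1)) = real (k i) * c k"
      unfolding c[of k] c[of "k(i := k i - 1)"] by (simp add: l field_simps fact_Suc del: of_nat_Suc)
    moreover have "sum (k(i := k i - 1)) J = ?K - 1"
    proof -
      have s: "sum h J = h i + sum h (J - {i})" for h :: "'i \<Rightarrow> nat"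
        using J i by (rule sum.remove)
      have "sum (k(i := k i - 1)) (J - {i}) = sum k (J - {i})" by (intro sum.cong) auto
      then show ?thesis unfolding s[of k] s[of "k(i := k i - 1)"] using l by simp
    qed
    ultimately show ?thesis using False by (simp add: mult_ac)
  qed simp
  have "(\<Sum>i\<in>J. b i * (if k i = 0 then 0 else fact m * c (k(i := k i - 1)) * q m (sum (k(i := k i - 1)) J)))
      = fact m * c k * (real ?K * q m (?K - 1))"
    by (simp add: summand sum_distrib_left[symmetric] sum_distrib_right[symmetric])
  \<comment> \<open>The \<open>?K\<close> points in the blocks and the \<open>Suc m - ?K\<close>
    points outside add up to \<open>Suc m\<close>; at the boundary \<open>?K = Suc m\<close> only
    the first term survives.\<close>
  moreover have "real ?K * q m (?K - 1) + r * q m ?K = real (Suc m) * q (Suc m) ?K"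
  proof -
    consider "?K = 0" | "?K > 0" "?K \<le> m" | "?K = Suc m" | "?K > Suc m" by linarith
    then show ?thesis
    proof cases
      case 1
      then show ?thesis by (simp add: q_def fact_Suc del: of_nat_Suc)
    next
      case 2
      then obtain d where d: "m = ?K + d" using le_Suc_ex by blast
      have e: "m - (?K - 1) = Suc d" "Suc m - ?K = Suc d" "m - ?K = d" "?K - 1 \<le> m" "?K \<le> Suc m"
        using d 2 by auto
      have "r * (r ^ d / fact d) = real (Suc d) * (r ^ Suc d / fact (Suc d))"
        by (simp add: fact_Suc del: of_nat_Suc)
      then have "real ?K * (r ^ Suc d / fact (Suc d)) + r * (r ^ d / fact d) =
          (real ?K + real (Suc d)) * (r ^ Suc d / fact (Suc d))"
        by (simp only: distrib_right)
      also have "real ?K + real (Suc d) = real (Suc m)" using d by simp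
      finally show ?thesis unfolding q_def using e 2 by (simp only: if_True)
    qed (auto simp: q_def)
  qed
  ultimately have "(\<Sum>i\<in>J. b i * (if k i = 0 then 0 else fact m * c (k(i := k i - 1)) * q m (sum (k(i := k i - 1)) J)))
      + r * (fact m * c k * q m ?K) = fact m * c k * (real (Suc m) * q (Suc m) ?K)"
    by (simp add: distrib_left[symmetric] mult.left_commute[of r])
  then show ?thesis by (simp add: fact_Suc mult_ac)
qed

text \<open>The multinomial formula for \<open>m\<close> unnormalised points, the complement of the
  blocks counting as one more block. Without the guard \<open>sum k J \<le> m\<close>, truncated
  subtraction would turn the last factor into 1 for impossible counts.\<close>

lemma emeasure_poisson_layer_counts:
  fixes B :: "'i \<Rightarrow> 'a set" and k :: "'i \<Rightarrow> nat"
  assumes J: "finite J" and B: "\<And>i. i \<in> J \<Longrightarrow> B i \<in> sets M" and disj: "disjoint_family_on B J"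
  defines "r \<equiv> measure M (space M - (\<Union>i\<in>J. B i))"
  shows "emeasure (poisson_layer M m) {N \<in> space (config_space M). \<forall>i\<in>J. points (B i) N = k i} =
    ennreal (fact m * (\<Prod>i\<in>J. measure M (B i) ^ k i / fact (k i)) *
      (if sum k J \<le> m then r ^ (m - sum k J) / fact (m - sum k J) else 0))"
proof -
  define b where "b i = measure M (B i)" for i
  define c where "c k = (\<Prod>i\<in>J. b i ^ k i / fact (k i))" for k :: "'i \<Rightarrow> nat"
  define q where "q m K = (if K \<le> m then r ^ (m - K) / fact (m - K) else 0)" for m K :: nat
  have nonneg: "0 \<le> c k" "0 \<le> q m K" "0 \<le> b i" "0 \<le> r" for k m K i
    by (auto simp: c_def q_def b_def r_def intro!: prod_nonneg)
  let ?E = "\<lambda>k. {N \<in> space (config_space M). \<forall>i\<in>J. points (B i) N = k i}"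
  have E: "?E k \<in> sets (config_space M)" for k using J B by (rule sets_counts)
  let ?R = "space M - (\<Union>i\<in>J. B i)"
  have R: "?R \<in> sets M" using J B by auto
  have "emeasure (poisson_layer M m) (?E k) = ennreal (fact m * c k * q m (sum k J))" for k
  proof (induction m arbitrary: k)
    case 0
    show ?case
    proof (cases "\<forall>i\<in>J. k i = 0")
      case True
      then show ?thesis using E[of k]
        by (auto simp: c_def q_def space_config_space indicator_def)
    next
      case False
      then have "sum k J \<noteq> 0" using J by (subst sum_eq_0_iff) auto
      moreover have "{#} \<notin> ?E k" using False by (auto simp: space_config_space)
      ultimately show ?thesis using E[of k]
        by (simp add: q_def)
    qed
  next
    case (Suc m)
    define F where "F k = emeasure (poisson_layer M m) (?E k)" for k
    \<comment> \<open>By disjointness the new point lies in at most one block, so at most one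
      indicator is nonzero; a block that has to stay empty cannot receive it.\<close>
    have slice: "emeasure (poisson_layer M m) {N \<in> space (config_space M). add_mset z N \<in> ?E k} =
        (\<Sum>i\<in>J. (if k i = 0 then 0 else F (k(i := k i - 1))) * indicator (B i) z) + F k * indicator ?R z"
      (is "?l = ?s + ?t")
      if z: "z \<in> space M" for z
    proof (cases "\<exists>i\<in>J. z \<in> B i")
      case True
      then obtain i where i: "i \<in> J" "z \<in> B i" by auto
      have other: "z \<notin> B j" if "j \<in> J" "j \<noteq> i" for j
        using disj i that by (auto simp: disjoint_family_on_def)
      have "?s = (\<Sum>j\<in>J. if j = i then (if k i = 0 then 0 else F (k(i := k i - 1))) else 0)"
        using i other by (intro sum.cong) (auto simp: indicator_def)
      also have "\<dots> = (if k i = 0 then 0 else F (k(i := k i - 1)))"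
        using J i by simp
      also have "\<dots> = ?l"
      proof -
        have pts: "points (B j) (add_mset z N) = (if j = i then Suc (points (B i) N) else points (B j) N)"
          if "j \<in> J" for j N
          using i other[OF that] by (auto simp: points_add_mset)
        have "(\<forall>j\<in>J. points (B j) (add_mset z N) = k j) \<longleftrightarrow>
            k i \<noteq> 0 \<and> (\<forall>j\<in>J. points (B j) N = (k(i := k i - 1)) j)" for N
          using i by (auto simp: pts)
        then have "{N \<in> space (config_space M). add_mset z N \<in> ?E k} = (if k i = 0 then {} else ?E (k(i := k i - 1)))"
          using z by (auto simp: space_config_space simp del: fun_upd_apply)
        then show ?thesis by (simp add: F_def)
      qed
      finally have "?s = ?l" .
      moreover have "indicator ?R z = (0 :: ennreal)" using i unfolding indicator_def by auto
      ultimately show ?thesis by (simp only: mult_zero_right add_0_right)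
    next
      case False
      then have "{N \<in> space (config_space M). add_mset z N \<in> ?E k} = ?E k"
        using z by (auto simp: points_add_mset space_config_space)
      then show ?thesis using False z by (simp add: F_def)
    qed
    have "emeasure (poisson_layer M (Suc m)) (?E k) =
        (\<integral>\<^sup>+ z. (\<Sum>i\<in>J. (if k i = 0 then 0 else F (k(i := k i - 1))) * indicator (B i) z) + F k * indicator ?R z \<partial>M)"
      unfolding emeasure_poisson_layer_Suc[OF E] by (intro nn_integral_cong slice)
    also have "\<dots> = (\<Sum>i\<in>J. (if k i = 0 then 0 else F (k(i := k i - 1))) * emeasure M (B i)) + F k * emeasure M ?R"
      using B R by (subst nn_integral_add) (auto simp: nn_integral_sum nn_integral_cmult_indicator)
    also have "\<dots> = ennreal ((\<Sum>i\<in>J. b i * (if k i = 0 then 0 else fact m * c (k(i := k i - 1)) * q m (sum (k(i := k i - 1)) J)))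
      + r * (fact m * c k * q m (sum k J)))"
    proof -
      have "(if k i = 0 then 0 else F (k(i := k i - 1))) * emeasure M (B i) =
        ennreal (b i * (if k i = 0 then 0 else fact m * c (k(i := k i - 1)) * q m (sum (k(i := k i - 1)) J)))" for i
        using nonneg unfolding F_def Suc.IH by (simp add: emeasure_eq_measure b_def[symmetric] ennreal_mult'[symmetric] mult_ac)
      moreover have "F k * emeasure M ?R = ennreal (r * (fact m * c k * q m (sum k J)))"
        using nonneg unfolding F_def Suc.IH by (simp add: emeasure_eq_measure r_def[symmetric] ennreal_mult'[symmetric] mult_ac)
      ultimately show ?thesis
        using nonneg by (simp add: sum_ennreal ennreal_plus[symmetric] sum_nonneg del: ennreal_plus)
    qed
    also have "\<dots> = ennreal (fact (Suc m) * c k * q (Suc m) (sum k J))"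
      unfolding c_def q_def by (subst poisson_coefficient_step[OF J]) (rule refl)
    finally show ?case .
  qed
  from this[of k] show ?thesis by (simp add: c_def q_def b_def)
qed

text \<open>Summing the layers leaves the exponential series in \<open>r\<close>, started at
  \<open>m = K\<close>. Its value \<open>exp r\<close> reduces
  \<open>exp (- measure M (space M))\<close> to the product of the exponential factors of the
  blocks, so the joint law of the counts factorises.\<close>

lemma emeasure_poisson_law_counts:
  fixes B :: "'i \<Rightarrow> 'a set" and k :: "'i \<Rightarrow> nat"
  assumes J: "finite J" and B: "\<And>i. i \<in> J \<Longrightarrow> B i \<in> sets M" and disj: "disjoint_family_on B J"
  shows "emeasure (poisson_law M) {N \<in> space (config_space M). \<forall>i\<in>J. points (B i) N = k i} =
    ennreal (\<Prod>i\<in>J. measure M (B i) ^ k i / fact (k i) * exp (- measure M (B i)))"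
proof -
  let ?E = "{N \<in> space (config_space M). \<forall>i\<in>J. points (B i) N = k i}"
  define r where "r = measure M (space M - (\<Union>i\<in>J. B i))"
  define c where "c = (\<Prod>i\<in>J. measure M (B i) ^ k i / fact (k i))"
  define K where "K = sum k J"
  let ?l = "measure M (space M)"
  have r: "r \<ge> 0" and c: "c \<ge> 0" by (auto simp: r_def c_def intro!: prod_nonneg)
  have E: "?E \<in> sets (config_space M)" using J B by (rule sets_counts)
  have "(\<lambda>m. r ^ m / fact m) sums exp r"
    using exp_converges[of r] by (simp add: field_simps)
  then have "(\<lambda>m. if K \<le> m + K then r ^ (m + K - K) / fact (m + K - K) else 0) sums exp r"
    by simp
  then have "(\<lambda>m. if K \<le> m then r ^ (m - K) / fact (m - K) else 0) sums exp r"
    by (subst (asm) sums_zero_iff_shift) auto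
  then have "(\<lambda>m. exp (- ?l) * c * (if K \<le> m then r ^ (m - K) / fact (m - K) else 0)) sums (exp (- ?l) * c * exp r)"
    by (rule sums_mult)
  then have "(\<Sum>m. ennreal (exp (- ?l) * c * (if K \<le> m then r ^ (m - K) / fact (m - K) else 0))) =
      ennreal (exp (- ?l) * c * exp r)"
    using r c by (intro suminf_ennreal_eq) auto
  moreover have "ennreal (exp (- ?l) / fact m) * emeasure (poisson_layer M m) ?E =
      ennreal (exp (- ?l) * c * (if K \<le> m then r ^ (m - K) / fact (m - K) else 0))" for m
    using r c emeasure_poisson_layer_counts[OF assms, of m k]
    by (simp add: r_def[symmetric] c_def[symmetric] K_def[symmetric] ennreal_mult'[symmetric])
  moreover have "exp (- ?l) * c * exp r = (\<Prod>i\<in>J. measure M (B i) ^ k i / fact (k i) * exp (- measure M (B i)))"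
  proof -
    have "?l = measure M (\<Union>i\<in>J. B i) + r"
      unfolding r_def using J B by (subst finite_measure_compl) auto
    also have "measure M (\<Union>i\<in>J. B i) = (\<Sum>i\<in>J. measure M (B i))"
      using J B disj by (intro finite_measure_finite_Union) auto
    finally have "exp (- ?l) * exp r = exp (\<Sum>i\<in>J. - measure M (B i))"
      by (simp add: mult_exp_exp sum_negf)
    also have "\<dots> = (\<Prod>i\<in>J. exp (- measure M (B i)))"
      using J by (rule exp_sum)
    finally have "exp (- ?l) * exp r = (\<Prod>i\<in>J. exp (- measure M (B i)))" .
    then show ?thesis unfolding prod.distrib c_def[symmetric] by (metis mult.assoc mult.commute)
  qed
  ultimately show ?thesis
    unfolding emeasure_poisson_law[OF E] by simp
qed

text \<open>The empty family of blocks imposes no condition, and its product is 1.\<close>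

lemma prob_space_poisson_law: "prob_space (poisson_law M)"
  using emeasure_poisson_law_counts[of "{} :: nat set"] by (intro prob_spaceI) (simp add: disjoint_family_on_def)

lemma poisson_process_poisson_law: "poisson_process M (poisson_law M)"
  unfolding poisson_process_def
proof (intro conjI ballI allI impI)
  interpret P: prob_space "poisson_law M" by (rule prob_space_poisson_law)
  show "finite_measure M" "prob_space (poisson_law M)" "sets (poisson_law M) = sets (config_space M)"
    by unfold_locales auto
  show "measure (poisson_law M) {N \<in> space (poisson_law M). points B N = k} =
      measure M B ^ k / fact k * exp (- measure M B)" if "B \<in> sets M" for B k
    using emeasure_poisson_law_counts[of "{()}" "\<lambda>_. B" "\<lambda>_. k"] that
    by (simp add: P.emeasure_eq_measure disjoint_family_on_def)
  fix m :: nat and B :: "nat \<Rightarrow> 'a set"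
  assume B: "(\<forall>i<m. B i \<in> sets M) \<and> disjoint_family_on B {..<m}"
  note pts = measurable_points[OF B[THEN conjunct1, rule_format]]
  have meas: "points (B i) \<in> poisson_law M \<rightarrow>\<^sub>M count_space UNIV" if "i \<in> {..<m}" for i
    using pts[of i] that by (simp cong: measurable_cong_sets)
  let ?X = "\<lambda>i k. points (B i) -` {k} \<inter> space (poisson_law M)"
  \<comment> \<open>The level sets of a count, with the empty set added to make the family stable
    under intersection; every event about the count is a countable union of them.\<close>
  let ?G = "\<lambda>i. insert {} (range (?X i))"
  have "P.indep_sets ?G {..<m}"
  proof (rule P.indep_setsI)
    show "?G i \<subseteq> P.events" if "i \<in> {..<m}" for i
      using measurable_sets[OF meas[OF that]] by auto
    fix A J assume J: "J \<noteq> {}" "J \<subseteq> {..<m}" "finite J" and A: "\<forall>j\<in>J. A j \<in> ?G j"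
    show "P.prob (\<Inter>j\<in>J. A j) = (\<Prod>j\<in>J. P.prob (A j))"
    proof (cases "\<exists>j\<in>J. A j = {}")
      case True
      then obtain j where "j \<in> J" "A j = {}" by auto
      then have "(\<Inter>j\<in>J. A j) = {}" "(\<Prod>j\<in>J. P.prob (A j)) = 0" using J by (auto intro!: prod_zero bexI[of _ j])
      then show ?thesis by simp
    next
      case False
      with A have "\<forall>j\<in>J. A j \<in> range (?X j)" by blast
      then have "\<forall>j\<in>J. \<exists>k. A j = ?X j k" unfolding image_iff by blast
      then obtain k where k: "\<And>j. j \<in> J \<Longrightarrow> A j = ?X j (k j)" by metis
      have law: "P.prob {N \<in> space (config_space M). \<forall>i\<in>I. points (B i) N = k i} =
          (\<Prod>i\<in>I. measure M (B i) ^ k i / fact (k i) * exp (- measure M (B i)))" if "I \<subseteq> J" for I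
      proof -
        have "I \<subseteq> {..<m}" using that J by auto
        then have "finite I" "\<And>i. i \<in> I \<Longrightarrow> B i \<in> sets M" "disjoint_family_on B I"
          using B by (auto intro: finite_subset disjoint_family_on_mono)
        from emeasure_poisson_law_counts[OF this, of k] show ?thesis
          by (simp add: P.emeasure_eq_measure prod_nonneg)
      qed
      have "(\<Inter>j\<in>J. A j) = {N \<in> space (config_space M). \<forall>i\<in>J. points (B i) N = k i}"
        using J k by auto
      moreover have "P.prob (A j) = measure M (B j) ^ k j / fact (k j) * exp (- measure M (B j))" if "j \<in> J" for j
      proof -
        have "A j = {N \<in> space (config_space M). \<forall>i\<in>{j}. points (B i) N = k i}"
          using k[OF that] by auto
        then show ?thesis using law[of "{j}"] that by simp
      qed
      ultimately show ?thesis using law[of J] by simp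
    qed
  qed
  then have "P.indep_sets (\<lambda>i. sigma_sets (space (poisson_law M)) (?G i)) {..<m}"
  proof (rule P.indep_sets_sigma)
    show "Int_stable (?G i)" for i
      by (auto simp: Int_stable_def)
  qed
  then have "P.indep_sets (\<lambda>i. {points (B i) -` A \<inter> space (poisson_law M) |A. A \<in> sets (count_space UNIV)}) {..<m}"
  proof (rule P.indep_sets_mono_sets)
    fix i
    show "{points (B i) -` A \<inter> space (poisson_law M) |A. A \<in> sets (count_space UNIV)} \<subseteq>
        sigma_sets (space (poisson_law M)) (?G i)"
    proof clarify
      fix A :: "nat set"
      have "points (B i) -` A \<inter> space (poisson_law M) = (\<Union>k. if k \<in> A then ?X i k else {})"
        by auto
      also have "\<dots> \<in> sigma_sets (space (poisson_law M)) (?G i)"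
        by (intro sigma_sets.Union) (auto intro: sigma_sets.Basic sigma_sets.Empty)
      finally show "points (B i) -` A \<inter> space (poisson_law M) \<in> sigma_sets (space (poisson_law M)) (?G i)" .
    qed
  qed
  then show "P.indep_vars (\<lambda>_. count_space UNIV) (\<lambda>i. points (B i)) {..<m}"
    unfolding P.indep_vars_def2 using meas by auto
qed

end

section \<open>Maximal coupling\<close>

text \<open>On \<open>Y\<close> the measure \<open>N\<close> is dominated by \<open>M\<close> and so
  has a density there. The density exceeds 1 only on a null set, since on the set \<open>Z\<close>
  where it does, \<open>N\<close> would outweigh \<open>M\<close>; cutting it off at 1 makes the
  bound hold everywhere.\<close>

lemma dominated_density_on:
  assumes fin: "finite_measure M" "finite_measure N" and sets: "sets N = sets M"
    and Y: "Y \<in> sets M" and le: "\<And>X. X \<in> sets M \<Longrightarrow> X \<subseteq> Y \<Longrightarrow> emeasure N X \<le> emeasure M X"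
  obtains h :: "'a \<Rightarrow> ennreal" where "h \<in> borel_measurable M" "\<And>x. h x \<le> 1"
    "\<And>A. A \<in> sets M \<Longrightarrow> emeasure N (A \<inter> Y) = (\<integral>\<^sup>+x. h x * indicator (A \<inter> Y) x \<partial>M)"
proof -
  interpret M: finite_measure M by fact
  interpret N: finite_measure N by fact
  note [measurable_cong] = sets
  note [measurable] = Y
  let ?N = "density N (indicator Y)"
  have N: "emeasure ?N A = emeasure N (A \<inter> Y)" if "A \<in> sets M" for A
    using that sets by (subst emeasure_density) (auto simp: indicator_inter_arith[symmetric] Int_commute)
  have "absolutely_continuous M ?N"
    unfolding absolutely_continuous_def
  proof
    fix A assume A: "A \<in> null_sets M"
    then have "emeasure M (A \<inter> Y) \<le> emeasure M A" by (intro emeasure_mono) auto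
    then have "emeasure M (A \<inter> Y) = 0" using A by auto
    moreover have "emeasure N (A \<inter> Y) \<le> emeasure M (A \<inter> Y)" using A by (intro le) auto
    ultimately show "A \<in> null_sets ?N" using A N[of A] sets by (auto simp: null_sets_def)
  qed
  from M.Radon_Nikodym[OF this] sets obtain g where g [measurable]: "g \<in> borel_measurable M"
    and dens: "density M g = ?N" by auto
  have gN: "(\<integral>\<^sup>+x. g x * indicator A x \<partial>M) = emeasure N (A \<inter> Y)" if "A \<in> sets M" for A
    using that N[OF that] by (simp add: dens[symmetric] emeasure_density)
  define Z where "Z = {x \<in> space M. x \<in> Y \<and> 1 < g x}"
  have Z [measurable]: "Z \<in> sets M" unfolding Z_def by measurable
  have "(\<integral>\<^sup>+x. (g x * indicator Z x - indicator Z x) \<partial>M) =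
      (\<integral>\<^sup>+x. g x * indicator Z x \<partial>M) - (\<integral>\<^sup>+x. indicator Z x \<partial>M)"
    by (rule nn_integral_diff)
      (auto simp: Z_def less_top[symmetric] split: split_indicator)
  also have "\<dots> = emeasure N (Z \<inter> Y) - emeasure M Z"
    by (simp add: gN)
  also have "Z \<inter> Y = Z" by (auto simp: Z_def)
  also have "emeasure N Z - emeasure M Z = 0"
    using le[of Z] by (intro diff_eq_0_ennreal) (auto simp: Z_def less_top[symmetric])
  finally have "AE x in M. g x * indicator Z x - indicator Z x = 0"
    by (subst (asm) nn_integral_0_iff_AE) auto
  then have AE: "AE x in M. x \<in> Y \<longrightarrow> g x \<le> 1"
  proof eventually_elim
    case (elim x)
    show ?case
    proof (rule ccontr)
      assume "\<not> (x \<in> Y \<longrightarrow> g x \<le> 1)"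
      then have "x \<in> Y" "1 < g x" by auto
      then have "g x - 1 > 0" by (simp add: diff_gt_0_iff_gt_ennreal)
      moreover have "x \<in> space M" using \<open>x \<in> Y\<close> sets.sets_into_space[OF Y] by auto
      ultimately show False using elim \<open>x \<in> Y\<close> \<open>1 < g x\<close> by (simp add: Z_def)
    qed
  qed
  show ?thesis
  proof (rule that[of "\<lambda>x. min 1 (g x)"])
    fix A assume A [measurable]: "A \<in> sets M"
    have "emeasure N (A \<inter> Y) = (\<integral>\<^sup>+x. g x * indicator (A \<inter> Y) x \<partial>M)"
      using gN[of "A \<inter> Y"] A Y by (simp add: Int_assoc)
    also have "\<dots> = (\<integral>\<^sup>+x. min 1 (g x) * indicator (A \<inter> Y) x \<partial>M)"
      using AE by (intro nn_integral_cong_AE) (auto split: split_indicator elim!: eventually_mono)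
    finally show "emeasure N (A \<inter> Y) = (\<integral>\<^sup>+x. min 1 (g x) * indicator (A \<inter> Y) x \<partial>M)" .
  qed auto
qed

text \<open>
  The common part of the two laws has a density \<open>H \<le> 1\<close> with respect to the law of \<open>f\<close>. The coupling
  puts \<open>(w, f w)\<close> with weight \<open>H (f w)\<close> and draws the second component from the normalised excess \<open>V\<close>
  of \<open>Q\<close> otherwise, so \<open>P\<close> need not be disintegrated along \<open>f\<close>.
\<close>

lemma maximal_coupling:
  assumes P: "prob_space P" and f: "f \<in> P \<rightarrow>\<^sub>M M" and Q: "prob_space Q" and sets: "sets Q = sets M"
    and le: "\<And>A. A \<in> sets M \<Longrightarrow> measure Q A \<le> measure (distr P M f) A + \<delta>"
  obtains K where "coupling P Q K"
    "\<And>bad. bad \<in> sets K \<Longrightarrow> (\<And>w. w \<in> space P \<Longrightarrow> (w, f w) \<notin> bad) \<Longrightarrow> measure K bad \<le> \<delta>"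
proof -
  interpret P: prob_space P by fact
  interpret Q: prob_space Q by fact
  let ?\<mu> = "distr P M f"
  interpret \<mu>: prob_space ?\<mu> using f by (rule P.prob_space_distr)
  note [measurable] = f
  note [measurable_cong] = sets
  have space: "space Q = space M" using sets by (rule sets_eq_imp_space_eq)
  \<comment> \<open>Hahn decomposition: the law of \<open>f\<close> dominates on \<open>Y\<close>,
    and \<open>Q\<close> dominates on the complement \<open>?Z\<close>.\<close>
  obtain Y where Y [measurable]: "Y \<in> sets M"
    and Y1: "\<And>X. X \<in> sets M \<Longrightarrow> X \<subseteq> Y \<Longrightarrow> emeasure Q X \<le> emeasure ?\<mu> X"
    and Y2: "\<And>X. X \<in> sets M \<Longrightarrow> X \<inter> Y = {} \<Longrightarrow> emeasure ?\<mu> X \<le> emeasure Q X"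
    using finite_unsigned_Hahn_decomposition[of ?\<mu> Q] sets P.finite_measure_distr[OF f] Q.finite_measure_axioms
    by auto
  let ?Z = "space M - Y"
  obtain h where h: "h \<in> borel_measurable ?\<mu>" "\<And>x. h x \<le> 1"
    and hQ: "\<And>A. A \<in> sets M \<Longrightarrow> emeasure Q (A \<inter> Y) = (\<integral>\<^sup>+x. h x * indicator (A \<inter> Y) x \<partial>?\<mu>)"
    by (rule dominated_density_on[of ?\<mu> Q Y])
      (use Y1 sets P.finite_measure_distr[OF f] Q.finite_measure_axioms in auto)
  have Y2': "emeasure ?\<mu> X \<le> emeasure Q X" if "X \<in> sets M" "X \<subseteq> ?Z" for X
    using that by (intro Y2) auto
  obtain g where g: "g \<in> borel_measurable Q" "\<And>x. g x \<le> 1"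
    and g\<mu>: "\<And>A. A \<in> sets M \<Longrightarrow> emeasure ?\<mu> (A \<inter> ?Z) = (\<integral>\<^sup>+x. g x * indicator (A \<inter> ?Z) x \<partial>Q)"
    by (rule dominated_density_on[of Q ?\<mu> ?Z])
      (use Y2' sets P.finite_measure_distr[OF f] Q.finite_measure_axioms in auto)
  have [measurable]: "h \<in> borel_measurable M" "g \<in> borel_measurable M"
    using h(1) g(1) sets by (auto cong: measurable_cong_sets)
  \<comment> \<open>The minimum of the two laws is \<open>Q\<close> on \<open>Y\<close>, with
    density \<open>h\<close>, and the law of \<open>f\<close> itself on \<open>?Z\<close>, with
    density 1. The measure \<open>R\<close> is what \<open>Q\<close> has in excess of it.\<close>
  define H where "H x = (if x \<in> Y then h x else 1)" for x
  define R where "R = density Q (\<lambda>x. (1 - g x) * indicator ?Z x)"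
  have H [measurable]: "H \<in> borel_measurable M" unfolding H_def by measurable
  have H1: "H x \<le> 1" for x by (simp add: H_def h)
  have [simp, measurable_cong]: "sets R = sets M" by (simp add: R_def sets)
  have split: "emeasure N A = emeasure N (A \<inter> Y) + emeasure N (A \<inter> ?Z)"
    if "A \<in> sets M" "sets N = sets M" for A N
    using that sets.sets_into_space[OF that(1)]
    by (subst plus_emeasure) (auto intro!: arg_cong[where f="emeasure N"])
  have H\<mu>: "(\<integral>\<^sup>+x. H x * indicator A x \<partial>?\<mu>) = emeasure Q (A \<inter> Y) + emeasure ?\<mu> (A \<inter> ?Z)"
    if A [measurable]: "A \<in> sets M" for A
  proof -
    have "(\<integral>\<^sup>+x. H x * indicator A x \<partial>?\<mu>) = (\<integral>\<^sup>+x. h x * indicator (A \<inter> Y) x + indicator (A \<inter> ?Z) x \<partial>?\<mu>)"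
      using sets.sets_into_space[OF A] by (intro nn_integral_cong) (auto simp: H_def split: split_indicator)
    then show ?thesis by (simp add: nn_integral_add hQ)
  qed
  have R: "emeasure ?\<mu> (A \<inter> ?Z) + emeasure R A = emeasure Q (A \<inter> ?Z)" if A [measurable]: "A \<in> sets M" for A
  proof -
    have "emeasure ?\<mu> (A \<inter> ?Z) + emeasure R A =
      (\<integral>\<^sup>+x. g x * indicator (A \<inter> ?Z) x + (1 - g x) * indicator ?Z x * indicator A x \<partial>Q)"
      unfolding R_def g\<mu>[OF A] by (subst nn_integral_add) (auto simp: emeasure_density sets)
    also have "\<dots> = (\<integral>\<^sup>+x. indicator (A \<inter> ?Z) x \<partial>Q)"
    proof (intro nn_integral_cong)
      fix x
      have "g x + (1 - g x) = 1"
        using diff_add_cancel_ennreal[OF g(2)[of x]] by (simp add: add.commute)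
      then show "g x * indicator (A \<inter> ?Z) x + (1 - g x) * indicator ?Z x * indicator A x = indicator (A \<inter> ?Z) x"
        by (auto split: split_indicator)
    qed
    finally show ?thesis by (simp add: sets)
  qed
  define d where "d = emeasure R (space M)"
  have HR: "(\<integral>\<^sup>+x. H x * indicator A x \<partial>?\<mu>) + emeasure R A = emeasure Q A" if "A \<in> sets M" for A
    using R[OF that] split[OF that sets] by (simp add: H\<mu>[OF that] add.assoc)
  have d1: "d \<le> 1"
    using HR[of "space M"] Q.emeasure_space_1 space unfolding d_def by (metis le_add2 le_iff_add add.commute sets.top)
  \<comment> \<open>Both laws have total mass 1, so the mass that the minimum leaves over from
    \<open>?\<mu>\<close> equals the mass of the excess.\<close>
  have one: "(\<integral>\<^sup>+w. 1 - H (f w) \<partial>P) = d"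
  proof -
    have "(\<integral>\<^sup>+x. 1 - H x \<partial>?\<mu>) + (\<integral>\<^sup>+x. H x \<partial>?\<mu>) = (\<integral>\<^sup>+x. 1 \<partial>?\<mu>)"
      using H1 by (subst nn_integral_add[symmetric]) (auto intro!: nn_integral_cong simp: diff_add_cancel_ennreal)
    also have "\<dots> = d + (\<integral>\<^sup>+x. H x \<partial>?\<mu>)"
    proof -
      have "(\<integral>\<^sup>+x. H x * indicator (space M) x \<partial>?\<mu>) = (\<integral>\<^sup>+x. H x \<partial>?\<mu>)"
        by (intro nn_integral_cong) auto
      then show ?thesis
        using HR[of "space M"] \<mu>.emeasure_space_1 Q.emeasure_space_1 space by (simp add: d_def add.commute)
    qed
    finally have eq: "(\<integral>\<^sup>+x. 1 - H x \<partial>?\<mu>) + (\<integral>\<^sup>+x. H x \<partial>?\<mu>) = d + (\<integral>\<^sup>+x. H x \<partial>?\<mu>)" .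
    have "(\<integral>\<^sup>+x. H x \<partial>?\<mu>) \<le> (\<integral>\<^sup>+x. 1 \<partial>?\<mu>)" using H1 by (intro nn_integral_mono) auto
    then have "(\<integral>\<^sup>+x. H x \<partial>?\<mu>) \<noteq> \<infinity>" using \<mu>.emeasure_space_1 by (auto simp: top_unique)
    then have "(\<integral>\<^sup>+x. 1 - H x \<partial>?\<mu>) = d"
      using eq ennreal_add_left_cancel by (metis add.commute)
    then show ?thesis by (simp add: nn_integral_distr)
  qed
  obtain V where V: "prob_space V" "sets V = sets M"
    and dV: "\<And>A. A \<in> sets M \<Longrightarrow> d * emeasure V A = emeasure R A"
  proof (cases "d = 0")
    \<comment> \<open>Without excess the redrawing has weight 0 almost surely, so any probability
      measure can serve as \<open>V\<close>.\<close>
    case True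
    have "emeasure R A = 0" if "A \<in> sets M" for A
      using emeasure_mono[of A "space M" R] sets.sets_into_space[OF that] True by (auto simp: d_def)
    then show ?thesis using True Q sets by (intro that[of Q]) auto
  next
    case False
    let ?V = "scale_measure (1 / d) R"
    have dd: "d * (1 / d) = 1"
      using False le_less_trans[OF d1 ennreal_one_less_top] by (simp add: ennreal_times_divide)
    show ?thesis
    proof (rule that[of ?V])
      have "space R = space M" by (rule sets_eq_imp_space_eq) simp
      then have "emeasure ?V (space ?V) = (1 / d) * d" by (simp add: d_def space_scale_measure)
      then show "prob_space ?V" using dd by (intro prob_spaceI) (simp add: mult.commute)
      show "d * emeasure ?V A = emeasure R A" for A
        using dd by (simp add: mult.assoc[symmetric])
    qed simp
  qed
  interpret V: prob_space V by fact
  have spV: "space V = space M" using V(2) by (rule sets_eq_imp_space_eq)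
  note [measurable_cong] = V(2)
  let ?k = "\<lambda>A w. H (f w) * indicator A (w, f w) + (1 - H (f w)) * emeasure V (Pair w -` A)"
  define \<kappa> where "\<kappa> A = (\<integral>\<^sup>+w. ?k A w \<partial>P)" for A
  define K where "K = measure_of (space (P \<Otimes>\<^sub>M Q)) (sets (P \<Otimes>\<^sub>M Q)) \<kappa>"
  have setsPV: "sets (P \<Otimes>\<^sub>M V) = sets (P \<Otimes>\<^sub>M Q)" by (intro sets_pair_measure_cong) (auto simp: sets V)
  have sK [simp]: "sets K = sets (P \<Otimes>\<^sub>M Q)" by (simp add: K_def)
  have spK: "space K = space P \<times> space M" using sets_eq_imp_space_eq[OF sK] by (simp add: space_pair_measure space)
  have ind: "(\<lambda>w. indicator A (w, f w) :: ennreal) \<in> borel_measurable P" if "A \<in> sets (P \<Otimes>\<^sub>M Q)" for A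
  proof -
    have [measurable]: "A \<in> sets (P \<Otimes>\<^sub>M Q)" by fact
    show ?thesis by measurable
  qed
  have sec: "(\<lambda>w. emeasure V (Pair w -` A)) \<in> borel_measurable P" if "A \<in> sets (P \<Otimes>\<^sub>M Q)" for A
    using V.measurable_emeasure_Pair[of A P] that setsPV by simp
  have secs: "Pair w -` A \<in> sets V" if "A \<in> sets (P \<Otimes>\<^sub>M Q)" for A w
    using sets_Pair1[of A P V w] that setsPV by simp
  have K: "emeasure K A = \<kappa> A" if "A \<in> sets (P \<Otimes>\<^sub>M Q)" for A
    unfolding K_def
  proof (rule emeasure_measure_of_sigma[OF _ _ _ that])
    show "sigma_algebra (space (P \<Otimes>\<^sub>M Q)) (sets (P \<Otimes>\<^sub>M Q))" ..
    show "positive (sets (P \<Otimes>\<^sub>M Q)) \<kappa>" by (simp add: positive_def \<kappa>_def)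
    show "countably_additive (sets (P \<Otimes>\<^sub>M Q)) \<kappa>"
    proof (rule countably_additiveI)
      fix A :: "nat \<Rightarrow> _" assume A: "range A \<subseteq> sets (P \<Otimes>\<^sub>M Q)" "disjoint_family A"
      have Ai: "A i \<in> sets (P \<Otimes>\<^sub>M Q)" for i using A(1) by auto
      have "\<kappa> (\<Union>i. A i) = (\<integral>\<^sup>+w. (\<Sum>i. ?k (A i) w) \<partial>P)"
        unfolding \<kappa>_def
      proof (intro nn_integral_cong)
        fix w
        have "emeasure V (Pair w -` (\<Union>i. A i)) = (\<Sum>i. emeasure V (Pair w -` A i))"
          using secs[OF Ai, of w] A(2)
          by (subst suminf_emeasure) (auto simp: disjoint_family_on_def vimage_Union)
        then show "?k (\<Union>i. A i) w =
          (\<Sum>i. ?k (A i) w)"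
          by (simp add: suminf_add[symmetric] suminf_indicator[OF A(2)])
      qed
      also have "\<dots> = (\<Sum>i. \<kappa> (A i))"
        unfolding \<kappa>_def
        by (intro nn_integral_suminf borel_measurable_add borel_measurable_times_ennreal ind[OF Ai] sec[OF Ai]) measurable
      finally show "(\<Sum>i. \<kappa> (A i)) = \<kappa> (\<Union>i. A i)" ..
    qed
  qed
  have "distr K P fst = P"
  proof (rule measure_eqI)
    fix A assume "A \<in> sets (distr K P fst)"
    then have A [measurable]: "A \<in> sets P" by simp
    have "emeasure (distr K P fst) A = emeasure K (A \<times> space M)"
    proof (subst emeasure_distr)
      show "fst \<in> K \<rightarrow>\<^sub>M P" by (simp add: measurable_cong_sets[OF sK refl])
      show "emeasure K (fst -` A \<inter> space K) = emeasure K (A \<times> space M)"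
        using sets.sets_into_space[OF A] by (intro arg_cong[where f="emeasure K"]) (auto simp: spK)
    qed fact
    also have "\<dots> = (\<integral>\<^sup>+w. ?k (A \<times> space M) w \<partial>P)"
      using pair_measureI[OF A sets.top[of Q]] space by (subst K) (auto simp: \<kappa>_def)
    also have "\<dots> = (\<integral>\<^sup>+w. indicator A w \<partial>P)"
      using H1 V.emeasure_space_1 measurable_space[OF f]
      by (intro nn_integral_cong) (auto simp: spV split: split_indicator)
    finally show "emeasure (distr K P fst) A = emeasure P A" by simp
  qed simp
  moreover have "distr K Q snd = Q"
  proof (rule measure_eqI)
    fix A assume "A \<in> sets (distr K Q snd)"
    then have A: "A \<in> sets Q" by simp
    then have A' [measurable]: "A \<in> sets M" using sets by simp
    have "emeasure (distr K Q snd) A = emeasure K (space P \<times> A)"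
    proof (subst emeasure_distr)
      show "snd \<in> K \<rightarrow>\<^sub>M Q" by (simp add: measurable_cong_sets[OF sK refl])
      show "emeasure K (snd -` A \<inter> space K) = emeasure K (space P \<times> A)"
        using sets.sets_into_space[OF A'] by (intro arg_cong[where f="emeasure K"]) (auto simp: spK)
    qed fact
    also have "\<dots> = (\<integral>\<^sup>+w. ?k (space P \<times> A) w \<partial>P)"
      using pair_measureI[OF sets.top[of P] A] by (subst K) (auto simp: \<kappa>_def)
    also have "\<dots> = (\<integral>\<^sup>+w. H (f w) * indicator A (f w) + (1 - H (f w)) * emeasure V A \<partial>P)"
      by (intro nn_integral_cong) (auto split: split_indicator)
    also have "\<dots> = (\<integral>\<^sup>+w. H (f w) * indicator A (f w) \<partial>P) + (\<integral>\<^sup>+w. 1 - H (f w) \<partial>P) * emeasure V A"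
      by (subst nn_integral_add) (auto simp: nn_integral_multc)
    also have "\<dots> = (\<integral>\<^sup>+x. H x * indicator A x \<partial>?\<mu>) + emeasure R A"
      by (simp add: one dV nn_integral_distr)
    also have "\<dots> = emeasure Q A" by (rule HR) fact
    finally show "emeasure (distr K Q snd) A = emeasure Q A" .
  qed simp
  ultimately have "coupling P Q K" by (simp add: coupling_def)
  moreover have "measure K bad \<le> \<delta>" if bad: "bad \<in> sets K" "\<And>w. w \<in> space P \<Longrightarrow> (w, f w) \<notin> bad" for bad
  proof -
    have "emeasure K bad = \<kappa> bad" using bad(1) by (intro K) simp
    also have "\<dots> \<le> (\<integral>\<^sup>+w. 1 - H (f w) \<partial>P)"
      unfolding \<kappa>_def using bad(2) V.emeasure_le_1
      by (intro nn_integral_mono) (auto intro: mult_left_le)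
    also have "\<dots> = d" by (rule one)
    finally have Kd: "emeasure K bad \<le> d" .
    \<comment> \<open>The excess lives on \<open>?Z\<close>, hence \<open>d\<close> is the
      difference of the two probabilities of \<open>?Z\<close>, which \<open>le\<close> bounds by
      \<open>\<delta>\<close>.\<close>
    have "emeasure ?\<mu> ?Z + d = emeasure Q ?Z"
      using R[of "space M"] by (simp add: d_def Int_absorb1)
    moreover have d: "ennreal (enn2real d) = d" using le_less_trans[OF d1 ennreal_one_less_top] by simp
    ultimately have "ennreal (measure ?\<mu> ?Z + enn2real d) = ennreal (measure Q ?Z)"
      by (simp add: \<mu>.emeasure_eq_measure Q.emeasure_eq_measure ennreal_plus)
    then have "measure ?\<mu> ?Z + enn2real d = measure Q ?Z"
      by (subst (asm) ennreal_inj) auto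
    then have "enn2real d \<le> \<delta>" using le[of ?Z] by auto
    moreover have "measure K bad \<le> enn2real d"
      unfolding measure_def using Kd le_less_trans[OF d1 ennreal_one_less_top] by (rule enn2real_mono)
    ultimately show ?thesis by simp
  qed
  ultimately show ?thesis by (rule that)
qed

section \<open>Cycles as closed vertex lists\<close>

definition cyc :: "'a list \<Rightarrow> ('a \<times> 'a) set" where
  "cyc vs = set (zip vs (rotate1 vs))"

lemma cyc_index: "cyc vs = {(vs ! i, vs ! (Suc i mod length vs)) |i. i < length vs}"
  by (auto simp: cyc_def set_zip nth_rotate1)

lemma cyc_rotate: "cyc (rotate m vs) = cyc vs"
proof (induction m)
  case (Suc m)
  have "cyc (rotate1 ws) = cyc ws" for ws :: "'a list"
  proof (cases ws)
    case (Cons x xs)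
    show ?thesis
    proof (cases xs)
      case (Cons y ys)
      have "zip ((y # ys) @ [x]) ((ys @ [x]) @ [y]) = zip (y # ys) (ys @ [x]) @ [(x, y)]"
        by (subst zip_append) auto
      then show ?thesis using \<open>ws = x # xs\<close> Cons by (simp add: cyc_def)
    qed (simp add: \<open>ws = x # xs\<close>)
  qed simp
  then show ?case using Suc by simp
qed simp

section \<open>Weighted walks\<close>

fun walk_weight :: "('a \<Rightarrow> 'a \<Rightarrow> real) \<Rightarrow> 'a list \<Rightarrow> real" where
  "walk_weight M (u # v # vs) = M u v * walk_weight M (v # vs)"
| "walk_weight M vs = 1"

lemma walk_weight_nonneg: "(\<And>u v. 0 \<le> M u v) \<Longrightarrow> 0 \<le> walk_weight M vs"
  by (induction M vs rule: walk_weight.induct) auto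

lemma prod_list_closed_walk:
  "prod_list (map (\<lambda>(a, b). M a b) (zip (u # vs) (vs @ [x]))) =
    walk_weight M (u # vs) * M (last (u # vs)) x"
  by (induction vs arbitrary: u) auto

text \<open>The left side is a row sum of the \<open>m\<close>-th matrix power. The first step is
  split off, and the remaining walk is bounded uniformly in its starting vertex.\<close>

lemma sum_walk_weight_le:
  assumes M: "\<And>u v. 0 \<le> M u v" and A: "finite A" and row: "\<And>u. (\<Sum>v\<in>A. M u v) \<le> c"
  shows "(\<Sum>vs | set vs \<subseteq> A \<and> length vs = m. walk_weight M (u # vs)) \<le> c ^ m"
proof (induction m arbitrary: u)
  case 0
  have "{vs. set vs \<subseteq> A \<and> length vs = 0} = {[]}" by auto
  then show ?case by simp
next
  case (Suc m)
  let ?L = "\<lambda>m. {vs. set vs \<subseteq> A \<and> length vs = m}"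
  have c: "0 \<le> c" using row[of u] sum_nonneg[of A "M u"] M by fastforce
  have "(\<Sum>vs\<in>?L (Suc m). walk_weight M (u # vs)) = (\<Sum>(vs, v)\<in>?L m \<times> A. walk_weight M (u # v # vs))"
    unfolding lists_length_Suc_eq
    by (subst sum.reindex) (auto simp: inj_on_def case_prod_beta)
  also have "\<dots> = (\<Sum>v\<in>A. \<Sum>vs\<in>?L m. M u v * walk_weight M (v # vs))"
    by (subst sum.cartesian_product[symmetric]) (simp, rule sum.swap)
  also have "\<dots> \<le> (\<Sum>v\<in>A. M u v * c ^ m)"
    unfolding sum_distrib_left[symmetric] by (intro sum_mono mult_left_mono Suc.IH M)
  also have "\<dots> \<le> c * c ^ m"
    unfolding sum_distrib_right[symmetric] using c row by (intro mult_right_mono) auto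
  finally show ?case by simp
qed

text \<open>
  The edge type is abstract so that \<open>arc_edge\<close> can be the identity in the directed case and
  forget the orientation in the undirected case.
\<close>

locale cycle_family =
  fixes n :: nat and arc_edge :: "nat \<times> nat \<Rightarrow> 'e" and ends :: "'e \<Rightarrow> nat set" and \<C> :: "'e set set"
  assumes ends_arc_edge: "ends (arc_edge (u, v)) = {u, v}"
    and cycle_vertices: "C \<in> \<C> \<Longrightarrow> \<exists>vs. distinct vs \<and> set vs \<subseteq> {..<n} \<and> 2 \<le> length vs \<and>
      C = arc_edge ` cyc vs \<and> card C = length vs"
begin

section \<open>Degrees and containment of cycles\<close>

definition verts :: "'e set \<Rightarrow> nat set" where
  "verts C = (\<Union>e\<in>C. ends e)"

definition repr :: "'e set \<Rightarrow> nat list \<Rightarrow> bool" where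
  "repr C vs \<longleftrightarrow> distinct vs \<and> set vs \<subseteq> {..<n} \<and> 2 \<le> length vs \<and> C = arc_edge ` cyc vs \<and> card C = length vs"

lemma repr_exists: "C \<in> \<C> \<Longrightarrow> \<exists>vs. repr C vs"
  using cycle_vertices unfolding repr_def by blast

lemma repr_rotate: "repr C vs \<Longrightarrow> repr C (rotate m vs)"
  by (auto simp: repr_def cyc_rotate)

lemma repr_verts:
  assumes "repr C vs"
  shows "verts C = set vs"
proof -
  have "verts C = {v. \<exists>i<length vs. v = vs ! i \<or> v = vs ! (Suc i mod length vs)}"
    using assms by (auto simp: verts_def repr_def cyc_index ends_arc_edge)
  also have "\<dots> = set vs"
  proof -
    have "vs ! (Suc i mod length vs) \<in> set vs" if "i < length vs" for i
      using that by (intro nth_mem mod_less_divisor) auto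
    then show ?thesis by (auto simp: in_set_conv_nth[of _ vs])
  qed
  finally show ?thesis .
qed

lemma card_verts: "C \<in> \<C> \<Longrightarrow> card (verts C) = card C"
  using repr_exists repr_verts by (metis distinct_card repr_def)

lemma verts_subset: "C \<in> \<C> \<Longrightarrow> verts C \<subseteq> {..<n}"
  using repr_exists repr_verts by (metis repr_def)

lemma verts_Union: "verts (\<Union>S) = (\<Union>C\<in>S. verts C)"
  by (auto simp: verts_def)

text \<open>The cardinality clause of \<open>repr\<close> leaves no room for two arcs with the same
  edge. In the undirected case it excludes lists of length 2, whose two arcs would merge.\<close>

lemma repr_inj:
  assumes "repr C vs"
  shows "inj_on arc_edge (cyc vs)"
proof (rule eq_card_imp_inj_on)
  show "finite (cyc vs)" by (simp add: cyc_def)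
  have "card (cyc vs) = length vs"
    using assms by (simp add: cyc_def repr_def distinct_card distinct_zipI1)
  then show "card (arc_edge ` cyc vs) = card (cyc vs)" using assms unfolding repr_def by metis
qed

lemma repr_hd:
  assumes "repr C vs" "v \<in> set vs"
  obtains ws where "repr C ws" "hd ws = v"
proof -
  obtain i where i: "i < length vs" "v = vs ! i" using assms(2) by (auto simp: in_set_conv_nth)
  then have "hd (rotate i vs) = v" by (subst hd_rotate_conv_nth) auto
  with repr_rotate[OF assms(1)] show ?thesis by (rule that)
qed

text \<open>Once the list is rotated to start at \<open>v\<close>, only its first arc and its
  closing arc touch \<open>v\<close>.\<close>

lemma card_incident:
  assumes C: "C \<in> \<C>" and v: "v \<in> verts C"
  shows "card {e \<in> C. v \<in> ends e} = 2"
proof -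
  obtain vs0 where "repr C vs0" using repr_exists[OF C] by auto
  then obtain vs where r: "repr C vs" "hd vs = v"
    using v repr_verts repr_hd by metis
  let ?k = "length vs"
  have k: "2 \<le> ?k" and dist: "distinct vs" and Ceq: "C = arc_edge ` cyc vs" using r by (auto simp: repr_def)
  have v0: "v = vs ! 0" using r(2) k by (cases vs) auto
  let ?a = "(vs ! 0, vs ! 1)" and ?b = "(vs ! (?k - 1), vs ! 0)"
  have a: "?a \<in> cyc vs" unfolding cyc_index using k by (auto intro!: exI[of _ 0])
  obtain l where l: "?k = Suc l" using k by (cases ?k) auto
  have b: "?b \<in> cyc vs" unfolding cyc_index l by (auto intro!: exI[of _ l])
  have nth_eq: "vs ! i = vs ! j \<longleftrightarrow> i = j" if "i < ?k" "j < ?k" for i j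
    using dist that by (simp add: nth_eq_iff_index_eq)
  have "{p \<in> cyc vs. fst p = v \<or> snd p = v} = {?a, ?b}"
  proof
    show "{p \<in> cyc vs. fst p = v \<or> snd p = v} \<subseteq> {?a, ?b}"
    proof
      fix p assume "p \<in> {p \<in> cyc vs. fst p = v \<or> snd p = v}"
      then obtain i where i: "i < ?k" "p = (vs ! i, vs ! (Suc i mod ?k))"
        and "vs ! i = vs ! 0 \<or> vs ! (Suc i mod ?k) = vs ! 0"
        unfolding cyc_index v0 by auto
      then have "i = 0 \<or> Suc i mod ?k = 0"
        using k i(1) nth_eq[of i 0] nth_eq[of "Suc i mod ?k" 0] mod_less_divisor[of ?k "Suc i"] by linarith
      moreover have "i = ?k - 1" if "Suc i mod ?k = 0"
        using that i(1) by (metis Suc_lessI diff_Suc_1 mod_less nat.distinct(1))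
      ultimately show "p \<in> {?a, ?b}" using i k by auto
    qed
  qed (use a b v0 in auto)
  moreover have "{e \<in> C. v \<in> ends e} = arc_edge ` {p \<in> cyc vs. fst p = v \<or> snd p = v}"
    by (auto simp: Ceq ends_arc_edge)
  moreover have "card (arc_edge ` {?a, ?b}) = card {?a, ?b}"
    using a b by (intro card_image inj_on_subset[OF repr_inj[OF r(1)]]) simp
  \<comment> \<open>This tells the two arcs apart by their first components, even for length 2,
    where they are antiparallel.\<close>
  moreover have "vs ! 0 \<noteq> vs ! (?k - 1)" using k by (subst nth_eq) auto
  ultimately show ?thesis by simp
qed

text \<open>Both cycles have degree 2 at a vertex of \<open>D\<close>, so \<open>D\<close> contains
  every edge of \<open>C\<close> there. Following \<open>C\<close> around from a vertex of
  \<open>D\<close> absorbs all of \<open>C\<close>.\<close>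

lemma cycle_subset_eq:
  assumes C: "C \<in> \<C>" and D: "D \<in> \<C>" and sub: "D \<subseteq> C"
  shows "D = C"
proof -
  have finC: "finite C" using C cycle_vertices by (fastforce simp: cyc_def)
  have closed: "e \<in> D" if e: "e \<in> C" "v \<in> ends e" "v \<in> verts D" for e v
  proof -
    have "v \<in> verts C" using e(3) sub by (auto simp: verts_def)
    then have "card {e \<in> D. v \<in> ends e} = card {e \<in> C. v \<in> ends e}"
      using card_incident[OF C] card_incident[OF D e(3)] by simp
    then have "{e \<in> D. v \<in> ends e} = {e \<in> C. v \<in> ends e}"
      using sub finC by (intro card_subset_eq) auto
    then show ?thesis using e by auto
  qed
  obtain ds where ds: "repr D ds" using repr_exists[OF D] by auto
  then have "ds \<noteq> []" by (auto simp: repr_def)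
  then have hd: "hd ds \<in> verts D" using repr_verts[OF ds] by auto
  moreover obtain vs0 where vs0: "repr C vs0" using repr_exists[OF C] by auto
  moreover have "verts D \<subseteq> verts C" using sub by (auto simp: verts_def)
  ultimately obtain vs where vs: "repr C vs" "hd vs = hd ds"
    using repr_hd repr_verts by (metis subset_iff)
  let ?e = "\<lambda>i. arc_edge (vs ! i, vs ! (Suc i mod length vs))"
  have Ceq: "C = {?e i |i. i < length vs}" using vs by (auto simp: repr_def cyc_index)
  then have mem: "?e i \<in> C" if "i < length vs" for i using that by blast
  have k: "2 \<le> length vs" using vs by (simp add: repr_def)
  have "vs ! i \<in> verts D \<and> ?e i \<in> D" if "i < length vs" for i
    using that
  proof (induction i)
    case 0
    have "vs ! 0 \<in> verts D" using vs hd k by (cases vs) auto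
    then show ?case using closed[OF mem[OF 0], of "vs ! 0"] by (simp add: ends_arc_edge)
  next
    case (Suc i)
    then have "vs ! Suc i \<in> ends (?e i)" "?e i \<in> D" by (auto simp: ends_arc_edge)
    then have "vs ! Suc i \<in> verts D" by (auto simp: verts_def)
    then show ?case using closed[OF mem[OF Suc.prems], of "vs ! Suc i"] by (simp add: ends_arc_edge)
  qed
  then show ?thesis using sub Ceq by auto
qed

context
  fixes S
  assumes S: "S \<subseteq> \<C>" and disj: "\<And>C D. C \<in> S \<Longrightarrow> D \<in> S \<Longrightarrow> C \<noteq> D \<Longrightarrow> verts C \<inter> verts D = {}"
begin

text \<open>At most one of the disjoint cycles passes through \<open>u\<close>, and it has two edges
  there. These are the steps of weight 1 in the matrix used below.\<close>

lemma card_neighbours_le: "card {v. arc_edge (u, v) \<in> \<Union>S} \<le> 2"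
proof (cases "\<exists>C\<in>S. u \<in> verts C")
  case True
  then obtain C where C: "C \<in> S" "u \<in> verts C" by auto
  have fin: "finite {e \<in> C. u \<in> ends e}"
    using C S card_incident[of C u] card_ge_0_finite[of "{e \<in> C. u \<in> ends e}"] by (auto simp: subset_iff)
  have sub: "(\<lambda>v. arc_edge (u, v)) ` {v. arc_edge (u, v) \<in> \<Union>S} \<subseteq> {e \<in> C. u \<in> ends e}"
  proof clarify
    fix v D assume D: "D \<in> S" "arc_edge (u, v) \<in> D"
    then have "u \<in> verts D" by (force simp: verts_def ends_arc_edge)
    then have "D = C" using disj[of C D] C D by auto
    then show "arc_edge (u, v) \<in> C \<and> u \<in> ends (arc_edge (u, v))" using D by (simp add: ends_arc_edge)
  qed
  have "inj_on (\<lambda>v. arc_edge (u, v)) {v. arc_edge (u, v) \<in> \<Union>S}"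
  proof (rule inj_onI)
    fix v w assume "arc_edge (u, v) = arc_edge (u, w)"
    then have "ends (arc_edge (u, v)) = ends (arc_edge (u, w))" by simp
    then show "v = w" unfolding ends_arc_edge by (auto simp: doubleton_eq_iff)
  qed
  from card_inj_on_le[OF this sub fin] show ?thesis
    using card_incident[of C u] C S by auto
next
  case False
  then have "{v. arc_edge (u, v) \<in> \<Union>S} = {}"
    by (force simp: verts_def ends_arc_edge)
  then show ?thesis by (simp only: card.empty)
qed

text \<open>Otherwise every edge by which \<open>D\<close> enters a vertex covered by
  \<open>S\<close> belongs to \<open>S\<close>, and going backwards around \<open>D\<close> puts all
  its edges into \<open>S\<close>. Consecutive edges share a vertex and members of \<open>S\<close>
  are disjoint, so a single member contains \<open>D\<close> and equals it by
  \<open>cycle_subset_eq\<close>.\<close>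

lemma leaving_repr:
  assumes D: "D \<in> \<C>" "D \<notin> S" and meet: "verts D \<inter> verts (\<Union>S) \<noteq> {}"
  shows "\<exists>vs. repr D vs \<and> hd vs \<in> verts (\<Union>S) \<and> arc_edge (last vs, hd vs) \<notin> \<Union>S"
proof -
  obtain vs where vs: "repr D vs" using repr_exists[OF D(1)] by auto
  let ?k = "length vs"
  have k: "2 \<le> ?k" and Deq: "D = arc_edge ` cyc vs" using vs by (auto simp: repr_def)
  let ?v = "\<lambda>i. vs ! (i mod ?k)"
  let ?e = "\<lambda>i. arc_edge (?v i, ?v (Suc i))"
  have "D = {arc_edge (vs ! i, vs ! (Suc i mod ?k)) |i. i < ?k}"
    using vs by (auto simp: repr_def cyc_index)
  also have "\<dots> = (\<lambda>i. arc_edge (vs ! i, vs ! (Suc i mod ?k))) ` {..<?k}" by auto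
  also have "\<dots> = ?e ` {..<?k}" by (intro image_cong) auto
  finally have De: "D = ?e ` {..<?k}" .
  have "\<exists>i. ?v (Suc i) \<in> verts (\<Union>S) \<and> ?e i \<notin> \<Union>S"
  proof (rule ccontr)
    assume "\<not> ?thesis"
    then have step: "?e i \<in> \<Union>S" if "?v (Suc i) \<in> verts (\<Union>S)" for i using that by auto
    have prev: "?v i \<in> verts (\<Union>S)" if "?v (Suc i) \<in> verts (\<Union>S)" for i
      using step[OF that] by (force simp: verts_def ends_arc_edge)
    obtain j where j: "?v j \<in> verts (\<Union>S)"
    proof -
      obtain v where v: "v \<in> verts D" "v \<in> verts (\<Union>S)" using meet by auto
      then obtain j where "j < ?k" "v = vs ! j" using repr_verts[OF vs] by (auto simp: in_set_conv_nth)
      then show ?thesis using v that[of j] by simp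
    qed
    have all: "?v i \<in> verts (\<Union>S)" for i
    proof -
      \<comment> \<open>Going backwards on the unrolled indices needs a start above
        \<open>i\<close>; adding a multiple of \<open>?k\<close> to \<open>j\<close> does not change
        the vertex.\<close>
      have "i \<le> j + ?k * i" using k by (metis le_add2 mult_le_mono1 nat_mult_1 one_le_numeral order_trans trans_le_add2)
      then show ?thesis
      proof (induction rule: inc_induct)
        case base
        show ?case using j by simp
      qed (use prev in blast)
    qed
    have edges: "?e i \<in> \<Union>S" for i using step all by blast
    then obtain C where C: "C \<in> S" "?e 0 \<in> C" by blast
    have "?e i \<in> C" for i
    proof (induction i)
      case (Suc i)
      obtain C' where C': "C' \<in> S" "?e (Suc i) \<in> C'" using edges by blast
      have "?v (Suc i) \<in> verts C" "?v (Suc i) \<in> verts C'"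
        using Suc C' by (force simp: verts_def ends_arc_edge)+
      then have "C' = C" using disj[of C C'] C C' by auto
      then show ?case using C' by simp
    qed (use C in simp)
    then have "D \<subseteq> C" unfolding De by blast
    then have "D = C" using cycle_subset_eq[of C D] C S D by auto
    then show False using C D by simp
  qed
  then obtain i where i: "?v (Suc i) \<in> verts (\<Union>S)" "?e i \<notin> \<Union>S" by auto
  \<comment> \<open>Rotating past \<open>i\<close> turns \<open>?e i\<close> into the closing
    edge.\<close>
  let ?ws = "rotate (Suc i) vs"
  have ne: "vs \<noteq> []" using k by auto
  have "hd ?ws = ?v (Suc i)" using ne by (subst hd_rotate_conv_nth) auto
  moreover have "last ?ws = ?v i"
  proof -
    have "last ?ws = ?ws ! (?k - 1)" using ne by (subst last_conv_nth) auto
    also have "\<dots> = vs ! ((Suc i + (?k - 1)) mod ?k)" using k by (subst nth_rotate) auto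
    also have "Suc i + (?k - 1) = i + ?k" using k by simp
    finally show ?thesis by simp
  qed
  ultimately show ?thesis using i repr_rotate[OF vs, of "Suc i"] by (intro exI[of _ ?ws]) auto
qed

text \<open>Edges outside the family contribute \<open>1 / n\<close> and edges inside contribute 1.
  The closing edge is outside, so its factor splits off and an open walk remains.\<close>

lemma repr_weight:
  assumes vs: "repr D vs" and closing: "arc_edge (last vs, hd vs) \<notin> \<Union>S"
  defines "M \<equiv> \<lambda>u v. if arc_edge (u, v) \<in> \<Union>S then 1 else 1 / real n"
  shows "(1 / real n) ^ card (D - \<Union>S) = walk_weight M vs / real n"
proof -
  obtain u r where ur: "vs = u # r" using vs by (cases vs) (auto simp: repr_def)
  have fin: "finite D" using vs by (auto simp: repr_def cyc_def)
  have "(1 / real n) ^ card (D - \<Union>S) = (\<Prod>e\<in>D. if e \<in> \<Union>S then 1 else 1 / real n)"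
    using fin by (simp add: prod.If_cases Diff_eq Collect_neg_eq[symmetric] del: Union_iff)
  also have "\<dots> = (\<Prod>p\<in>cyc vs. M (fst p) (snd p))"
    using repr_inj[OF vs] vs by (simp add: repr_def prod.reindex M_def)
  also have "\<dots> = prod_list (map (\<lambda>(a, b). M a b) (zip vs (rotate1 vs)))"
    unfolding cyc_def using vs
    by (subst prod.distinct_set_conv_list) (auto simp: repr_def distinct_zipI1 case_prod_unfold)
  also have "\<dots> = walk_weight M vs * M (last vs) (hd vs)"
    using prod_list_closed_walk[of M u r u] by (simp add: ur)
  also have "M (last vs) (hd vs) = 1 / real n"
    using closing by (simp add: M_def)
  finally show ?thesis by simp
qed

text \<open>Choosing one list per cycle is injective, so the cycles are dominated by all walks of
  \<open>k\<close> steps that start in \<open>U\<close>; the closing edge supplies the extra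
  \<open>1 / n\<close>.\<close>

lemma sum_repr_le:
  assumes n: "0 < n" and U: "U \<subseteq> {..<n}" and \<D>: "finite \<D>"
    and repr: "\<And>D. D \<in> \<D> \<Longrightarrow> card D = Suc k \<and>
      (\<exists>vs. repr D vs \<and> hd vs \<in> U \<and> arc_edge (last vs, hd vs) \<notin> \<Union>S)"
  shows "(\<Sum>D\<in>\<D>. (1 / real n) ^ card (D - \<Union>S)) \<le> card U * 3 ^ k / real n"
proof -
  define M where "M u v = (if arc_edge (u, v) \<in> \<Union>S then 1 else 1 / real n)" for u v
  have M: "0 \<le> M u v" for u v by (simp add: M_def)
  obtain \<rho> where \<rho>: "\<And>D. D \<in> \<D> \<Longrightarrow> repr D (\<rho> D) \<and> hd (\<rho> D) \<in> U \<and> arc_edge (last (\<rho> D), hd (\<rho> D)) \<notin> \<Union>S"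
    using repr by metis
  have inj: "inj_on \<rho> \<D>"
    using \<rho> by (intro inj_onI) (metis repr_def)
  let ?R = "{r. set r \<subseteq> {..<n} \<and> length r = k}"
  have finR: "finite ?R" by (rule finite_lists_length_eq) simp
  let ?L = "(\<lambda>(u, r). u # r) ` (U \<times> ?R)"
  have finU: "finite U" using U finite_subset by blast
  have sub: "\<rho> ` \<D> \<subseteq> ?L"
  proof
    fix vs assume "vs \<in> \<rho> ` \<D>"
    then obtain D where D: "D \<in> \<D>" "vs = \<rho> D" by auto
    then have "length vs = Suc k" "set vs \<subseteq> {..<n}" "hd vs \<in> U"
      using \<rho>[OF D(1)] repr[OF D(1)] by (auto simp: repr_def)
    then show "vs \<in> ?L" by (cases vs) auto
  qed
  have "(\<Sum>D\<in>\<D>. (1 / real n) ^ card (D - \<Union>S)) = (\<Sum>D\<in>\<D>. walk_weight M (\<rho> D) / real n)"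
  proof (intro sum.cong refl)
    fix D assume "D \<in> \<D>"
    then show "(1 / real n) ^ card (D - \<Union>S) = walk_weight M (\<rho> D) / real n"
      unfolding M_def[abs_def] using \<rho> by (intro repr_weight) auto
  qed
  also have "\<dots> = (\<Sum>vs\<in>\<rho> ` \<D>. walk_weight M vs / real n)"
    using inj by (simp add: sum.reindex)
  also have "\<dots> \<le> (\<Sum>vs\<in>?L. walk_weight M vs / real n)"
    using finU finR by (intro sum_mono2 sub) (auto simp: walk_weight_nonneg[OF M])
  also have "\<dots> = (\<Sum>(u, r)\<in>U \<times> ?R. walk_weight M (u # r) / real n)"
    by (subst sum.reindex) (auto simp: inj_on_def case_prod_beta)
  also have "\<dots> = (\<Sum>u\<in>U. (\<Sum>r\<in>?R. walk_weight M (u # r)) / real n)"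
    by (simp add: sum.cartesian_product[symmetric] sum_divide_distrib)
  also have "\<dots> \<le> (\<Sum>u\<in>U. 3 ^ k / real n)"
  proof (intro sum_mono divide_right_mono sum_walk_weight_le M)
    fix u
    let ?N = "{v. arc_edge (u, v) \<in> \<Union>S}"
    have "(\<Sum>v<n. M u v) \<le> (\<Sum>v<n. (if v \<in> ?N then 1 else 0) + 1 / real n)"
      by (intro sum_mono) (auto simp: M_def)
    also have "\<dots> = card ({..<n} \<inter> ?N) + 1"
      using n by (simp add: sum.distrib sum.If_cases)
    \<comment> \<open>An infinite set has cardinality 0, so \<open>card_neighbours_le\<close> limits
      the intersection only once \<open>?N\<close> is known to be finite.\<close>
    also have "card ({..<n} \<inter> ?N) \<le> 2"
    proof (cases "finite ?N")
      case True
      then have "card ({..<n} \<inter> ?N) \<le> card ?N" by (intro card_mono) auto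
      then show ?thesis using card_neighbours_le[of u] by linarith
    next
      case False
      have "finite ?N"
      proof (rule finite_subset)
        show "?N \<subseteq> verts (\<Union>S)" by (force simp: verts_def ends_arc_edge)
        have "verts (\<Union>S) \<subseteq> {..<n}" using verts_subset S unfolding verts_Union by blast
        then show "finite (verts (\<Union>S))" by (rule finite_subset) simp
      qed
      with False show ?thesis by simp
    qed
    finally show "(\<Sum>v<n. M u v) \<le> 3" by simp
  qed auto
  finally show ?thesis by simp
qed

end

text \<open>The case of an empty family: every edge costs \<open>1 / n\<close>, and any list
  starting in \<open>U\<close> is admissible. The power from \<open>k - 1\<close> steps is weakened
  to \<open>3 ^ k\<close>, which suits the sum defining \<open>\<tau>\<close>.\<close>

lemma sum_meeting_le:
  assumes n: "0 < n" and U: "U \<subseteq> {..<n}" and \<C>: "finite \<C>"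
  shows "(\<Sum>D | D \<in> \<C> \<and> card D = k \<and> verts D \<inter> U \<noteq> {}. (1 / real n) ^ k) \<le> card U * 3 ^ k / real n"
proof (cases k)
  case 0
  have "{D. D \<in> \<C> \<and> card D = k \<and> verts D \<inter> U \<noteq> {}} = {}"
    using cycle_vertices 0 by fastforce
  then show ?thesis by (simp only: sum.empty) simp
next
  case (Suc m)
  let ?\<D> = "{D. D \<in> \<C> \<and> card D = k \<and> verts D \<inter> U \<noteq> {}}"
  have "(\<Sum>D\<in>?\<D>. (1 / real n) ^ card (D - \<Union>{})) \<le> card U * 3 ^ m / real n"
  proof (rule sum_repr_le[OF _ _ n U])
    fix D assume D: "D \<in> ?\<D>"
    then obtain v where v: "v \<in> verts D" "v \<in> U" by auto
    obtain vs where "repr D vs" using repr_exists D by auto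
    then obtain ws where "repr D ws" "hd ws = v" using v repr_verts repr_hd by metis
    then show "card D = Suc m \<and> (\<exists>vs. repr D vs \<and> hd vs \<in> U \<and> arc_edge (last vs, hd vs) \<notin> \<Union>{})"
      using D v Suc by auto
  qed (use \<C> in auto)
  also have "\<dots> \<le> card U * 3 ^ k / real n"
    by (intro divide_right_mono mult_left_mono power_increasing) (auto simp: Suc)
  finally show ?thesis by simp
qed

text \<open>\<open>leaving_repr\<close> supplies lists that start at a covered vertex and close with
  an edge outside, so one factor \<open>1 / n\<close> is saved even though these cycles may have few
  edges of their own.\<close>

lemma sum_overlapping_le:
  assumes n: "0 < n" and \<C>: "finite \<C>"
    and S: "S \<subseteq> \<C>" "\<And>C D. C \<in> S \<Longrightarrow> D \<in> S \<Longrightarrow> C \<noteq> D \<Longrightarrow> verts C \<inter> verts D = {}"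
  shows "(\<Sum>D | D \<in> \<C> - S \<and> card D = k \<and> verts D \<inter> verts (\<Union>S) \<noteq> {}. (1 / real n) ^ card (D - \<Union>S))
    \<le> card (verts (\<Union>S)) * 3 ^ k / real n"
proof (cases k)
  case 0
  have "{D. D \<in> \<C> - S \<and> card D = k \<and> verts D \<inter> verts (\<Union>S) \<noteq> {}} = {}"
    using cycle_vertices 0 by fastforce
  then show ?thesis by (simp only: sum.empty) simp
next
  case (Suc m)
  have "verts (\<Union>S) \<subseteq> {..<n}" using verts_subset S unfolding verts_Union by blast
  then have "(\<Sum>D | D \<in> \<C> - S \<and> card D = k \<and> verts D \<inter> verts (\<Union>S) \<noteq> {}. (1 / real n) ^ card (D - \<Union>S))
      \<le> card (verts (\<Union>S)) * 3 ^ m / real n"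
    using leaving_repr[OF S] \<C> by (intro sum_repr_le[OF S n]) (auto simp: Suc)
  also have "\<dots> \<le> card (verts (\<Union>S)) * 3 ^ k / real n"
    by (intro divide_right_mono mult_left_mono power_increasing) (auto simp: Suc)
  finally show ?thesis .
qed

end

section \<open>Configurations of light cycles\<close>

locale light_cycle_family =
  cycle_family n arc_edge ends "short_cycles n Cs"
  for n :: nat and arc_edge :: "nat \<times> nat \<Rightarrow> 'e" and ends :: "'e \<Rightarrow> nat set" and Cs :: "'e set set" +
  fixes E :: "'e set" and c0 :: real
  assumes n_pos: "0 < n" and c0_pos: "0 < c0" and finite_E: "finite E" and finite_Cs: "finite Cs"
    and Cs_subset: "C \<in> Cs \<Longrightarrow> C \<subseteq> E"
begin

abbreviation "\<C> \<equiv> short_cycles n Cs"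
abbreviation "W \<equiv> weights E"
abbreviation "Sp \<equiv> state_space n Cs c0"
abbreviation "CS \<equiv> config_space Sp"
abbreviation "\<Lambda> \<equiv> light_intensity n E Cs c0"

sublocale W: prob_space "weights E" by (rule prob_space_weights)

definition X :: "'e set \<Rightarrow> ('e \<Rightarrow> real) \<Rightarrow> real" where
  "X C w = real n * mean_weight w C"

definition hit :: "'e set \<Rightarrow> ('e \<Rightarrow> real) \<Rightarrow> bool" where
  "hit C w \<longleftrightarrow> 0 < X C w \<and> X C w \<le> c0"

text \<open>The value \<open>c0\<close> off the event \<open>hit C w\<close> is arbitrary; it keeps the point in the state space.\<close>

definition point :: "'e set \<Rightarrow> ('e \<Rightarrow> real) \<Rightarrow> 'e set \<times> real" where
  "point C w = (C, if hit C w then X C w else c0)"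

definition conf :: "'e set set \<Rightarrow> ('e \<Rightarrow> real) \<Rightarrow> ('e set \<times> real) multiset" where
  "conf S w = image_mset (\<lambda>C. point C w) (mset_set S)"

text \<open>Only the cycles in \<open>S\<close> are inspected; others may be light as well. The
  event \<open>isolated\<close> below adds that they are not.\<close>

definition hits :: "'e set set \<Rightarrow> ('e set \<times> real) multiset set \<Rightarrow> ('e \<Rightarrow> real) set" where
  "hits S A = {w \<in> space W. (\<forall>C\<in>S. hit C w) \<and> conf S w \<in> A}"

definition p :: "'e set \<Rightarrow> real" where
  "p C = measure W {w \<in> space W. hit C w}"

definition fiber :: "'e set \<Rightarrow> ('e set \<times> real) set" where
  "fiber C = {C} \<times> {0<..c0}"

definition meets :: "'e set \<Rightarrow> 'e set \<Rightarrow> bool" where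
  "meets C D \<longleftrightarrow> verts C \<inter> verts D \<noteq> {}"

definition packing :: "'e set set \<Rightarrow> bool" where
  "packing S \<longleftrightarrow> S \<subseteq> \<C> \<and> (\<forall>C\<in>S. \<forall>D\<in>S. meets C D \<longrightarrow> C = D)"

text \<open>The configurations supported by a packing without double points. Double points are
  excluded by the case \<open>C = D\<close>, which occurs because a cycle meets itself.\<close>

definition separated :: "('e set \<times> real) multiset set" where
  "separated = {N \<in> space CS. \<forall>C\<in>\<C>. \<forall>D\<in>\<C>. meets C D \<longrightarrow>
     (if C = D then points (fiber C) N \<le> 1 else points (fiber C) N = 0 \<or> points (fiber D) N = 0)}"

lemma finite_\<C>: "finite \<C>"
  using finite_Cs by (simp add: short_cycles_def)

lemma \<C>_subset: "C \<in> \<C> \<Longrightarrow> C \<subseteq> E"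
  using Cs_subset by (auto simp: short_cycles_def)

lemma finite_cycle: "C \<in> \<C> \<Longrightarrow> finite C"
  using \<C>_subset finite_E finite_subset by blast

lemma card_cycle: "C \<in> \<C> \<Longrightarrow> 2 \<le> card C"
  using cycle_vertices by fastforce

lemma verts_nonempty: "C \<in> \<C> \<Longrightarrow> verts C \<noteq> {}"
  using card_verts card_cycle by fastforce

lemma meets_refl: "C \<in> \<C> \<Longrightarrow> meets C C"
  using verts_nonempty by (auto simp: meets_def)

lemma meets_sym: "meets C D \<longleftrightarrow> meets D C"
  by (auto simp: meets_def)

lemma not_meets_disjoint:
  assumes "C \<in> \<C>" "\<not> meets C D"
  shows "C \<inter> D = {}"
proof (rule ccontr)
  assume "C \<inter> D \<noteq> {}"
  then obtain e where e: "e \<in> C" "e \<in> D" by auto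
  then obtain u v where "e = arc_edge (u, v)" using cycle_vertices[OF assms(1)] by auto
  then have "u \<in> ends e" by (simp add: ends_arc_edge)
  then show False using e assms(2) by (auto simp: meets_def verts_def)
qed

lemma X_eq: "X C w = real n / real (card C) * (\<Sum>e\<in>C. w e)"
  by (simp add: X_def mean_weight_def)

lemma X_cong: "(\<And>e. e \<in> C \<Longrightarrow> w e = w' e) \<Longrightarrow> X C w = X C w'"
  by (simp add: X_eq)

lemma hit_cong: "(\<And>e. e \<in> C \<Longrightarrow> w e = w' e) \<Longrightarrow> hit C w = hit C w'"
  by (simp add: hit_def X_cong[of C w w'])

lemma point_cong: "(\<And>e. e \<in> C \<Longrightarrow> w e = w' e) \<Longrightarrow> point C w = point C w'"
  by (simp add: point_def hit_cong[of C w w'] X_cong[of C w w'])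

lemma conf_cong:
  assumes "\<And>e. e \<in> \<Union>S \<Longrightarrow> w e = w' e"
  shows "conf S w = conf S w'"
proof (cases "finite S")
  case True
  have "point C w = point C w'" if "C \<in> S" for C using assms that by (intro point_cong) auto
  then show ?thesis unfolding conf_def using True by (intro image_mset_cong) auto
qed (simp add: conf_def)

lemma conf_empty [simp]: "conf {} w = {#}"
  by (simp add: conf_def)

lemma conf_insert: "finite S \<Longrightarrow> C \<notin> S \<Longrightarrow> conf (insert C S) w = add_mset (point C w) (conf S w)"
  by (simp add: conf_def)

lemma measurable_X [measurable]: "C \<in> \<C> \<Longrightarrow> X C \<in> borel_measurable W"
  unfolding X_def[abs_def] using \<C>_subset by (intro borel_measurable_times measurable_mean_weight) auto

lemma measurable_hit [measurable]: "C \<in> \<C> \<Longrightarrow> Measurable.pred W (hit C)"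
  unfolding hit_def[abs_def] by measurable

lemma point_in_space: "C \<in> \<C> \<Longrightarrow> point C w \<in> space Sp"
  using c0_pos by (auto simp: point_def space_state_space hit_def)

lemma measurable_point [measurable]: "C \<in> \<C> \<Longrightarrow> point C \<in> W \<rightarrow>\<^sub>M Sp"
  unfolding state_space_def point_def[abs_def]
  using c0_pos by (intro measurable_Pair measurable_const measurable_restrict_space2)
    (auto simp: hit_def)

lemma measurable_conf [measurable]: "S \<subseteq> \<C> \<Longrightarrow> conf S \<in> W \<rightarrow>\<^sub>M CS"
proof -
  assume S: "S \<subseteq> \<C>"
  then have "finite S" using finite_\<C> finite_subset by blast
  then show ?thesis using S
  proof (induction S rule: finite_induct)
    case empty
    have "conf {} = (\<lambda>w. {#})" by (simp add: fun_eq_iff)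
    then show ?case by (simp add: space_config_space)
  next
    case (insert C S)
    have "conf (insert C S) = (\<lambda>w. add_mset (point C w) (conf S w))"
      using insert.hyps by (simp add: conf_insert fun_eq_iff)
    moreover have "(\<lambda>w. add_mset (point C w) (conf S w)) \<in> W \<rightarrow>\<^sub>M CS"
      using insert by (intro measurable_add_mset' measurable_point) auto
    ultimately show ?case by simp
  qed
qed

lemma finite_subset_\<C>: "S \<subseteq> \<C> \<Longrightarrow> finite S"
  using finite_\<C> finite_subset by blast

lemma hits_sets [measurable]: "S \<subseteq> \<C> \<Longrightarrow> A \<in> sets CS \<Longrightarrow> hits S A \<in> sets W"
proof -
  assume S: "S \<subseteq> \<C>" and [measurable]: "A \<in> sets CS"
  have [measurable]: "Measurable.pred W (\<lambda>w. \<forall>C\<in>S. hit C w)"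
    using S finite_subset_\<C>[OF S] by (intro pred_intros_finite) auto
  note [measurable] = measurable_conf[OF S]
  show ?thesis unfolding hits_def by measurable
qed

lemma emeasure_hits:
  assumes "S \<subseteq> \<C>" "A \<in> sets CS"
  shows "emeasure W (hits S A) = (\<integral>\<^sup>+ w. of_bool (\<forall>C\<in>S. hit C w) * indicator A (conf S w) \<partial>W)"
proof -
  have "emeasure W (hits S A) = (\<integral>\<^sup>+ w. indicator (hits S A) w \<partial>W)"
    by (rule nn_integral_indicator[symmetric]) (rule hits_sets[OF assms])
  also have "\<dots> = (\<integral>\<^sup>+ w. of_bool (\<forall>C\<in>S. hit C w) * indicator A (conf S w) \<partial>W)"
    by (intro nn_integral_cong) (auto simp: hits_def split: split_indicator)
  finally show ?thesis .
qed

lemma weights_decouple: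
  assumes "(\<lambda>(x, y). h x y) \<in> borel_measurable (W \<Otimes>\<^sub>M W)"
    and "\<And>x y x' y'. (\<And>i. i \<in> E \<inter> G \<Longrightarrow> x i = x' i) \<Longrightarrow> (\<And>i. i \<in> E - G \<Longrightarrow> y i = y' i) \<Longrightarrow> h x y = h x' y'"
  shows "(\<integral>\<^sup>+ x. h x x \<partial>W) = (\<integral>\<^sup>+ x. \<integral>\<^sup>+ y. h x y \<partial>W \<partial>W)"
  unfolding weights_def
proof (rule nn_integral_PiM_decouple[OF finite_E, where G=G])
  show "prob_space (density lborel (exponential_density 1))"
    by (rule prob_space_exponential_density) simp
qed (fact assms(1)[unfolded weights_def], rule assms(2))

text \<open>A cycle that meets no member of \<open>S\<close> shares no edge with them, so its point
  is independent of \<open>conf S\<close>. The resulting integral over the new point has the shape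
  of \<open>emeasure_poisson_layer_Suc\<close>.\<close>

lemma hits_insert:
  assumes C: "C \<in> \<C>" and S: "S \<subseteq> \<C>" and apart: "\<And>D. D \<in> S \<Longrightarrow> \<not> meets C D" and A: "A \<in> sets CS"
  shows "emeasure W (hits (insert C S) A) =
      (\<integral>\<^sup>+ x. of_bool (hit C x) * emeasure W (hits S {N \<in> space CS. add_mset (point C x) N \<in> A}) \<partial>W)"
    and "(\<lambda>x. of_bool (hit C x) * emeasure W (hits S {N \<in> space CS. add_mset (point C x) N \<in> A}))
      \<in> borel_measurable W"
proof -
  have CS: "C \<notin> S" using apart meets_refl[OF C] by auto
  note [measurable] = A measurable_conf[OF S] measurable_point[OF C] measurable_hit[OF C]
  have disj: "C \<inter> \<Union>S = {}" using not_meets_disjoint[OF C] apart by auto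
  have [measurable]: "Measurable.pred W (\<lambda>w. \<forall>C\<in>S. hit C w)"
    using S finite_subset_\<C>[OF S] by (intro pred_intros_finite) auto
  define h :: "('e \<Rightarrow> real) \<Rightarrow> ('e \<Rightarrow> real) \<Rightarrow> ennreal" where
    "h x y = of_bool (hit C x) * (of_bool (\<forall>D\<in>S. hit D y) * indicator A (add_mset (point C x) (conf S y)))" for x y
  have h_meas: "(\<lambda>(x, y). h x y) \<in> borel_measurable (W \<Otimes>\<^sub>M W)"
    unfolding h_def by measurable
  have slice: "(\<integral>\<^sup>+ y. h x y \<partial>W) =
      of_bool (hit C x) * emeasure W (hits S {N \<in> space CS. add_mset (point C x) N \<in> A})" for x
  proof -
    have pt: "(\<lambda>N. add_mset (point C x) N) \<in> CS \<rightarrow>\<^sub>M CS"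
      using point_in_space[OF C] by (intro measurable_add_mset') auto
    have "{N \<in> space CS. add_mset (point C x) N \<in> A} \<in> sets CS"
      using measurable_sets[OF pt A] by (simp add: vimage_def Int_def conj_commute)
    moreover have "conf S y \<in> space CS" if "y \<in> space W" for y
      using measurable_space[OF measurable_conf[OF S] that] .
    ultimately show ?thesis
      unfolding h_def by (subst emeasure_hits[OF S], simp, subst nn_integral_cmult)
        (auto intro!: arg_cong2[where f="(*)"] nn_integral_cong split: split_indicator)
  qed
  have "emeasure W (hits (insert C S) A) = (\<integral>\<^sup>+ w. h w w \<partial>W)"
    using C S CS finite_subset_\<C>[OF S] by (subst emeasure_hits[OF _ A])
      (auto intro!: nn_integral_cong simp: h_def conf_insert)
  also have "\<dots> = (\<integral>\<^sup>+ x. \<integral>\<^sup>+ y. h x y \<partial>W \<partial>W)"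
  proof (rule weights_decouple[where G=C])
    show "(\<lambda>(x, y). h x y) \<in> borel_measurable (W \<Otimes>\<^sub>M W)" by (rule h_meas)
    fix x y x' y' :: "'e \<Rightarrow> real"
    assume x: "\<And>i. i \<in> E \<inter> C \<Longrightarrow> x i = x' i" and y: "\<And>i. i \<in> E - C \<Longrightarrow> y i = y' i"
    have "hit C x = hit C x'" "point C x = point C x'"
      using x \<C>_subset[OF C] by (auto intro!: hit_cong point_cong)
    moreover have y': "y e = y' e" if "e \<in> \<Union>S" for e
      using that disj S \<C>_subset by (intro y) auto
    then have "(\<forall>D\<in>S. hit D y) = (\<forall>D\<in>S. hit D y')" "conf S y = conf S y'"
      by (auto intro!: conf_cong) (metis UnionI hit_cong)+
    ultimately show "h x y = h x' y'" by (simp add: h_def)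
  qed
  finally show "emeasure W (hits (insert C S) A) =
      (\<integral>\<^sup>+ x. of_bool (hit C x) * emeasure W (hits S {N \<in> space CS. add_mset (point C x) N \<in> A}) \<partial>W)"
    by (simp only: slice)
  show "(\<lambda>x. of_bool (hit C x) * emeasure W (hits S {N \<in> space CS. add_mset (point C x) N \<in> A}))
      \<in> borel_measurable W"
    using W.borel_measurable_nn_integral[OF h_meas] by (simp only: slice)
qed

lemma X_pos:
  assumes pos: "\<forall>e\<in>E. 0 < w e" and C: "C \<in> \<C>"
  shows "0 < X C w"
proof -
  have "0 < (\<Sum>e\<in>C. w e)"
    using pos \<C>_subset[OF C] finite_cycle[OF C] card_cycle[OF C] by (intro sum_pos) auto
  moreover have "0 < card C" using card_cycle[OF C] by simp
  ultimately show ?thesis using n_pos by (simp add: X_eq)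
qed

lemma AE_X_pos: "AE w in W. \<forall>C\<in>\<C>. 0 < X C w"
  using AE_weights_pos[OF finite_E] by eventually_elim (simp add: X_pos)

lemma light_points_eq_conf: "light_points n Cs c0 w = conf {C \<in> \<C>. hit C w} w"
proof -
  let ?H = "{C \<in> \<C>. hit C w}"
  have fin: "finite ?H" using finite_\<C> by simp
  have "light_points n Cs c0 w = mset_set ((\<lambda>C. (C, X C w)) ` ?H)"
    unfolding light_points_eq_image[OF n_pos] X_def hit_def ..
  also have "\<dots> = image_mset (\<lambda>C. (C, X C w)) (mset_set ?H)"
    using fin by (intro image_mset_mset_set[symmetric]) (auto simp: inj_on_def)
  also have "\<dots> = conf ?H w"
    unfolding conf_def using fin by (intro image_mset_cong) (auto simp: point_def)
  finally show ?thesis .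
qed

lemma points_conf: "finite S \<Longrightarrow> points B (conf S w) = card {C \<in> S. point C w \<in> B}"
  by (induction S rule: finite_induct)
    (auto simp: conf_insert points_add_mset Collect_conv_if insert_Collect[symmetric] conj_disj_distribR
      Collect_disj_eq card_insert_if)

lemma measurable_light [measurable]: "light_points n Cs c0 \<in> W \<rightarrow>\<^sub>M CS"
  using n_pos finite_Cs Cs_subset by (rule measurable_light_points)

lemma sets_\<Lambda> [simp, measurable_cong]: "sets \<Lambda> = sets Sp"
  by (simp add: light_intensity_def mean_measure_def)

lemma space_\<Lambda> [simp]: "space \<Lambda> = space Sp"
  by (rule sets_eq_imp_space_eq) simp

lemma emeasure_\<Lambda>:
  assumes B: "B \<in> sets Sp"
  shows "emeasure \<Lambda> B = (\<Sum>C\<in>\<C>. \<integral>\<^sup>+ w. of_bool (hit C w) * indicator B (point C w) \<partial>W)"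
proof -
  note [measurable] = B measurable_points[OF B]
  have "emeasure \<Lambda> B = (\<integral>\<^sup>+ w. of_nat (points B (light_points n Cs c0 w)) \<partial>W)"
    unfolding light_intensity_def light_process_def using B
    by (subst emeasure_mean_measure) (auto simp: nn_integral_distr)
  also have "\<dots> = (\<integral>\<^sup>+ w. (\<Sum>C\<in>\<C>. of_bool (hit C w) * indicator B (point C w)) \<partial>W)"
  proof (rule nn_integral_cong)
    fix w
    have fin: "finite {C \<in> \<C>. hit C w}" using finite_\<C> by simp
    have "(\<Sum>C\<in>\<C>. of_bool (hit C w) * indicator B (point C w) :: ennreal) =
        (\<Sum>C\<in>\<C>. if hit C w \<and> point C w \<in> B then 1 else 0)"
      by (intro sum.cong) auto
    also have "\<dots> = of_nat (card {C \<in> \<C>. hit C w \<and> point C w \<in> B})"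
      using finite_\<C> by (simp add: sum.If_cases Int_def)
    also have "{C \<in> \<C>. hit C w \<and> point C w \<in> B} = {C \<in> {C \<in> \<C>. hit C w}. point C w \<in> B}" by auto
    finally show "of_nat (points B (light_points n Cs c0 w)) =
        (\<Sum>C\<in>\<C>. of_bool (hit C w) * indicator B (point C w) :: ennreal)"
      by (simp add: light_points_eq_conf points_conf[OF fin])
  qed
  also have "\<dots> = (\<Sum>C\<in>\<C>. \<integral>\<^sup>+ w. of_bool (hit C w) * indicator B (point C w) \<partial>W)"
    by (rule nn_integral_sum) measurable
  finally show ?thesis .
qed

text \<open>Presents \<open>\<Lambda>\<close> as the image under \<open>point\<close> of counting
  measure times \<open>W\<close>, restricted to the hits. Integrals over a Poisson point become
  integrals over edge weights, ready for \<open>hits_insert\<close>.\<close>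

lemma nn_integral_\<Lambda>:
  assumes [measurable]: "f \<in> borel_measurable Sp"
  shows "(\<integral>\<^sup>+ z. f z \<partial>\<Lambda>) = (\<Sum>C\<in>\<C>. \<integral>\<^sup>+ w. of_bool (hit C w) * f (point C w) \<partial>W)"
proof -
  interpret pair_sigma_finite "count_space \<C>" W
    using finite_\<C> by (intro pair_sigma_finite.intro sigma_finite_measure_count_space_finite W.sigma_finite_measure_axioms)
  let ?D = "density (count_space \<C> \<Otimes>\<^sub>M W) (\<lambda>(C, w). of_bool (hit C w))"
  have m: "(\<lambda>(C, w). g C w) \<in> count_space \<C> \<Otimes>\<^sub>M W \<rightarrow>\<^sub>M N" if "\<And>C. C \<in> \<C> \<Longrightarrow> g C \<in> W \<rightarrow>\<^sub>M N" for g N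
    using that finite_\<C> by (intro measurable_pair_measure_countable1) (auto intro: countable_finite)
  have [measurable]: "(\<lambda>(C, w). of_bool (hit C w) :: ennreal) \<in> borel_measurable (count_space \<C> \<Otimes>\<^sub>M W)"
    by (intro m) measurable
  have [measurable]: "(\<lambda>(C, w). point C w) \<in> count_space \<C> \<Otimes>\<^sub>M W \<rightarrow>\<^sub>M Sp"
    by (intro m measurable_point)
  have int: "(\<integral>\<^sup>+ z. g z \<partial>distr ?D Sp (\<lambda>(C, w). point C w)) =
      (\<Sum>C\<in>\<C>. \<integral>\<^sup>+ w. of_bool (hit C w) * g (point C w) \<partial>W)"
    if [measurable]: "g \<in> borel_measurable Sp" for g
  proof -
    have "(\<integral>\<^sup>+ z. g z \<partial>distr ?D Sp (\<lambda>(C, w). point C w)) =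
        (\<integral>\<^sup>+ z. (case z of (C, w) \<Rightarrow> of_bool (hit C w) * g (point C w)) \<partial>(count_space \<C> \<Otimes>\<^sub>M W))"
      by (subst nn_integral_distr, simp, simp, subst nn_integral_density)
        (auto intro!: nn_integral_cong)
    also have "\<dots> = (\<integral>\<^sup>+ C. \<integral>\<^sup>+ w. of_bool (hit C w) * g (point C w) \<partial>W \<partial>count_space \<C>)"
      by (subst W.nn_integral_fst[symmetric]) (auto intro!: m)
    also have "\<dots> = (\<Sum>C\<in>\<C>. \<integral>\<^sup>+ w. of_bool (hit C w) * g (point C w) \<partial>W)"
      using finite_\<C> by (rule nn_integral_count_space_finite)
    finally show ?thesis .
  qed
  have "\<Lambda> = distr ?D Sp (\<lambda>(C, w). point C w)"
  proof (rule measure_eqI)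
    fix B assume "B \<in> sets \<Lambda>"
    then have B: "B \<in> sets Sp" by simp
    then show "emeasure \<Lambda> B = emeasure (distr ?D Sp (\<lambda>(C, w). point C w)) B"
      using int[of "indicator B"] by (simp add: emeasure_\<Lambda>)
  qed simp
  then show ?thesis using int[OF assms] by simp
qed

end

section \<open>The Poisson process on disjoint cycles\<close>

lemma (in finite_measure) measurable_poisson_layer_slice:
  assumes A: "A \<in> sets (config_space M)"
  shows "(\<lambda>z. emeasure (poisson_layer M m) {N \<in> space (config_space M). add_mset z N \<in> A}) \<in> borel_measurable M"
proof -
  interpret L: finite_measure "poisson_layer M m" by (rule finite_poisson_layer)
  let ?X = "(\<lambda>(z, N). add_mset z N) -` A \<inter> space (M \<Otimes>\<^sub>M poisson_layer M m)"
  have f: "(\<lambda>(z, N). add_mset z N) \<in> M \<Otimes>\<^sub>M poisson_layer M m \<rightarrow>\<^sub>M config_space M"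
    by measurable
  have "(\<lambda>z. emeasure (poisson_layer M m) (Pair z -` ?X)) \<in> borel_measurable M"
    by (rule L.measurable_emeasure_Pair) (rule measurable_sets[OF f A])
  moreover have "Pair z -` ?X = {N \<in> space (config_space M). add_mset z N \<in> A}" if "z \<in> space M" for z
    using that by (auto simp: space_pair_measure)
  ultimately show ?thesis by (simp cong: measurable_cong)
qed

context light_cycle_family
begin

lemma config_space_\<Lambda> [simp]: "config_space \<Lambda> = CS"
  by (rule config_space_cong) simp

lemma fiber_sets [measurable]: "C \<in> \<C> \<Longrightarrow> fiber C \<in> sets Sp"
  unfolding fiber_def state_space_def
  by (intro pair_measureI) (auto simp: sets_restrict_space_iff)

lemma point_in_fiber: "point C w \<in> fiber D \<longleftrightarrow> C = D"
  using c0_pos by (auto simp: point_def fiber_def hit_def)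

lemma points_fiber_conf: "finite S \<Longrightarrow> points (fiber D) (conf S w) = (if D \<in> S then 1 else 0)"
  by (simp add: points_conf point_in_fiber Collect_conv_if conj_commute[of "_ \<in> S"] cong: conj_cong)

lemma emeasure_p: "C \<in> \<C> \<Longrightarrow> emeasure W {w \<in> space W. hit C w} = ennreal (p C)"
  by (simp add: p_def W.emeasure_eq_measure)

lemma p_nonneg: "0 \<le> p C"
  by (simp add: p_def)

lemma nn_integral_hit: "C \<in> \<C> \<Longrightarrow> (\<integral>\<^sup>+ w. of_bool (hit C w) \<partial>W) = ennreal (p C)"
proof -
  assume C: "C \<in> \<C>"
  have "(\<integral>\<^sup>+ w. of_bool (hit C w) \<partial>W) = (\<integral>\<^sup>+ w. indicator {w \<in> space W. hit C w} w \<partial>W)"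
    by (intro nn_integral_cong) (auto split: split_indicator)
  also have "\<dots> = emeasure W {w \<in> space W. hit C w}"
    using C by (intro nn_integral_indicator) measurable
  finally show ?thesis using emeasure_p[OF C] by simp
qed

lemma emeasure_\<Lambda>_fiber:
  assumes "C \<in> \<C>"
  shows "emeasure \<Lambda> (fiber C) = ennreal (p C)"
proof -
  have "emeasure \<Lambda> (fiber C) = (\<Sum>D\<in>\<C>. if D = C then ennreal (p C) else 0)"
    unfolding emeasure_\<Lambda>[OF fiber_sets[OF assms]]
    by (intro sum.cong) (auto simp: nn_integral_hit point_in_fiber indicator_def)
  then show ?thesis using assms finite_\<C> by simp
qed

lemma emeasure_\<Lambda>_space: "emeasure \<Lambda> (space Sp) = ennreal (\<Sum>C\<in>\<C>. p C)"
proof -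
  have "emeasure \<Lambda> (space Sp) = (\<Sum>C\<in>\<C>. \<integral>\<^sup>+ w. of_bool (hit C w) \<partial>W)"
    using emeasure_\<Lambda>[OF sets.top] point_in_space by (auto intro!: sum.cong nn_integral_cong)
  also have "\<dots> = (\<Sum>C\<in>\<C>. ennreal (p C))" by (intro sum.cong refl nn_integral_hit)
  finally show ?thesis by (simp add: sum_ennreal p_nonneg)
qed

sublocale \<Lambda>: finite_measure "light_intensity n E Cs c0"
  by (rule finite_measureI) (simp add: emeasure_\<Lambda>_space)

lemma measure_\<Lambda>_fiber: "C \<in> \<C> \<Longrightarrow> measure \<Lambda> (fiber C) = p C"
  using emeasure_\<Lambda>_fiber by (simp add: measure_def p_nonneg)

lemma measure_\<Lambda>_space: "measure \<Lambda> (space Sp) = (\<Sum>C\<in>\<C>. p C)"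
  using emeasure_\<Lambda>_space by (simp add: measure_def sum_nonneg p_nonneg)

lemma separated_sets [measurable]: "separated \<in> sets CS"
proof -
  have [measurable]: "Measurable.pred CS (\<lambda>N. if C = D then points (fiber C) N \<le> 1
      else points (fiber C) N = 0 \<or> points (fiber D) N = 0)"
    if "C \<in> \<C>" "D \<in> \<C>" for C D
    using measurable_points[OF fiber_sets[OF that(1)]] measurable_points[OF fiber_sets[OF that(2)]]
    by measurable
  have "Measurable.pred CS (\<lambda>N. \<forall>C\<in>\<C>. \<forall>D\<in>\<C>. meets C D \<longrightarrow>
     (if C = D then points (fiber C) N \<le> 1 else points (fiber C) N = 0 \<or> points (fiber D) N = 0))"
    by (intro pred_intros_finite finite_\<C> pred_intros_imp') measurable
  then show ?thesis unfolding separated_def by measurable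
qed

lemma finite_packings: "finite {S. packing S \<and> P S}"
  by (rule finite_subset[of _ "Pow \<C>"]) (auto simp: packing_def finite_\<C>)

lemma packing_subset: "packing S \<Longrightarrow> S \<subseteq> \<C>"
  by (simp add: packing_def)

lemma packing_finite: "packing S \<Longrightarrow> finite S"
  using packing_subset finite_subset_\<C> by blast

lemma packing_insert:
  "packing (insert C S) \<longleftrightarrow> packing S \<and> C \<in> \<C> \<and> (\<forall>D\<in>S. meets C D \<longrightarrow> C = D)"
  using meets_sym by (auto simp: packing_def)

abbreviation fits :: "'e set \<Rightarrow> 'e set set \<Rightarrow> bool" where
  "fits C S \<equiv> C \<notin> S \<and> packing (insert C S)"

text \<open>Double counting: a packing of size \<open>Suc m\<close> arises from \<open>Suc m\<close>
  pairs, one for each cycle removed from it. This factor turns \<open>fact m\<close> into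
  \<open>fact (Suc m)\<close> in the induction over layers.\<close>

lemma sum_packings_insert:
  fixes a :: "'e set set \<Rightarrow> ennreal"
  shows "(\<Sum>C\<in>\<C>. \<Sum>S | packing S \<and> card S = m. of_bool (fits C S) * a (insert C S)) =
    of_nat (Suc m) * (\<Sum>S | packing S \<and> card S = Suc m. a S)"
proof -
  let ?P = "\<lambda>m. {S. packing S \<and> card S = m}"
  let ?T = "{(C, S). C \<in> \<C> \<and> S \<in> ?P m \<and> C \<notin> S \<and> packing (insert C S)}"
  have "(\<Sum>C\<in>\<C>. \<Sum>S\<in>?P m. of_bool (fits C S) * a (insert C S)) =
      (\<Sum>z\<in>\<C> \<times> ?P m. if z \<in> ?T then a (insert (fst z) (snd z)) else 0)"
    unfolding sum.cartesian_product by (intro sum.cong) auto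
  also have "\<dots> = (\<Sum>z\<in>?T. a (insert (fst z) (snd z)))"
    using finite_\<C> finite_packings by (subst sum.inter_restrict[symmetric]) (auto intro!: sum.cong)
  also have "\<dots> = (\<Sum>z\<in>Sigma (?P (Suc m)) (\<lambda>S. S). a (fst z))"
  proof (rule sum.reindex_bij_witness[where i="\<lambda>(S, C). (C, S - {C})" and j="\<lambda>(C, S). (insert C S, C)"])
    fix z assume "z \<in> Sigma (?P (Suc m)) (\<lambda>S. S)"
    then obtain S C where z: "z = (S, C)" "packing S" "card S = Suc m" "C \<in> S" by auto
    then have ins: "insert C (S - {C}) = S" by auto
    then have "packing (S - {C})" using z(2) packing_insert by metis
    moreover have "C \<in> \<C>" using z packing_subset by auto
    moreover have "card (S - {C}) = m" using z packing_finite[OF z(2)] by simp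
    ultimately show "(case z of (S, C) \<Rightarrow> (C, S - {C})) \<in> ?T" using z ins by simp
    show "(case case z of (S, C) \<Rightarrow> (C, S - {C}) of (C, S) \<Rightarrow> (insert C S, C)) = z" using z ins by simp
  qed (auto simp: packing_finite)
  also have "\<dots> = (\<Sum>S\<in>?P (Suc m). \<Sum>C\<in>S. a S)"
    by (subst sum.Sigma) (auto intro: packing_finite finite_packings simp: case_prod_beta)
  also have "\<dots> = of_nat (Suc m) * (\<Sum>S\<in>?P (Suc m). a S)"
    unfolding sum_distrib_left by (intro sum.cong) auto
  finally show ?thesis .
qed

text \<open>The new point lies on some cycle \<open>C\<close>, and separation forces the other
  points off every cycle meeting \<open>C\<close>. By \<open>nn_integral_\<Lambda>\<close> and
  \<open>hits_insert\<close> the bound then passes through the recursion; \<open>fact m\<close>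
  counts the orders in which the points of a configuration can be laid down.\<close>

lemma poisson_layer_separated_le:
  assumes "A \<in> sets CS"
  shows "emeasure (poisson_layer \<Lambda> m) (A \<inter> separated) \<le>
    fact m * (\<Sum>S | packing S \<and> card S = m. emeasure W (hits S A))"
  using assms
proof (induction m arbitrary: A)
  case 0
  have "{S. packing S \<and> card S = 0} = {{}}"
    by (auto simp: packing_finite) (auto simp: packing_def)
  moreover have "hits {} A = (if {#} \<in> A then space W else {})" by (auto simp: hits_def)
  ultimately show ?case using 0 W.emeasure_space_1 by (auto simp: indicator_def)
next
  case (Suc m)
  note A [measurable] = Suc.prems
  let ?P = "{S. packing S \<and> card S = m}"
  let ?slice = "\<lambda>C x. {N \<in> space CS. add_mset (point C x) N \<in> A}"
  let ?s = "\<lambda>z. emeasure (poisson_layer \<Lambda> m) {N \<in> space CS. add_mset z N \<in> A \<inter> separated}"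
  have s_meas: "?s \<in> borel_measurable Sp"
    using \<Lambda>.measurable_poisson_layer_slice[of "A \<inter> separated" m] by simp
  have slice_sets: "?slice C x \<in> sets CS" if C: "C \<in> \<C>" for C x
  proof -
    have "(\<lambda>N. add_mset (point C x) N) \<in> CS \<rightarrow>\<^sub>M CS"
      using point_in_space[OF C] by (intro measurable_add_mset') auto
    from measurable_sets[OF this A] show ?thesis by (simp add: vimage_def Int_def conj_commute)
  qed
  have s_le: "?s (point C x) \<le> fact m * (\<Sum>S\<in>?P. of_bool (fits C S) * emeasure W (hits S (?slice C x)))"
    if C: "C \<in> \<C>" for C x
  proof -
    let ?z = "point C x"
    \<comment> \<open>The condition that the new point imposes on the others is kept inside the
      event, so that it survives the induction hypothesis.\<close>
    let ?A = "{N \<in> ?slice C x. \<forall>D\<in>\<C>. meets C D \<longrightarrow> points (fiber D) N = 0}"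
    have pts: "points (fiber D) (add_mset ?z N) = (if C = D then 1 else 0) + points (fiber D) N" for D N
      by (simp add: points_add_mset point_in_fiber)
    have "Measurable.pred CS (\<lambda>N. \<forall>D\<in>\<C>. meets C D \<longrightarrow> points (fiber D) N = 0)"
    proof (intro pred_intros_finite finite_\<C> pred_intros_imp')
      fix D assume "D \<in> \<C>"
      note [measurable] = measurable_points[OF fiber_sets[OF this]]
      show "Measurable.pred CS (\<lambda>N. points (fiber D) N = 0)" by measurable
    qed
    then have "?slice C x \<inter> {N \<in> space CS. \<forall>D\<in>\<C>. meets C D \<longrightarrow> points (fiber D) N = 0} \<in> sets CS"
      using slice_sets[OF C] by (intro sets.Int) auto
    then have A': "?A \<in> sets CS" by (rule back_subst[where P="\<lambda>A. A \<in> sets CS"]) auto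
    have "{N \<in> space CS. add_mset ?z N \<in> A \<inter> separated} \<subseteq> ?A \<inter> separated"
    proof
      fix N assume "N \<in> {N \<in> space CS. add_mset ?z N \<in> A \<inter> separated}"
      then have N: "N \<in> space CS" "add_mset ?z N \<in> A" and sep: "add_mset ?z N \<in> separated" by auto
      have sepD: "if D = D' then points (fiber D) (add_mset ?z N) \<le> 1
          else points (fiber D) (add_mset ?z N) = 0 \<or> points (fiber D') (add_mset ?z N) = 0"
        if "D \<in> \<C>" "D' \<in> \<C>" "meets D D'" for D D'
        using sep that unfolding separated_def by blast
      have "points (fiber D) N = 0" if "D \<in> \<C>" "meets C D" for D
        using sepD[OF C that] unfolding pts by (auto split: if_splits)
      moreover have "if D = D' then points (fiber D) N \<le> 1
          else points (fiber D) N = 0 \<or> points (fiber D') N = 0"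
        if "D \<in> \<C>" "D' \<in> \<C>" "meets D D'" for D D'
        using sepD[OF that] unfolding pts by (auto split: if_splits)
      then have "N \<in> separated"
        using N(1) unfolding separated_def by blast
      ultimately show "N \<in> ?A \<inter> separated" using N by auto
    qed
    then have "?s ?z \<le> emeasure (poisson_layer \<Lambda> m) (?A \<inter> separated)"
      using A' by (intro emeasure_mono) auto
    also have "\<dots> \<le> fact m * (\<Sum>S\<in>?P. emeasure W (hits S ?A))"
      by (rule Suc.IH[OF A'])
    also have "\<dots> \<le> fact m * (\<Sum>S\<in>?P. of_bool (fits C S) * emeasure W (hits S (?slice C x)))"
    proof (intro mult_left_mono sum_mono)
      fix S assume "S \<in> ?P"
      then have S: "packing S" by simp
      show "emeasure W (hits S ?A) \<le> of_bool (fits C S) * emeasure W (hits S (?slice C x))"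
      proof (cases "fits C S")
        case True
        have "hits S ?A \<subseteq> hits S (?slice C x)" by (auto simp: hits_def)
        then show ?thesis using True hits_sets[OF packing_subset[OF S] slice_sets[OF C]]
          by (simp add: emeasure_mono)
      next
        case False
        \<comment> \<open>If \<open>C\<close> does not fit, some member of \<open>S\<close> meets
          it, possibly \<open>C\<close> itself, and puts a point on a forbidden fiber.\<close>
        have "hits S ?A = {}"
        proof (rule ccontr)
          assume "hits S ?A \<noteq> {}"
          then obtain y where y: "\<And>D. D \<in> \<C> \<Longrightarrow> meets C D \<Longrightarrow> points (fiber D) (conf S y) = 0"
            by (auto simp: hits_def)
          then have apart: "\<not> meets C D" if "D \<in> S" for D
            using that packing_subset[OF S] points_fiber_conf[OF packing_finite[OF S], of D y] by force
          then show False using False S C meets_refl[OF C] by (auto simp: packing_insert)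
        qed
        then show ?thesis by simp
      qed
    qed simp
    finally show ?thesis .
  qed
  have "emeasure (poisson_layer \<Lambda> (Suc m)) (A \<inter> separated) = (\<integral>\<^sup>+ z. ?s z \<partial>\<Lambda>)"
    using \<Lambda>.emeasure_poisson_layer_Suc[of "A \<inter> separated" m] by simp
  also have "\<dots> = (\<Sum>C\<in>\<C>. \<integral>\<^sup>+ x. of_bool (hit C x) * ?s (point C x) \<partial>W)"
    by (rule nn_integral_\<Lambda>[OF s_meas])
  also have "\<dots> \<le> (\<Sum>C\<in>\<C>. \<integral>\<^sup>+ x. (\<Sum>S\<in>?P. fact m * (of_bool (fits C S) *
      (of_bool (hit C x) * emeasure W (hits S (?slice C x))))) \<partial>W)"
  proof (intro sum_mono nn_integral_mono)
    fix C x assume C: "C \<in> \<C>"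
    have "of_bool (hit C x) * ?s (point C x) \<le> of_bool (hit C x) *
      (fact m * (\<Sum>S\<in>?P. of_bool (fits C S) * emeasure W (hits S (?slice C x))))"
      by (intro mult_left_mono s_le[OF C]) simp
    then show "of_bool (hit C x) * ?s (point C x) \<le> (\<Sum>S\<in>?P. fact m * (of_bool (fits C S) *
      (of_bool (hit C x) * emeasure W (hits S (?slice C x)))))"
      by (simp add: sum_distrib_left mult_ac)
  qed
  also have "\<dots> = (\<Sum>C\<in>\<C>. \<Sum>S\<in>?P. fact m * (of_bool (fits C S) * emeasure W (hits (insert C S) A)))"
  proof (intro sum.cong refl)
    fix C assume C: "C \<in> \<C>"
    let ?f = "\<lambda>S x. of_bool (hit C x) * emeasure W (hits S (?slice C x))"
    have ins: "emeasure W (hits (insert C S) A) = (\<integral>\<^sup>+ x. ?f S x \<partial>W)" "?f S \<in> borel_measurable W"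
      if "C \<notin> S" "packing (insert C S)" for S
    proof -
      have "S \<subseteq> \<C>" "\<And>D. D \<in> S \<Longrightarrow> \<not> meets C D"
        using that by (auto simp: packing_insert packing_def)
      from hits_insert[OF C this A] show "emeasure W (hits (insert C S) A) = (\<integral>\<^sup>+ x. ?f S x \<partial>W)"
        "?f S \<in> borel_measurable W" by auto
    qed
    have meas: "(\<lambda>x. fact m * (of_bool (fits C S) * ?f S x)) \<in> borel_measurable W" for S
      using ins(2)[of S] by (cases "fits C S") auto
    show "(\<integral>\<^sup>+ x. (\<Sum>S\<in>?P. fact m * (of_bool (fits C S) * ?f S x)) \<partial>W) =
        (\<Sum>S\<in>?P. fact m * (of_bool (fits C S) * emeasure W (hits (insert C S) A)))"
    proof (subst nn_integral_sum[OF meas], intro sum.cong refl)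
      fix S
      show "(\<integral>\<^sup>+ x. fact m * (of_bool (fits C S) * ?f S x) \<partial>W) =
          fact m * (of_bool (fits C S) * emeasure W (hits (insert C S) A))"
        using ins[of S] by (cases "fits C S") (auto simp: nn_integral_cmult)
    qed
  qed
  also have "\<dots> = fact m * (of_nat (Suc m) * (\<Sum>S | packing S \<and> card S = Suc m. emeasure W (hits S A)))"
    by (simp only: sum_distrib_left[symmetric] sum_packings_insert[of "\<lambda>S. emeasure W (hits S A)" m])
  finally show ?case by (simp add: mult_ac)
qed

definition mass :: real where
  "mass = (\<Sum>C\<in>\<C>. p C)"

text \<open>The factorials of law and layer cancel. The sum over the number of points is finite
  because no packing has more than \<open>card \<C>\<close> members, and grouping by size gives the
  sum over all packings.\<close>

lemma poisson_law_separated_le: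
  assumes A: "A \<in> sets CS"
  shows "measure (poisson_law \<Lambda>) (A \<inter> separated) \<le> exp (- mass) * (\<Sum>S | packing S. measure W (hits S A))"
proof -
  interpret Q: prob_space "poisson_law \<Lambda>" by (rule \<Lambda>.prob_space_poisson_law)
  let ?a = "\<lambda>S. emeasure W (hits S A)"
  let ?P = "\<lambda>m. {S. packing S \<and> card S = m}"
  have fact: "(fact m :: ennreal) = ennreal (fact m)" for m
    by (metis ennreal_of_nat_eq_real_of_nat of_nat_fact)
  have "emeasure (poisson_law \<Lambda>) (A \<inter> separated) =
      (\<Sum>m. ennreal (exp (- mass) / fact m) * emeasure (poisson_layer \<Lambda> m) (A \<inter> separated))"
    using A by (subst emeasure_poisson_law) (auto simp: measure_\<Lambda>_space mass_def)
  also have "\<dots> \<le> (\<Sum>m. ennreal (exp (- mass)) * (\<Sum>S\<in>?P m. ?a S))"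
  proof (intro suminf_le allI summableI)
    fix m
    have "ennreal (exp (- mass) / fact m) * emeasure (poisson_layer \<Lambda> m) (A \<inter> separated) \<le>
        ennreal (exp (- mass) / fact m) * (fact m * (\<Sum>S\<in>?P m. ?a S))"
      by (intro mult_left_mono poisson_layer_separated_le A) simp
    also have "\<dots> = ennreal (exp (- mass) / fact m) * ennreal (fact m) * (\<Sum>S\<in>?P m. ?a S)"
      by (simp only: mult.assoc fact)
    also have "ennreal (exp (- mass) / fact m) * ennreal (fact m) = ennreal (exp (- mass))"
      by (subst ennreal_mult'[symmetric]) auto
    finally show "ennreal (exp (- mass) / fact m) * emeasure (poisson_layer \<Lambda> m) (A \<inter> separated) \<le>
        ennreal (exp (- mass)) * (\<Sum>S\<in>?P m. ?a S)" .
  qed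
  also have "\<dots> = (\<Sum>m\<le>card \<C>. ennreal (exp (- mass)) * (\<Sum>S\<in>?P m. ?a S))"
  proof (rule suminf_finite)
    fix m assume "m \<notin> {..card \<C>}"
    then have "?P m = {}" using card_mono[OF finite_\<C>] packing_subset by force
    then show "ennreal (exp (- mass)) * (\<Sum>S\<in>?P m. ?a S) = 0" by (simp only: sum.empty mult_zero_right)
  qed simp
  also have "\<dots> = ennreal (exp (- mass)) * (\<Sum>m\<le>card \<C>. \<Sum>S\<in>{S \<in> Collect packing. card S = m}. ?a S)"
    by (simp add: sum_distrib_left)
  also have "(\<Sum>m\<le>card \<C>. \<Sum>S\<in>{S \<in> Collect packing. card S = m}. ?a S) = (\<Sum>S | packing S. ?a S)"
    using finite_packings[of "\<lambda>_. True"] card_mono[OF finite_\<C>] packing_subset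
    by (intro sum.group) auto
  also have "\<dots> = ennreal (\<Sum>S | packing S. measure W (hits S A))"
    by (simp add: W.emeasure_eq_measure sum_ennreal)
  also have "ennreal (exp (- mass)) * \<dots> = ennreal (exp (- mass) * (\<Sum>S | packing S. measure W (hits S A)))"
    by (subst ennreal_mult) (auto intro: sum_nonneg)
  finally show ?thesis by (simp add: Q.emeasure_eq_measure sum_nonneg)
qed

text \<open>Ordered pairs with the diagonal: besides intersecting cycles this accounts for double
  points and for the second-order loss in \<open>exp_mass_le_void\<close>.\<close>

definition overlap :: real where
  "overlap = (\<Sum>C\<in>\<C>. \<Sum>D | D \<in> \<C> \<and> meets C D. p C * p D)"

text \<open>A union bound over the violated conditions. Distinct fibers have independent Poisson
  counts, so a double point on \<open>C\<close> costs \<open>1 - (1 + p C) * exp (- p C)\<close>,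
  and points on two different cycles cost \<open>(1 - exp (- p C)) * (1 - exp (- p D))\<close>; both
  are second order in \<open>p\<close>.\<close>

lemma poisson_law_not_separated_le: "measure (poisson_law \<Lambda>) (space CS - separated) \<le> overlap"
proof -
  interpret Q: prob_space "poisson_law \<Lambda>" by (rule \<Lambda>.prob_space_poisson_law)
  let ?Q = "measure (poisson_law \<Lambda>)"
  define bad where "bad C D = {N \<in> space CS. \<not> (if C = D then points (fiber C) N \<le> 1
      else points (fiber C) N = 0 \<or> points (fiber D) N = 0)}" for C D
  have count: "{N \<in> space CS. points (fiber C) N = k} \<in> sets CS" if "C \<in> \<C>" for C k
    using measurable_points[OF fiber_sets[OF that]] by measurable
  have law1: "?Q {N \<in> space CS. points (fiber C) N = k} = p C ^ k / fact k * exp (- p C)" if "C \<in> \<C>" for C k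
    using \<Lambda>.emeasure_poisson_law_counts[of "{C}" fiber "\<lambda>_. k"] that
    by (simp add: disjoint_family_on_def measure_\<Lambda>_fiber Q.emeasure_eq_measure p_nonneg)
  have law2: "?Q {N \<in> space CS. points (fiber C) N = 0 \<and> points (fiber D) N = 0} = exp (- p C) * exp (- p D)"
    if "C \<in> \<C>" "D \<in> \<C>" "C \<noteq> D" for C D
  proof -
    have disj: "disjoint_family_on fiber {C, D}"
      using that(3) by (auto simp: disjoint_family_on_def fiber_def)
    have fib: "B \<in> {C, D} \<Longrightarrow> fiber B \<in> sets \<Lambda>" for B using that by auto
    from \<Lambda>.emeasure_poisson_law_counts[OF _ fib disj, of "\<lambda>_. 0"] show ?thesis
      using that by (simp add: measure_\<Lambda>_fiber Q.emeasure_eq_measure)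
  qed
  have bad_le: "?Q (bad C D) \<le> p C * p D" and bad_sets: "bad C D \<in> sets CS" if CD: "C \<in> \<C>" "D \<in> \<C>" for C D
  proof -
    let ?N = "\<lambda>C k. {N \<in> space CS. points (fiber C) N = k}"
    have "?Q (bad C D) \<le> p C * p D \<and> bad C D \<in> sets CS"
    proof (cases "C = D")
      case True
      have "bad C D = space (poisson_law \<Lambda>) - (?N C 0 \<union> ?N C 1)"
        using True by (auto simp: bad_def le_Suc_eq)
      moreover have "?Q (?N C 0 \<union> ?N C 1) = exp (- p C) + p C * exp (- p C)"
        using law1[OF CD(1), of 0] law1[OF CD(1), of 1] count[OF CD(1)]
        by (subst Q.finite_measure_Union) auto
      moreover have "1 - (exp (- p C) + p C * exp (- p C)) \<le> p C * p C"
      proof -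
        have "(1 + - p C) * (1 + p C) \<le> exp (- p C) * (1 + p C)"
          using p_nonneg[of C] by (intro mult_right_mono exp_ge_add_one_self) auto
        then show ?thesis by (simp add: algebra_simps)
      qed
      ultimately show ?thesis using count[OF CD(1)] True Q.prob_compl[of "?N C 0 \<union> ?N C 1"] by auto
    next
      case False
      have "bad C D = space (poisson_law \<Lambda>) - (?N C 0 \<union> ?N D 0)"
        using False by (auto simp: bad_def)
      moreover have "?Q (?N C 0 \<union> ?N D 0) = exp (- p C) + exp (- p D) - exp (- p C) * exp (- p D)"
      proof -
        have "?N C 0 \<inter> ?N D 0 = {N \<in> space CS. points (fiber C) N = 0 \<and> points (fiber D) N = 0}" by auto
        then show ?thesis
          using law1[OF CD(1), of 0] law1[OF CD(2), of 0] law2[OF CD False] count[OF CD(1)] count[OF CD(2)]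
          by (simp add: Q.finite_measure_Union')
             (subst Q.finite_measure_Diff', auto simp: Int_commute)
      qed
      moreover have "1 - (exp (- p C) + exp (- p D) - exp (- p C) * exp (- p D)) \<le> p C * p D"
      proof -
        have "(1 - exp (- p C)) * (1 - exp (- p D)) \<le> p C * p D"
          using exp_ge_add_one_self[of "- p C"] exp_ge_add_one_self[of "- p D"] p_nonneg
          by (intro mult_mono) auto
        then show ?thesis by (simp add: algebra_simps)
      qed
      ultimately show ?thesis using count[OF CD(1)] count[OF CD(2)] Q.prob_compl[of "?N C 0 \<union> ?N D 0"] by auto
    qed
    then show "?Q (bad C D) \<le> p C * p D" "bad C D \<in> sets CS" by auto
  qed
  let ?M = "\<lambda>C. {D. D \<in> \<C> \<and> meets C D}"
  have "space CS - separated = (\<Union>C\<in>\<C>. \<Union>D\<in>?M C. bad C D)"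
    unfolding separated_def bad_def by blast
  then have "?Q (space CS - separated) \<le> (\<Sum>C\<in>\<C>. ?Q (\<Union>D\<in>?M C. bad C D))"
    using finite_\<C> bad_sets by (simp, intro Q.finite_measure_subadditive_finite) auto
  also have "\<dots> \<le> (\<Sum>C\<in>\<C>. \<Sum>D\<in>?M C. ?Q (bad C D))"
    using finite_\<C> bad_sets by (intro sum_mono Q.finite_measure_subadditive_finite) auto
  also have "\<dots> \<le> overlap"
    unfolding overlap_def by (intro sum_mono bad_le) auto
  finally show ?thesis .
qed

end

section \<open>Light cycles on disjoint cycles\<close>

lemma power_div_fact_le_exp:
  fixes x :: real
  assumes "0 \<le> x"
  shows "x ^ m / fact m \<le> exp x"
proof -
  have "(\<lambda>k. x ^ k / fact k) sums exp x"
    using exp_converges[of x] by (simp add: field_simps)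
  then show ?thesis
    using sum_le_suminf[of "\<lambda>k. x ^ k / fact k" "{m}"] assms by (auto simp: sums_iff)
qed

context light_cycle_family
begin

text \<open>The probability that no cycle is light if these events were independent.\<close>

definition void :: real where
  "void = (\<Prod>C\<in>\<C>. 1 - p C)"

text \<open>Bounds the expected number of light short cycles through a given vertex:
  \<open>3 ^ k\<close> bounds the weighted walks, \<open>exp c0 ^ k\<close> comes from
  \<open>p_le\<close>, and \<open>1 / n\<close> from the closing edge. The cost of cycles
  overlapping a packing obeys the same bound per covered vertex.\<close>

definition \<tau> :: real where
  "\<tau> = (\<Sum>k\<le>nat \<lfloor>L0 n\<rfloor>. (3 * exp c0) ^ k) / real n"

lemma card_le_L0: "C \<in> \<C> \<Longrightarrow> card C \<le> nat \<lfloor>L0 n\<rfloor>"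
  by (auto simp: short_cycles_def le_nat_floor)

lemma hit_AE: "AE w in W. \<forall>C\<in>\<C>. hit C w \<longleftrightarrow> X C w \<le> c0"
  using AE_X_pos by eventually_elim (auto simp: hit_def)

lemma measure_X_le: "C \<in> \<C> \<Longrightarrow> measure W {w \<in> space W. X C w \<le> c0} = p C"
proof -
  assume C: "C \<in> \<C>"
  note [measurable] = measurable_X[OF C] measurable_hit[OF C]
  show ?thesis
    unfolding p_def
  proof (rule W.finite_measure_eq_AE)
    show "AE w in W. (w \<in> {w \<in> space W. X C w \<le> c0}) = (w \<in> {w \<in> space W. hit C w})"
      using hit_AE
    proof eventually_elim
      case (elim w)
      then have "hit C w \<longleftrightarrow> X C w \<le> c0" using C by blast
      then show ?case by simp
    qed
    show "{w \<in> space W. X C w \<le> c0} \<in> sets W" by measurable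
    show "{w \<in> space W. hit C w} \<in> sets W" by measurable
  qed
qed

lemma p_le_1: "p C \<le> 1"
  by (simp add: p_def)

lemma measure_miss:
  assumes "C \<in> \<C>"
  shows "measure W {w \<in> space W. c0 < X C w} = 1 - p C"
proof -
  have "{w \<in> space W. c0 < X C w} = space W - {w \<in> space W. X C w \<le> c0}" by auto
  moreover have "{w \<in> space W. X C w \<le> c0} \<in> sets W"
    using measurable_X[OF assms] by measurable
  ultimately show ?thesis using W.prob_compl measure_X_le[OF assms] by metis
qed

lemma expectation_of_bool:
  assumes "Measurable.pred W P"
  shows "(\<integral>w. of_bool (P w) \<partial>W) = measure W {w \<in> space W. P w}"
proof -
  have "(\<integral>w. of_bool (P w) \<partial>W) = (\<integral>w. indicat_real {w \<in> space W. P w} w \<partial>W)"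
    by (intro Bochner_Integration.integral_cong) (auto split: split_indicator)
  also have "\<dots> = measure W {w \<in> space W. P w}"
    by (simp add: Int_absorb2[of _ "space W"] Collect_restrict)
  finally show ?thesis .
qed

lemma X_mono: "x \<le> y \<Longrightarrow> X C (w(i := x)) \<le> X C (w(i := y))"
  unfolding X_eq by (intro mult_left_mono sum_mono) auto

lemma Harris_events:
  assumes P: "Measurable.pred W P" and Q: "Measurable.pred W Q"
    and "\<And>i x y w. i \<in> E - G \<Longrightarrow> x \<le> y \<Longrightarrow> P (w(i := x)) \<Longrightarrow> P (w(i := y))"
    and "\<And>i x y w. i \<in> E - G \<Longrightarrow> x \<le> y \<Longrightarrow> Q (w(i := x)) \<Longrightarrow> Q (w(i := y))"
    and "\<And>i x y w. i \<in> E \<inter> G \<Longrightarrow> Q (w(i := x)) \<Longrightarrow> Q (w(i := y))"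
  shows "measure W {w \<in> space W. P w} * measure W {w \<in> space W. Q w} \<le> measure W {w \<in> space W. P w \<and> Q w}"
proof -
  have PQ: "Measurable.pred W (\<lambda>w. P w \<and> Q w)" using P Q by measurable
  have "W.expectation (\<lambda>w. of_bool (P w)) * W.expectation (\<lambda>w. of_bool (Q w)) \<le>
      (W.expectation (\<lambda>w. of_bool (P w) * of_bool (Q w)) :: real)"
    unfolding weights_def
  proof (rule Harris_inequality[of E "\<lambda>_. density lborel (exponential_density 1)" "\<lambda>w. of_bool (P w)" "\<lambda>w. of_bool (Q w)" G])
    show "finite E" by (rule finite_E)
    show "space (density lborel (exponential_density 1)) = (UNIV :: real set)" by simp
    show "prob_space (density lborel (exponential_density 1))"
      by (rule prob_space_exponential_density) simp
    show "(\<lambda>w. of_bool (P w)) \<in> borel_measurable (PiM E (\<lambda>_. density lborel (exponential_density 1)))"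
      "(\<lambda>w. of_bool (Q w)) \<in> borel_measurable (PiM E (\<lambda>_. density lborel (exponential_density 1)))"
      using P Q unfolding weights_def by measurable
    show "of_bool (P (w(i := x))) \<le> (of_bool (P (w(i := y))) :: real)" if "i \<in> E - G" "x \<le> y" for i x y w
      using assms(3)[OF that, of w] by auto
    show "of_bool (Q (w(i := x))) \<le> (of_bool (Q (w(i := y))) :: real)" if "i \<in> E - G" "x \<le> y" for i x y w
      using assms(4)[OF that, of w] by auto
    show "of_bool (Q (w(i := x))) = (of_bool (Q (w(i := y))) :: real)" if "i \<in> E \<inter> G" for i x y w
      using assms(5)[OF that, of w x y] assms(5)[OF that, of w y x] by auto
  qed auto
  then show ?thesis
    using expectation_of_bool[OF P] expectation_of_bool[OF Q] expectation_of_bool[OF PQ]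
    by (simp add: of_bool_conj)
qed

lemma pred_all_miss: "\<D> \<subseteq> \<C> \<Longrightarrow> Measurable.pred W (\<lambda>w. \<forall>D\<in>\<D>. c0 < X D w)"
proof -
  assume D: "\<D> \<subseteq> \<C>"
  show ?thesis
  proof (intro pred_intros_finite finite_subset_\<C>[OF D])
    fix C assume "C \<in> \<D>"
    then have [measurable]: "X C \<in> borel_measurable W" using D by (intro measurable_X) auto
    show "Measurable.pred W (\<lambda>w. c0 < X C w)" by measurable
  qed
qed

lemma void_probability_ge:
  assumes "\<D> \<subseteq> \<C>"
  shows "(\<Prod>D\<in>\<D>. 1 - p D) \<le> measure W {w \<in> space W. \<forall>D\<in>\<D>. c0 < X D w}"
  using finite_subset_\<C>[OF assms] assms
proof (induction \<D> rule: finite_induct)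
  case (insert C \<D>)
  have "(\<Prod>D\<in>insert C \<D>. 1 - p D) = (1 - p C) * (\<Prod>D\<in>\<D>. 1 - p D)"
    using insert.hyps by simp
  also have "\<dots> \<le> measure W {w \<in> space W. c0 < X C w} * measure W {w \<in> space W. \<forall>D\<in>\<D>. c0 < X D w}"
    using insert by (subst measure_miss) (auto intro!: mult_left_mono simp: p_le_1)
  also have "\<dots> \<le> measure W {w \<in> space W. c0 < X C w \<and> (\<forall>D\<in>\<D>. c0 < X D w)}"
  proof (rule Harris_events[where G="{}"])
    show "Measurable.pred W (\<lambda>w. c0 < X C w)" using pred_all_miss[of "{C}"] insert by simp
    show "Measurable.pred W (\<lambda>w. \<forall>D\<in>\<D>. c0 < X D w)" using pred_all_miss insert by simp
    fix i x y and w :: "'e \<Rightarrow> real" assume xy: "(x::real) \<le> y"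
    show "c0 < X C (w(i := y))" if "c0 < X C (w(i := x))"
      using that X_mono[OF xy] by (rule less_le_trans)
    show "\<forall>D\<in>\<D>. c0 < X D (w(i := y))" if "\<forall>D\<in>\<D>. c0 < X D (w(i := x))"
      using that X_mono[OF xy] by (meson less_le_trans)
  qed simp
  also have "\<dots> = measure W {w \<in> space W. \<forall>D\<in>insert C \<D>. c0 < X D w}" by simp
  finally show ?case .
qed (simp add: W.prob_space)

text \<open>All factors lie between 0 and 1, so dropping some of them only increases the product.
  One quantity \<open>void\<close> thus serves every packing, whichever cycles remain once those in
  it and near it are removed.\<close>

lemma void_le: "\<D> \<subseteq> \<C> \<Longrightarrow> void \<le> (\<Prod>D\<in>\<D>. 1 - p D)"
proof -
  assume D: "\<D> \<subseteq> \<C>"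
  have "void = (\<Prod>D\<in>\<C> - \<D>. 1 - p D) * (\<Prod>D\<in>\<D>. 1 - p D)"
    unfolding void_def by (rule prod.subset_diff[OF D finite_\<C>])
  also have "\<dots> \<le> 1 * (\<Prod>D\<in>\<D>. 1 - p D)"
    using p_le_1 p_nonneg by (intro mult_right_mono prod_le_1 prod_nonneg) auto
  finally show ?thesis by simp
qed

lemma void_nonneg: "0 \<le> void"
  unfolding void_def using p_le_1 by (intro prod_nonneg) auto

text \<open>Disjoint cycles use disjoint sets of weights; \<open>hits_insert\<close> with the full
  configuration space peels off one factor at a time.\<close>

lemma measure_hits_space:
  assumes "packing S"
  shows "measure W (hits S (space CS)) = (\<Prod>C\<in>S. p C)"
proof -
  have S: "S \<subseteq> \<C>" using assms by (simp add: packing_def)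
  have fin: "finite S" using finite_subset_\<C>[OF S] .
  have "emeasure W (hits S (space CS)) = ennreal (\<Prod>C\<in>S. p C)"
    using fin assms
  proof (induction S rule: finite_induct)
    case empty
    have "hits {} (space CS) = space W" by (auto simp: hits_def space_config_space)
    then show ?case by (simp add: W.emeasure_space_1)
  next
    case (insert C S)
    have C: "C \<in> \<C>" and S: "S \<subseteq> \<C>" "packing S" and apart: "\<And>D. D \<in> S \<Longrightarrow> \<not> meets C D"
      using insert by (auto simp: packing_def)
    have "hits S {N \<in> space CS. add_mset (point C x) N \<in> space CS} = hits S (space CS)" for x
      using point_in_space[OF C, of x] by (auto simp: hits_def space_config_space)
    then have "emeasure W (hits (insert C S) (space CS)) =
        (\<integral>\<^sup>+ x. of_bool (hit C x) * emeasure W (hits S (space CS)) \<partial>W)"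
      using hits_insert(1)[OF C S(1) apart sets.top] by simp
    also have "\<dots> = (\<integral>\<^sup>+ x. indicator {w \<in> space W. hit C w} x \<partial>W) * emeasure W (hits S (space CS))"
      using measurable_hit[OF C]
      by (subst nn_integral_multc[symmetric]) (auto intro!: nn_integral_cong split: split_indicator)
    also have "\<dots> = ennreal (p C) * ennreal (\<Prod>C\<in>S. p C)"
      using insert.IH[OF S(2)] measurable_hit[OF C] by (simp add: p_def W.emeasure_eq_measure)
    finally show ?case
      using insert.hyps by (simp add: ennreal_mult' p_nonneg)
  qed
  then show ?thesis by (simp add: measure_def prod_nonneg p_nonneg)
qed

text \<open>If \<open>D\<close> is light, its edges outside the packing weigh at most
  \<open>c0 * card D / n\<close> together, and they are independent of the packing. The numerator in
  \<open>measure_weights_sum_le\<close> is absorbed by \<open>x ^ m / fact m \<le> exp x\<close>,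
  uniformly in the number \<open>m\<close> of these edges.\<close>

lemma joint_light_le:
  assumes S: "packing S" and D: "D \<in> \<C>"
  shows "measure W {w \<in> space W. (\<forall>C\<in>S. hit C w) \<and> X D w \<le> c0} \<le>
    (\<Prod>C\<in>S. p C) * (exp (c0 * card D) * (1 / real n) ^ card (D - \<Union>S))"
proof -
  have S': "S \<subseteq> \<C>" using S by (simp add: packing_def)
  let ?H = "D - \<Union>S" and ?t = "c0 * card D / real n"
  let ?J = "{w \<in> space W. (\<forall>C\<in>S. hit C w) \<and> X D w \<le> c0}"
  let ?T = "{w \<in> space W. (\<Sum>e\<in>?H. w e) \<le> ?t}"
  have H: "?H \<subseteq> E" using \<C>_subset[OF D] by auto
  have t: "0 \<le> ?t" using c0_pos by simp
  have [measurable]: "Measurable.pred W (\<lambda>w. \<forall>C\<in>S. hit C w)"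
    using S' finite_subset_\<C>[OF S'] by (intro pred_intros_finite) auto
  have [measurable]: "(\<lambda>w. \<Sum>e\<in>?H. w e) \<in> borel_measurable W"
    using H by (intro borel_measurable_sum measurable_weights_component) auto
  note [measurable] = measurable_X[OF D]
  define h :: "('e \<Rightarrow> real) \<Rightarrow> ('e \<Rightarrow> real) \<Rightarrow> ennreal" where
    "h x y = of_bool (\<forall>C\<in>S. hit C x) * of_bool ((\<Sum>e\<in>?H. y e) \<le> ?t)" for x y
  have "emeasure W ?J =
      (\<integral>\<^sup>+ w. indicator ?J w \<partial>W)"
    by (rule nn_integral_indicator[symmetric]) measurable
  also have "\<dots> \<le> (\<integral>\<^sup>+ w. h w w \<partial>W)"
  proof (rule nn_integral_mono_AE)
    show "AE w in W. indicator ?J w \<le> h w w"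
      using AE_weights_pos[OF finite_E]
    proof eventually_elim
      case (elim w)
      have "(\<Sum>e\<in>?H. w e) \<le> ?t" if "X D w \<le> c0"
      proof -
        have "(\<Sum>e\<in>?H. w e) \<le> (\<Sum>e\<in>D. w e)"
          using elim \<C>_subset[OF D] finite_cycle[OF D] by (intro sum_mono2) (auto intro: less_imp_le)
        also have "\<dots> \<le> ?t"
          using that n_pos card_cycle[OF D] by (simp add: X_eq field_simps)
        finally show ?thesis .
      qed
      then show ?case by (auto simp: h_def split: split_indicator)
    qed
  qed
  also have "\<dots> = (\<integral>\<^sup>+ x. \<integral>\<^sup>+ y. h x y \<partial>W \<partial>W)"
  proof (rule weights_decouple[where G="\<Union>S"])
    show "(\<lambda>(x, y). h x y) \<in> borel_measurable (W \<Otimes>\<^sub>M W)"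
      unfolding h_def by measurable
    fix x y x' y' :: "'e \<Rightarrow> real"
    assume x: "\<And>i. i \<in> E \<inter> \<Union>S \<Longrightarrow> x i = x' i" and y: "\<And>i. i \<in> E - \<Union>S \<Longrightarrow> y i = y' i"
    have "hit C x = hit C x'" if "C \<in> S" for C
      using that S' \<C>_subset by (intro hit_cong x) auto
    moreover have "(\<Sum>e\<in>?H. y e) = (\<Sum>e\<in>?H. y' e)"
      using H by (intro sum.cong y) auto
    ultimately show "h x y = h x' y'" by (simp add: h_def)
  qed
  also have "\<dots> = (\<integral>\<^sup>+ x. of_bool (\<forall>C\<in>S. hit C x) * emeasure W ?T \<partial>W)"
  proof (rule nn_integral_cong)
    fix x
    have m: "?T \<in> sets W" by measurable
    have "(\<integral>\<^sup>+ y. h x y \<partial>W) = (\<integral>\<^sup>+ y. of_bool (\<forall>C\<in>S. hit C x) *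
        indicator ?T y \<partial>W)"
      unfolding h_def by (intro nn_integral_cong) (auto split: split_indicator)
    also have "\<dots> = of_bool (\<forall>C\<in>S. hit C x) * (\<integral>\<^sup>+ y. indicator ?T y \<partial>W)"
      using m by (intro nn_integral_cmult borel_measurable_indicator)
    finally show "(\<integral>\<^sup>+ y. h x y \<partial>W) = of_bool (\<forall>C\<in>S. hit C x) * emeasure W ?T"
      by (simp only: nn_integral_indicator[OF m])
  qed
  also have "\<dots> = (\<integral>\<^sup>+ x. indicator (hits S (space CS)) x * emeasure W ?T \<partial>W)"
    using measurable_space[OF measurable_conf[OF S']]
    by (intro nn_integral_cong) (auto simp: hits_def split: split_indicator)
  also have "\<dots> = emeasure W (hits S (space CS)) * emeasure W ?T"
    using hits_sets[OF S' sets.top] by (subst nn_integral_multc) auto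
  also have "\<dots> = ennreal ((\<Prod>C\<in>S. p C) * measure W ?T)"
    using measure_hits_space[OF S] by (simp add: W.emeasure_eq_measure ennreal_mult' prod_nonneg p_nonneg)
  finally have "measure W ?J \<le>
      (\<Prod>C\<in>S. p C) * measure W ?T"
    by (simp add: W.emeasure_eq_measure prod_nonneg p_nonneg)
  also have "measure W ?T \<le> ?t ^ card ?H / fact (card ?H)"
    by (rule measure_weights_sum_le[OF finite_E H t])
  also have "\<dots> = (c0 * card D) ^ card ?H / fact (card ?H) * (1 / real n) ^ card ?H"
    by (simp add: power_divide)
  also have "\<dots> \<le> exp (c0 * card D) * (1 / real n) ^ card ?H"
    using c0_pos by (intro mult_right_mono power_div_fact_le_exp) auto
  finally show ?thesis
    by (simp add: mult_left_mono prod_nonneg p_nonneg)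
qed

definition isolated :: "'e set set \<Rightarrow> ('e set \<times> real) multiset set \<Rightarrow> ('e \<Rightarrow> real) set" where
  "isolated S A = {w \<in> hits S A. \<forall>D\<in>\<C> - S. c0 < X D w}"

definition cost :: "'e set set \<Rightarrow> 'e set \<Rightarrow> real" where
  "cost S D = exp (c0 * card D) * (1 / real n) ^ card (D - \<Union>S)"

definition near :: "'e set set \<Rightarrow> 'e set set" where
  "near S = {D \<in> \<C> - S. verts D \<inter> verts (\<Union>S) \<noteq> {}}"

text \<open>The cycles outside \<open>S\<close> are split. Near ones may share edges with
  \<open>S\<close> and are removed by a union bound through \<open>joint_light_le\<close>. Far ones
  avoid the edges of \<open>S\<close>, so \<open>?Q\<close> ignores the weights on which
  \<open>?P\<close> is unrestricted; in the other weights \<open>?P\<close> is increasing, because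
  there it only asks near cycles to be heavy.\<close>

lemma isolated_hits_ge:
  assumes S: "packing S" and A: "A \<in> sets CS"
  shows "void * (measure W (hits S A) -
      (\<Prod>C\<in>S. p C) * (\<Sum>D\<in>near S. cost S D))
    \<le> measure W (isolated S A)"
proof -
  have S': "S \<subseteq> \<C>" using S by (simp add: packing_def)
  let ?far = "\<C> - S - near S"
  let ?P = "\<lambda>w. ((\<forall>C\<in>S. hit C w) \<and> conf S w \<in> A) \<and> (\<forall>D\<in>near S. c0 < X D w)"
  let ?Q = "\<lambda>w. \<forall>D\<in>?far. c0 < X D w"
  have near: "near S \<subseteq> \<C>" by (auto simp: near_def)
  note [measurable] = A measurable_conf[OF S']
  have [measurable]: "Measurable.pred W (\<lambda>w. \<forall>C\<in>S. hit C w)"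
    using S' finite_subset_\<C>[OF S'] by (intro pred_intros_finite) auto
  have [measurable]: "Measurable.pred W (\<lambda>w. \<forall>D\<in>near S. c0 < X D w)" "Measurable.pred W ?Q"
    by (rule pred_all_miss, use near in auto)+
  let ?B = "\<lambda>D. {w \<in> space W. (\<forall>C\<in>S. hit C w) \<and> X D w \<le> c0}"
  have B: "?B D \<in> sets W" if "D \<in> near S" for D
  proof -
    have [measurable]: "X D \<in> borel_measurable W" using that near by (intro measurable_X) auto
    show ?thesis by measurable
  qed
  have P: "{w \<in> space W. ?P w} \<in> sets W" by measurable
  have "measure W (hits S A) \<le> measure W ({w \<in> space W. ?P w} \<union> (\<Union>D\<in>near S. ?B D))"
  proof (rule W.finite_measure_mono)
    show "hits S A \<subseteq> {w \<in> space W. ?P w} \<union> (\<Union>D\<in>near S. ?B D)" by (auto simp: hits_def not_less)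
    show "{w \<in> space W. ?P w} \<union> (\<Union>D\<in>near S. ?B D) \<in> sets W"
      using B by (intro sets.Un P sets.finite_UN finite_subset_\<C>[OF near])
  qed
  also have "\<dots> \<le> measure W {w \<in> space W. ?P w} + measure W (\<Union>D\<in>near S. ?B D)"
    using B by (intro measure_Un_le P sets.finite_UN finite_subset_\<C>[OF near])
  also have "measure W (\<Union>D\<in>near S. ?B D) \<le> (\<Sum>D\<in>near S. measure W (?B D))"
    using B finite_subset_\<C>[OF near] by (intro W.finite_measure_subadditive_finite) auto
  also have "\<dots> \<le> (\<Sum>D\<in>near S. (\<Prod>C\<in>S. p C) * cost S D)"
    using near by (intro sum_mono joint_light_le[OF S, folded cost_def]) auto
  finally have P_ge: "measure W (hits S A) -
      (\<Prod>C\<in>S. p C) * (\<Sum>D\<in>near S. cost S D) \<le>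
      measure W {w \<in> space W. ?P w}"
    by (simp add: sum_distrib_left)
  have "void * (measure W (hits S A) -
      (\<Prod>C\<in>S. p C) * (\<Sum>D\<in>near S. cost S D))
    \<le> void * measure W {w \<in> space W. ?P w}"
    by (intro mult_left_mono P_ge void_nonneg)
  also have "\<dots> \<le> measure W {w \<in> space W. ?Q w} * measure W {w \<in> space W. ?P w}"
  proof (intro mult_right_mono)
    have far: "?far \<subseteq> \<C>" by blast
    show "void \<le> measure W {w \<in> space W. ?Q w}"
      using void_le[OF far] void_probability_ge[OF far] by (rule order_trans)
  qed simp
  also have "\<dots> = measure W {w \<in> space W. ?P w} * measure W {w \<in> space W. ?Q w}"
    by (rule mult.commute)
  also have "\<dots> \<le> measure W {w \<in> space W. ?P w \<and> ?Q w}"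
  proof (rule Harris_events[where G="\<Union>S"])
    fix i x y and w :: "'e \<Rightarrow> real"
    assume i: "i \<in> E - \<Union>S" and xy: "(x::real) \<le> y"
    have h: "hit C (w(i := x)) = hit C (w(i := y))" if "C \<in> S" for C
      using that i by (intro hit_cong) auto
    have c: "conf S (w(i := x)) = conf S (w(i := y))"
      using i by (intro conf_cong) auto
    have miss: "\<forall>D\<in>\<D>. c0 < X D (w(i := y))" if "\<forall>D\<in>\<D>. c0 < X D (w(i := x))" for \<D>
      using that X_mono[OF xy] by (meson less_le_trans)
    show "?P (w(i := y))" if P: "?P (w(i := x))"
    proof (intro conjI ballI)
      show "hit C (w(i := y))" if "C \<in> S" for C using P h[OF that] that by blast
      show "conf S (w(i := y)) \<in> A" using P unfolding c by blast
      show "c0 < X D (w(i := y))" if "D \<in> near S" for D using P miss that by blast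
    qed
    show "?Q (w(i := y))" if "?Q (w(i := x))" by (rule miss[OF that])
  next
    fix i x y and w :: "'e \<Rightarrow> real"
    assume i: "i \<in> E \<inter> \<Union>S"
    have "X D (w(i := x)) = X D (w(i := y))" if D: "D \<in> ?far" for D
    proof (rule X_cong)
      obtain C where C: "C \<in> S" "i \<in> C" using i by auto
      have "\<not> meets D C"
        using D C by (auto simp: near_def verts_Union meets_def)
      then have "i \<notin> D" using not_meets_disjoint[of D C] D C by auto
      then show "(w(i := x)) e = (w(i := y)) e" if "e \<in> D" for e using that by auto
    qed
    then show "?Q (w(i := y))" if "?Q (w(i := x))" using that by metis
  qed measurable
  also have "{w \<in> space W. ?P w \<and> ?Q w} = isolated S A"
    by (auto simp: isolated_def hits_def near_def)
  finally show ?thesis .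
qed

lemma sum_by_card:
  fixes f :: "'e set \<Rightarrow> real"
  assumes "\<D> \<subseteq> \<C>"
  shows "(\<Sum>D\<in>\<D>. f D) = (\<Sum>k\<le>nat \<lfloor>L0 n\<rfloor>. \<Sum>D | D \<in> \<D> \<and> card D = k. f D)"
  using finite_subset_\<C>[OF assms] card_le_L0 assms
  by (intro sum.group[symmetric]) auto

text \<open>A packing covers at most as many vertices as its total length, and each covered vertex
  attracts cost at most \<open>\<tau>\<close>.\<close>

lemma sum_near_le:
  assumes "packing S"
  shows "(\<Sum>D\<in>near S. cost S D) \<le> (\<Sum>C\<in>S. card C) * \<tau>"
proof -
  have S: "S \<subseteq> \<C>" "\<And>C D. C \<in> S \<Longrightarrow> D \<in> S \<Longrightarrow> C \<noteq> D \<Longrightarrow> verts C \<inter> verts D = {}"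
    using assms by (auto simp: packing_def meets_def)
  have "(\<Sum>D\<in>near S. cost S D) =
      (\<Sum>k\<le>nat \<lfloor>L0 n\<rfloor>. \<Sum>D | D \<in> near S \<and> card D = k. cost S D)"
    by (rule sum_by_card) (auto simp: near_def)
  also have "\<dots> = (\<Sum>k\<le>nat \<lfloor>L0 n\<rfloor>. exp c0 ^ k *
      (\<Sum>D | D \<in> \<C> - S \<and> card D = k \<and> verts D \<inter> verts (\<Union>S) \<noteq> {}. (1 / real n) ^ card (D - \<Union>S)))"
    unfolding sum_distrib_left
    by (intro sum.cong refl) (auto simp: near_def cost_def exp_of_nat_mult[symmetric] mult.commute)
  also have "\<dots> \<le> (\<Sum>k\<le>nat \<lfloor>L0 n\<rfloor>. exp c0 ^ k * (card (verts (\<Union>S)) * 3 ^ k / real n))"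
    by (intro sum_mono mult_left_mono sum_overlapping_le[OF n_pos finite_\<C> S]) auto
  also have "\<dots> = card (verts (\<Union>S)) * \<tau>"
    by (simp add: \<tau>_def sum_distrib_left sum_divide_distrib power_mult_distrib mult_ac)
  also have "\<dots> \<le> (\<Sum>C\<in>S. card C) * \<tau>"
  proof (intro mult_right_mono of_nat_mono)
    have "card (verts (\<Union>S)) \<le> (\<Sum>C\<in>S. card (verts C))"
      unfolding verts_Union by (rule card_UN_le[OF finite_subset_\<C>[OF S(1)]])
    also have "\<dots> = (\<Sum>C\<in>S. card C)" using S(1) card_verts by (intro sum.cong) auto
    finally show "card (verts (\<Union>S)) \<le> (\<Sum>C\<in>S. card C)" .
    show "0 \<le> \<tau>" by (auto simp: \<tau>_def intro!: divide_nonneg_nonneg sum_nonneg)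
  qed
  finally show ?thesis .
qed

text \<open>The case of the empty packing, where all edges of \<open>C\<close> are fresh.\<close>

lemma p_le: "C \<in> \<C> \<Longrightarrow> p C \<le> exp (c0 * card C) * (1 / real n) ^ card C"
  using joint_light_le[of "{}" C] measure_X_le by (simp add: packing_def)

lemma sum_p_meeting_le:
  assumes "U \<subseteq> {..<n}"
  shows "(\<Sum>D | D \<in> \<C> \<and> verts D \<inter> U \<noteq> {}. p D) \<le> card U * \<tau>"
proof -
  have "(\<Sum>D | D \<in> \<C> \<and> verts D \<inter> U \<noteq> {}. p D) =
      (\<Sum>k\<le>nat \<lfloor>L0 n\<rfloor>. \<Sum>D | D \<in> {D. D \<in> \<C> \<and> verts D \<inter> U \<noteq> {}} \<and> card D = k. p D)"
    by (rule sum_by_card) auto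
  also have "\<dots> \<le> (\<Sum>k\<le>nat \<lfloor>L0 n\<rfloor>. exp c0 ^ k * (\<Sum>D | D \<in> \<C> \<and> card D = k \<and> verts D \<inter> U \<noteq> {}. (1 / real n) ^ k))"
  proof (intro sum_mono)
    fix k
    have "(\<Sum>D | D \<in> {D. D \<in> \<C> \<and> verts D \<inter> U \<noteq> {}} \<and> card D = k. p D) \<le>
        (\<Sum>D | D \<in> {D. D \<in> \<C> \<and> verts D \<inter> U \<noteq> {}} \<and> card D = k. exp c0 ^ k * (1 / real n) ^ k)"
    proof (intro sum_mono)
      fix D assume "D \<in> {D. D \<in> {D. D \<in> \<C> \<and> verts D \<inter> U \<noteq> {}} \<and> card D = k}"
      then show "p D \<le> exp c0 ^ k * (1 / real n) ^ k"
        using p_le[of D] by (auto simp: exp_of_nat_mult[symmetric] mult.commute)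
    qed
    also have "\<dots> = exp c0 ^ k * (\<Sum>D | D \<in> \<C> \<and> card D = k \<and> verts D \<inter> U \<noteq> {}. (1 / real n) ^ k)"
      unfolding sum_distrib_left by (intro sum.cong) auto
    finally show "(\<Sum>D | D \<in> {D. D \<in> \<C> \<and> verts D \<inter> U \<noteq> {}} \<and> card D = k. p D) \<le> \<dots>" .
  qed
  also have "\<dots> \<le> (\<Sum>k\<le>nat \<lfloor>L0 n\<rfloor>. exp c0 ^ k * (card U * 3 ^ k / real n))"
    by (intro sum_mono mult_left_mono sum_meeting_le[OF n_pos assms finite_\<C>]) auto
  also have "\<dots> = card U * \<tau>"
    by (simp add: \<tau>_def sum_distrib_left sum_divide_distrib power_mult_distrib mult_ac)
  finally show ?thesis .
qed

end

section \<open>Comparison of the two processes\<close>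

lemma points_Int_space: "set_mset N \<subseteq> A \<Longrightarrow> points (B \<inter> A) N = points B N"
  unfolding points_def by (intro arg_cong[where f=size] filter_mset_cong) auto

context light_cycle_family
begin

text \<open>On \<open>isolated S A\<close> the light cycles are exactly those of \<open>S\<close>,
  so these events are disjoint for different \<open>S\<close> and the process equals
  \<open>conf S\<close> there. Configurations with intersecting light cycles are discarded, hence
  only an inequality.\<close>

lemma packings_le_light:
  assumes A: "A \<in> sets CS"
  shows "(\<Sum>S | packing S. measure W (isolated S A)) \<le>
    measure (light_process n E Cs c0) A"
proof -
  have sets: "isolated S A \<in> sets W" if "packing S" for S
  proof -
    have "isolated S A = hits S A \<inter> {w \<in> space W. \<forall>D\<in>\<C> - S. c0 < X D w}"
      by (auto simp: isolated_def hits_def)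
    also have "\<dots> \<in> sets W"
      using pred_all_miss[of "\<C> - S"] hits_sets[OF packing_subset[OF that] A]
      by (intro sets.Int) (auto simp: pred_def)
    finally show ?thesis .
  qed
  have hit_set: "{C \<in> \<C>. hit C w} = S" if "packing S" "w \<in> isolated S A" for S w
  proof (intro set_eqI iffI)
    fix C assume "C \<in> {C \<in> \<C>. hit C w}"
    then have C: "C \<in> \<C>" "hit C w" by auto
    show "C \<in> S"
    proof (rule ccontr)
      assume "C \<notin> S"
      then have "c0 < X C w" using that(2) C(1) by (auto simp: isolated_def)
      then show False using C(2) by (simp add: hit_def)
    qed
  next
    fix C assume "C \<in> S"
    then show "C \<in> {C \<in> \<C>. hit C w}" using that packing_subset[OF that(1)] by (auto simp: isolated_def hits_def)
  qed
  have "(\<Sum>S | packing S. measure W (isolated S A)) = measure W (\<Union>S\<in>Collect packing. isolated S A)"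
  proof (rule W.finite_measure_finite_Union[symmetric])
    show "finite (Collect packing)" using finite_packings[of "\<lambda>_. True"] by simp
    show "disjoint_family_on (\<lambda>S. isolated S A) (Collect packing)"
      unfolding disjoint_family_on_def using hit_set by blast
  qed (use sets in auto)
  also have "\<dots> \<le> measure W (light_points n Cs c0 -` A \<inter> space W)"
  proof (rule W.finite_measure_mono)
    show "(\<Union>S\<in>Collect packing. isolated S A) \<subseteq> light_points n Cs c0 -` A \<inter> space W"
    proof
      fix w assume "w \<in> (\<Union>S\<in>Collect packing. isolated S A)"
      then obtain S where S: "packing S" "w \<in> isolated S A" by auto
      then show "w \<in> light_points n Cs c0 -` A \<inter> space W"
        using hit_set[OF S] by (auto simp: light_points_eq_conf isolated_def hits_def)
    qed
    show "light_points n Cs c0 -` A \<inter> space W \<in> sets W"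
      by (rule measurable_sets[OF measurable_light A])
  qed
  also have "\<dots> = measure (light_process n E Cs c0) A"
    unfolding light_process_def by (rule measure_distr[OF measurable_light A, symmetric])
  finally show ?thesis .
qed

text \<open>Dropping the packing condition gives the expansion of the product of the factors
  \<open>1 + p C\<close>.\<close>

lemma sum_prod_packing_le: "(\<Sum>S | packing S. \<Prod>C\<in>S. p C) \<le> exp mass"
proof -
  have "(\<Sum>S | packing S. \<Prod>C\<in>S. p C) \<le> (\<Sum>S\<in>Pow \<C>. \<Prod>C\<in>S. p C)"
    using finite_\<C> by (intro sum_mono2) (auto simp: packing_def prod_nonneg p_nonneg)
  also have "\<dots> = (\<Prod>C\<in>\<C>. p C + 1)"
    using prod_add[OF finite_\<C>, of p "\<lambda>_. 1"] by simp
  also have "\<dots> \<le> (\<Prod>C\<in>\<C>. exp (p C))"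
    using p_nonneg by (intro prod_mono) (auto simp: add.commute exp_ge_add_one_self intro: add_nonneg_nonneg)
  also have "\<dots> = exp mass"
    unfolding mass_def by (rule exp_sum[OF finite_\<C>, symmetric])
  finally show ?thesis .
qed

lemma void_le_exp: "void \<le> exp (- mass)"
proof -
  have "void \<le> (\<Prod>C\<in>\<C>. exp (- p C))"
    unfolding void_def using p_le_1 exp_ge_add_one_self[of "- p _"] by (intro prod_mono) auto
  then show ?thesis
    unfolding mass_def using exp_sum[OF finite_\<C>, of "\<lambda>C. - p C"] by (simp add: sum_negf)
qed

lemma overlap_nonneg: "0 \<le> overlap"
  unfolding overlap_def by (intro sum_nonneg mult_nonneg_nonneg p_nonneg)

text \<open>Combines \<open>(1 - x) * exp x \<ge> 1 - x * x\<close> with the Weierstrass inequality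
  for products; the sum of the squares is the diagonal part of \<open>overlap\<close>.\<close>

lemma exp_mass_le_void: "exp (- mass) * (1 - overlap) \<le> void"
proof -
  have "(\<Sum>C\<in>\<C>. p C * p C) \<le> overlap"
    unfolding overlap_def
  proof (rule sum_mono)
    fix C assume C: "C \<in> \<C>"
    then show "p C * p C \<le> (\<Sum>D | D \<in> \<C> \<and> meets C D. p C * p D)"
      using finite_\<C> meets_refl[OF C] p_nonneg
      by (intro member_le_sum[where f="\<lambda>D. p C * p D"]) auto
  qed
  then have "1 - overlap \<le> 1 - (\<Sum>C\<in>\<C>. p C * p C)" by simp
  also have "\<dots> \<le> (\<Prod>C\<in>\<C>. 1 - p C * p C)"
    using p_nonneg p_le_1 by (intro Weierstrass_prod_ineq) (auto intro: mult_le_one)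
  also have "\<dots> \<le> (\<Prod>C\<in>\<C>. (1 - p C) * exp (p C))"
  proof (rule prod_mono)
    fix C
    have "(1 - p C) * (1 + p C) \<le> (1 - p C) * exp (p C)"
      using p_le_1[of C] by (intro mult_left_mono exp_ge_add_one_self) auto
    moreover have "(1 - p C) * (1 + p C) = 1 - p C * p C" by (simp add: algebra_simps)
    moreover have "p C * p C \<le> 1" using p_nonneg p_le_1 by (auto intro: mult_le_one)
    ultimately show "0 \<le> 1 - p C * p C \<and> 1 - p C * p C \<le> (1 - p C) * exp (p C)" by simp
  qed
  also have "\<dots> = void * exp mass"
    unfolding void_def mass_def by (simp add: prod.distrib exp_sum[OF finite_\<C>])
  finally have "exp (- mass) * (1 - overlap) \<le> exp (- mass) * (void * exp mass)"
    by (intro mult_left_mono) auto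
  also have "\<dots> = void" by (simp add: exp_minus)
  finally show ?thesis .
qed

text \<open>Each cycle counts with its number of vertices, the places where another cycle can touch
  it; this converts bounds per vertex into bounds per configuration.\<close>

definition total_length :: real where
  "total_length = (\<Sum>C\<in>\<C>. card C * p C)"

text \<open>Removing a marked cycle \<open>C\<close> from a packing leaves a packing, at the price
  of a factor \<open>p C\<close>; the remaining sum is at most \<open>exp mass\<close>.\<close>

lemma sum_packing_length_le:
  "(\<Sum>S | packing S. (\<Prod>C\<in>S. p C) * (\<Sum>C\<in>S. card C)) \<le> exp mass * total_length"
proof -
  let ?P = "{S. packing S}"
  have finP: "finite ?P" using finite_packings[of "\<lambda>_. True"] by simp
  have through: "(\<Sum>S | packing S \<and> C \<in> S. \<Prod>D\<in>S. p D) \<le> exp mass * p C" for C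
  proof -
    let ?T = "{S. packing S \<and> C \<in> S}"
    have "(\<Sum>S\<in>?T. \<Prod>D\<in>S. p D) = p C * (\<Sum>S\<in>?T. \<Prod>D\<in>S - {C}. p D)"
      unfolding sum_distrib_left by (intro sum.cong refl) (auto intro!: prod.remove packing_finite)
    moreover have "(\<Sum>S\<in>?T. \<Prod>D\<in>S - {C}. p D) = (\<Sum>S\<in>(\<lambda>S. S - {C}) ` ?T. \<Prod>D\<in>S. p D)"
      by (subst sum.reindex) (auto intro!: inj_onI)
    moreover have "(\<Sum>S\<in>(\<lambda>S. S - {C}) ` ?T. \<Prod>D\<in>S. p D) \<le> (\<Sum>S\<in>?P. \<Prod>D\<in>S. p D)"
      using finP by (intro sum_mono2) (auto simp: packing_def prod_nonneg p_nonneg)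
    ultimately have "(\<Sum>S\<in>?T. \<Prod>D\<in>S. p D) \<le> p C * exp mass"
      using p_nonneg[of C] sum_prod_packing_le by (simp add: mult_left_mono)
    then show ?thesis by (simp only: mult.commute)
  qed
  have "(\<Sum>S\<in>?P. (\<Prod>C\<in>S. p C) * (\<Sum>C\<in>S. card C)) =
      (\<Sum>S\<in>?P. \<Sum>C\<in>\<C>. if C \<in> S then (\<Prod>D\<in>S. p D) * card C else 0)"
  proof (intro sum.cong refl)
    fix S assume "S \<in> ?P"
    then have S: "S \<subseteq> \<C>" by (simp add: packing_def)
    have "(\<Sum>C\<in>\<C>. if C \<in> S then (\<Prod>D\<in>S. p D) * card C else 0) = (\<Sum>C\<in>\<C> \<inter> S. (\<Prod>D\<in>S. p D) * card C)"
      using finite_\<C> by (simp add: sum.inter_restrict)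
    also have "\<C> \<inter> S = S" using S by auto
    finally show "(\<Prod>C\<in>S. p C) * (\<Sum>C\<in>S. card C) = (\<Sum>C\<in>\<C>. if C \<in> S then (\<Prod>D\<in>S. p D) * card C else 0)"
      by (simp add: sum_distrib_left)
  qed
  also have "\<dots> = (\<Sum>C\<in>\<C>. \<Sum>S\<in>?P. if C \<in> S then (\<Prod>D\<in>S. p D) * card C else 0)"
    by (rule sum.swap)
  also have "\<dots> = (\<Sum>C\<in>\<C>. card C * (\<Sum>S | packing S \<and> C \<in> S. \<Prod>D\<in>S. p D))"
  proof (intro sum.cong refl)
    fix C
    have "(\<Sum>S\<in>?P. if C \<in> S then (\<Prod>D\<in>S. p D) * card C else 0) = (\<Sum>S\<in>?P \<inter> {S. C \<in> S}. (\<Prod>D\<in>S. p D) * card C)"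
      using finP by (simp add: sum.inter_restrict)
    also have "?P \<inter> {S. C \<in> S} = {S. packing S \<and> C \<in> S}" by auto
    finally show "(\<Sum>S\<in>?P. if C \<in> S then (\<Prod>D\<in>S. p D) * card C else 0) =
        card C * (\<Sum>S | packing S \<and> C \<in> S. \<Prod>D\<in>S. p D)"
      by (simp add: sum_distrib_left mult.commute)
  qed
  also have "\<dots> \<le> (\<Sum>C\<in>\<C>. card C * (exp mass * p C))"
    by (intro sum_mono mult_left_mono through) simp
  also have "\<dots> = exp mass * total_length"
    by (simp add: total_length_def sum_distrib_left mult_ac)
  finally show ?thesis .
qed

lemma \<tau>_nonneg: "0 \<le> \<tau>"
  by (auto simp: \<tau>_def intro!: divide_nonneg_nonneg sum_nonneg)

lemma overlap_le: "overlap \<le> \<tau> * total_length"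
proof -
  have "overlap \<le> (\<Sum>C\<in>\<C>. p C * (card C * \<tau>))"
    unfolding overlap_def sum_distrib_left[symmetric]
  proof (intro sum_mono mult_left_mono p_nonneg)
    fix C assume C: "C \<in> \<C>"
    have "(\<Sum>D | D \<in> \<C> \<and> meets C D. p D) = (\<Sum>D | D \<in> \<C> \<and> verts D \<inter> verts C \<noteq> {}. p D)"
      by (intro sum.cong) (auto simp: meets_def)
    also have "\<dots> \<le> card (verts C) * \<tau>"
      by (rule sum_p_meeting_le[OF verts_subset[OF C]])
    finally show "(\<Sum>D | D \<in> \<C> \<and> meets C D. p D) \<le> card C * \<tau>" by (simp add: card_verts[OF C])
  qed
  then show ?thesis by (simp add: total_length_def sum_distrib_left mult_ac)
qed

text \<open>Every cycle meets the set of all vertices, so \<open>sum_p_meeting_le\<close> bounds the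
  expected number of light short cycles by \<open>n * \<tau>\<close>.\<close>

lemma total_length_le: "total_length \<le> nat \<lfloor>L0 n\<rfloor> * (n * \<tau>)"
proof -
  have "total_length \<le> (\<Sum>C\<in>\<C>. nat \<lfloor>L0 n\<rfloor> * p C)"
    unfolding total_length_def using card_le_L0
    by (intro sum_mono mult_right_mono p_nonneg) auto
  also have "\<dots> = nat \<lfloor>L0 n\<rfloor> * (\<Sum>D | D \<in> \<C> \<and> verts D \<inter> {..<n} \<noteq> {}. p D)"
  proof -
    have "{D. D \<in> \<C> \<and> verts D \<inter> {..<n} \<noteq> {}} = \<C>"
      using verts_subset verts_nonempty by blast
    then show ?thesis by (simp add: sum_distrib_left)
  qed
  also have "\<dots> \<le> nat \<lfloor>L0 n\<rfloor> * (card {..<n} * \<tau>)"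
    by (intro mult_left_mono sum_p_meeting_le) auto
  finally show ?thesis by simp
qed

text \<open>Three losses of this size: Poisson configurations that are not separated, the passage
  from \<open>exp (- mass)\<close> to \<open>void\<close>, and near cycles that spoil an isolated
  packing. The first two are \<open>overlap\<close>, estimated by \<open>overlap_le\<close>.\<close>

definition discrepancy :: real where
  "discrepancy = 3 * (\<tau> * total_length)"

text \<open>Both laws are compared through the sum \<open>?\<eta>\<close> over packings, weighted by
  \<open>exp (- mass)\<close> on the Poisson side and by \<open>void\<close> on the side of light
  cycles. The bound \<open>?\<eta> \<le> exp mass\<close> keeps the change of weight within
  \<open>overlap\<close>.\<close>

lemma poisson_law_le_light:
  assumes A: "A \<in> sets CS"
  shows "measure (poisson_law \<Lambda>) A \<le> measure (light_process n E Cs c0) A + discrepancy"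
proof -
  interpret Q: prob_space "poisson_law \<Lambda>" by (rule \<Lambda>.prob_space_poisson_law)
  let ?\<eta> = "\<Sum>S | packing S. measure W (hits S A)"
  let ?p = "\<lambda>S. \<Prod>C\<in>S. p C" and ?len = "\<lambda>S. \<Sum>C\<in>S. card C"
  have "A \<subseteq> space CS" using sets.sets_into_space[OF A] .
  then have "measure (poisson_law \<Lambda>) A \<le> measure (poisson_law \<Lambda>) (A \<inter> separated \<union> (space CS - separated))"
    using A by (intro Q.finite_measure_mono) auto
  also have "\<dots> \<le> measure (poisson_law \<Lambda>) (A \<inter> separated) + measure (poisson_law \<Lambda>) (space CS - separated)"
    using A by (intro measure_Un_le) auto
  also have "\<dots> \<le> exp (- mass) * ?\<eta> + overlap"
    by (intro add_mono poisson_law_separated_le[OF A] poisson_law_not_separated_le)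
  finally have upper: "measure (poisson_law \<Lambda>) A \<le> exp (- mass) * ?\<eta> + overlap" .
  have \<eta>: "?\<eta> \<le> exp mass"
  proof -
    have "?\<eta> \<le> (\<Sum>S | packing S. ?p S)"
    proof (rule sum_mono)
      fix S assume "S \<in> {S. packing S}"
      then have S: "packing S" by simp
      have "measure W (hits S A) \<le> measure W (hits S (space CS))"
        using \<open>A \<subseteq> space CS\<close> hits_sets[OF packing_subset[OF S] sets.top]
        by (intro W.finite_measure_mono) (auto simp: hits_def)
      then show "measure W (hits S A) \<le> ?p S" by (simp add: measure_hits_space[OF S])
    qed
    also have "\<dots> \<le> exp mass" by (rule sum_prod_packing_le)
    finally show ?thesis .
  qed
  have \<eta>0: "0 \<le> ?\<eta>" by (intro sum_nonneg) simp
  \<comment> \<open>The near cycles of all packings together: the factor \<open>exp mass\<close>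
    from the sum over packings cancels against \<open>void\<close>.\<close>
  have "void * (\<Sum>S | packing S. ?p S * ?len S) * \<tau> \<le> exp (- mass) * (exp mass * total_length) * \<tau>"
    using void_le_exp void_nonneg sum_packing_length_le \<tau>_nonneg
    by (intro mult_right_mono mult_mono) (auto intro!: sum_nonneg mult_nonneg_nonneg prod_nonneg p_nonneg)
  also have "\<dots> = \<tau> * total_length" by (simp add: exp_minus)
  finally have err: "void * (\<Sum>S | packing S. ?p S * ?len S) * \<tau> \<le> \<tau> * total_length" .
  have "exp (- mass) * (1 - overlap) * ?\<eta> \<le> void * ?\<eta>"
    by (intro mult_right_mono exp_mass_le_void \<eta>0)
  moreover have "exp (- mass) * overlap * ?\<eta> \<le> overlap"
  proof -
    have "exp (- mass) * overlap * ?\<eta> \<le> exp (- mass) * overlap * exp mass"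
      using \<eta> overlap_nonneg by (intro mult_left_mono) auto
    also have "\<dots> = overlap" by (simp add: exp_minus)
    finally show ?thesis .
  qed
  ultimately have "exp (- mass) * ?\<eta> - overlap - \<tau> * total_length \<le> void * ?\<eta> - void * (\<Sum>S | packing S. ?p S * ?len S) * \<tau>"
    using err by (simp add: algebra_simps)
  also have "\<dots> = (\<Sum>S | packing S. void * (measure W (hits S A) - ?p S * (?len S * \<tau>)))"
    by (simp add: sum_distrib_left sum_distrib_right sum_subtractf algebra_simps)
  also have "\<dots> \<le> (\<Sum>S | packing S. measure W (isolated S A))"
  proof (rule sum_mono)
    fix S assume "S \<in> {S. packing S}"
    then have S: "packing S" by simp
    have "void * (measure W (hits S A) - ?p S * (?len S * \<tau>)) \<le>
      void * (measure W (hits S A) - ?p S * (\<Sum>D\<in>near S. cost S D))"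
      using sum_near_le[OF S] void_nonneg
      by (intro mult_left_mono diff_left_mono) (auto intro: prod_nonneg p_nonneg)
    also have "\<dots> \<le> measure W (isolated S A)"
      by (rule isolated_hits_ge[OF S A])
    finally show "void * (measure W (hits S A) - ?p S * (?len S * \<tau>)) \<le>
        measure W (isolated S A)" .
  qed
  also have "\<dots> \<le> measure (light_process n E Cs c0) A" by (rule packings_le_light[OF A])
  finally show ?thesis using upper overlap_le by (simp add: discrepancy_def)
qed

text \<open>The one-sided bound applied to the complement of an event gives the opposite
  direction.\<close>

lemma total_variation_le: "total_variation (light_process n E Cs c0) (poisson_law \<Lambda>) \<le> discrepancy"
  unfolding total_variation_def
proof (rule cSUP_least)
  interpret Q: prob_space "poisson_law \<Lambda>" by (rule \<Lambda>.prob_space_poisson_law)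
  interpret P: prob_space "light_process n E Cs c0"
    unfolding light_process_def by (rule W.prob_space_distr[OF measurable_light])
  have sP: "sets (light_process n E Cs c0) = sets CS" by (simp add: light_process_def)
  have spP: "space (light_process n E Cs c0) = space CS" by (simp add: light_process_def)
  fix A assume "A \<in> sets (light_process n E Cs c0)"
  then have A: "A \<in> sets CS" by (simp add: sP)
  have "P.prob A - Q.prob A = Q.prob (space CS - A) - P.prob (space CS - A)"
    using P.prob_compl[of A] Q.prob_compl[of A] A by (simp add: sP spP)
  then show "\<bar>P.prob A - Q.prob A\<bar> \<le> discrepancy"
    using poisson_law_le_light[OF A] poisson_law_le_light[of "space CS - A"] A by auto
qed auto

section \<open>Counts by length and level under the coupling\<close>

definition short_light :: "nat \<Rightarrow> real \<Rightarrow> ('e set \<times> real) set" where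
  "short_light k c = {z \<in> space Sp. card (fst z) = k \<and> snd z \<le> c}"

lemma short_light_sets: "short_light k c \<in> sets Sp"
proof -
  have "short_light k c = (\<Union>C\<in>{C \<in> \<C>. card C = k}. {C} \<times> ({0<..c0} \<inter> {..c}))"
    by (auto simp: short_light_def space_state_space)
  also have "\<dots> \<in> sets Sp"
    unfolding state_space_def using finite_\<C>
    by (intro sets.finite_UN pair_measureI) (auto simp: sets_restrict_space_iff)
  finally show ?thesis .
qed

text \<open>Finite configurations have no level in some interval just above \<open>c\<close>, so
  counts up to \<open>c\<close> agree with counts up to a rational in it. This lets a countable
  union of mismatches control all real levels.\<close>

lemma points_short_light_rat:
  assumes eq: "\<And>q. q \<in> \<rat> \<Longrightarrow> points (short_light k q) M = points (short_light k q) N"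
  shows "points (short_light k c) M = points (short_light k c) N"
proof -
  let ?F = "{x \<in> snd ` (set_mset M \<union> set_mset N). c < x}"
  obtain u where u: "c < u" "\<And>x. x \<in> ?F \<Longrightarrow> u \<le> x"
  proof (cases "?F = {}")
    case False
    then show ?thesis using that[of "Min ?F"] by auto
  next
    case True
    then show ?thesis using that[of "c + 1"] by auto
  qed
  obtain q where q: "q \<in> \<rat>" "c < q" "q < u" using Rats_dense_in_real[OF u(1)] by auto
  have le: "snd z \<le> q \<longleftrightarrow> snd z \<le> c" if "z \<in> set_mset M \<union> set_mset N" for z
    using u(2)[of "snd z"] q that by force
  have "points (short_light k q) M = points (short_light k c) M" "points (short_light k q) N = points (short_light k c) N"
    unfolding points_def using le
    by (auto intro!: arg_cong[where f=size] filter_mset_cong simp: short_light_def)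
  then show ?thesis using eq[OF q(1)] by simp
qed

text \<open>Positive weights make every light cycle a point, as the state space has no level 0. For
  \<open>c \<le> 0\<close> both sides vanish.\<close>

lemma card_light_eq:
  assumes pos: "\<forall>e\<in>E. 0 < w e" and k: "real k \<le> L0 n" and c: "c \<le> c0"
  shows "card {C \<in> Cs. card C = k \<and> light n w c C} = points (short_light k c) (light_points n Cs c0 w)"
proof -
  have "{C \<in> Cs. card C = k \<and> light n w c C} =
      {C \<in> \<C>. 0 < real n * mean_weight w C \<and> real n * mean_weight w C \<le> c0 \<and>
        (C, real n * mean_weight w C) \<in> short_light k c}"
  proof (intro set_eqI iffI)
    fix C assume "C \<in> {C \<in> Cs. card C = k \<and> light n w c C}"
    then have C: "C \<in> \<C>" and Ck: "card C = k" and light: "light n w c C"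
      using k by (auto simp: short_cycles_def)
    have "0 < mean_weight w C"
      using X_pos[OF pos C] n_pos by (simp add: X_def zero_less_mult_iff)
    moreover have "real n * mean_weight w C \<le> c"
      using light n_pos by (simp add: light_def field_simps)
    ultimately show "C \<in> {C \<in> \<C>. 0 < real n * mean_weight w C \<and> real n * mean_weight w C \<le> c0 \<and>
        (C, real n * mean_weight w C) \<in> short_light k c}"
      using C Ck c n_pos by (auto simp: short_light_def space_state_space)
  next
    fix C assume "C \<in> {C \<in> \<C>. 0 < real n * mean_weight w C \<and> real n * mean_weight w C \<le> c0 \<and>
        (C, real n * mean_weight w C) \<in> short_light k c}"
    then show "C \<in> {C \<in> Cs. card C = k \<and> light n w c C}"
      using n_pos by (auto simp: short_light_def light_def short_cycles_def field_simps)
  qed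
  then show ?thesis by (simp add: points_light_points[OF n_pos finite_Cs])
qed

lemma discrepancy_le: "discrepancy \<le> 3 * (nat \<lfloor>L0 n\<rfloor> * (n * \<tau>\<^sup>2))"
  using mult_left_mono[OF total_length_le \<tau>_nonneg] by (simp add: discrepancy_def power2_eq_square mult_ac)

text \<open>The base \<open>b\<close> is at least 1, so the geometric sum in \<open>\<tau>\<close>
  is at most its number of terms times the last one. Squaring \<open>\<tau>\<close> produces the 2
  in the exponent and leaves one power of \<open>n\<close> in the denominator.\<close>

lemma discrepancy_bound:
  assumes L0: "0 \<le> L0 n"
  shows "discrepancy \<le> 3 * (L0 n + 1) ^ 3 * exp (2 * ln (3 * exp c0) * L0 n) / real n"
proof -
  define b where "b = 3 * exp c0"
  define L where "L = nat \<lfloor>L0 n\<rfloor>"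
  define x where "x = exp (ln b * L0 n)"
  have "1 < exp c0" using c0_pos by simp
  then have b: "1 \<le> b" unfolding b_def by linarith
  have L: "real L \<le> L0 n" using L0 by (simp add: L_def)
  have "(\<Sum>k\<le>L. b ^ k) \<le> (\<Sum>k\<le>L. b ^ L)"
    using b by (intro sum_mono power_increasing) auto
  also have "\<dots> = (real L + 1) * b ^ L" by simp
  also have "b ^ L = exp (ln b * real L)"
    using b by (simp add: exp_of_nat2_mult)
  also have "(real L + 1) * exp (ln b * real L) \<le> (L0 n + 1) * x"
    unfolding x_def using b L L0 by (intro mult_mono) (auto intro: mult_left_mono)
  finally have "\<tau> \<le> (L0 n + 1) * x / real n"
    unfolding \<tau>_def b_def L_def by (intro divide_right_mono) auto
  then have "\<tau>\<^sup>2 \<le> ((L0 n + 1) * x / real n)\<^sup>2"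
    using \<tau>_nonneg by (rule power_mono)
  then have "real L * (real n * \<tau>\<^sup>2) \<le> (L0 n + 1) * (real n * ((L0 n + 1) * x / real n)\<^sup>2)"
    using L L0 by (intro mult_mono mult_left_mono) auto
  also have "\<dots> = (L0 n + 1) ^ 3 * x\<^sup>2 / real n"
    using n_pos by (simp add: power2_eq_square power3_eq_cube field_simps)
  also have "x\<^sup>2 = exp (2 * ln b * L0 n)"
    by (simp add: x_def power2_eq_square exp_add[symmetric] mult_ac)
  finally show ?thesis
    using discrepancy_le by (simp add: b_def L_def)
qed

text \<open>The coupling involves the weights themselves, so lightness can be read off its first
  component. The exceptional event consists of a null event, some weight not being positive, and of
  the mismatches of counts at rational levels; the latter never contain a pair
  \<open>(w, light_points n Cs c0 w)\<close>, so \<open>maximal_coupling\<close> bounds their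
  measure.\<close>

theorem light_poisson_approximation:
  assumes L0: "0 \<le> L0 n"
    and \<epsilon>: "3 * (L0 n + 1) ^ 3 * exp (2 * ln (3 * exp c0) * L0 n) / real n \<le> \<epsilon>"
  shows "\<exists>Q. poisson_process \<Lambda> Q \<and> total_variation (light_process n E Cs c0) Q \<le> \<epsilon> \<and>
    (\<exists>K. coupling W Q K \<and>
      (\<exists>bad\<in>sets K. measure K bad \<le> \<epsilon> \<and>
        (\<forall>(w, N)\<in>space K - bad. \<forall>k. real k \<le> L0 n \<longrightarrow> (\<forall>c\<le>c0.
          card {C \<in> Cs. card C = k \<and> light n w c C} = points {(C, x). card C = k \<and> x \<le> c} N))))"
proof -
  interpret Q: prob_space "poisson_law \<Lambda>" by (rule \<Lambda>.prob_space_poisson_law)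
  let ?f = "light_points n Cs c0"
  have le: "measure (poisson_law \<Lambda>) A \<le> measure (distr W CS ?f) A + discrepancy" if "A \<in> sets CS" for A
    using poisson_law_le_light[OF that] by (simp add: light_process_def)
  have sQ: "sets (poisson_law \<Lambda>) = sets CS" by simp
  obtain K where K: "coupling W (poisson_law \<Lambda>) K"
    and K_le: "\<And>bad. bad \<in> sets K \<Longrightarrow> (\<And>w. w \<in> space W \<Longrightarrow> (w, ?f w) \<notin> bad) \<Longrightarrow> measure K bad \<le> discrepancy"
    using maximal_coupling[OF W.prob_space_axioms measurable_light Q.prob_space_axioms sQ le] by metis
  have sK: "sets K = sets (W \<Otimes>\<^sub>M poisson_law \<Lambda>)" and fstK: "distr K W fst = W"
    using K by (auto simp: coupling_def)
  have sK': "sets K = sets (W \<Otimes>\<^sub>M CS)"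
    unfolding sK by (intro sets_pair_measure_cong) auto
  have spK: "space K = space W \<times> space CS"
    using sets_eq_imp_space_eq[OF sK'] by (simp add: space_pair_measure)
  have fst_meas: "fst \<in> K \<rightarrow>\<^sub>M W" by (simp add: measurable_cong_sets[OF sK' refl])
  let ?Z = "{w \<in> space W. \<not> (\<forall>e\<in>E. 0 < w e)}"
  have Z: "?Z \<in> sets W"
  proof -
    have "Measurable.pred W (\<lambda>w. \<forall>e\<in>E. 0 < w e)"
    proof (intro pred_intros_finite finite_E)
      fix e assume "e \<in> E"
      note [measurable] = measurable_weights_component[OF this]
      show "Measurable.pred W (\<lambda>w. 0 < w e)" by measurable
    qed
    then show ?thesis by measurable
  qed
  define bad1 where "bad1 = fst -` ?Z \<inter> space K"
  define mismatch where "mismatch k q = {z \<in> space K. points (short_light k q) (?f (fst z)) \<noteq> points (short_light k q) (snd z)}"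
    for k q
  define bad2 where "bad2 = (\<Union>k. \<Union>q\<in>\<rat>. mismatch k q)"
  have bad1: "bad1 \<in> sets K" unfolding bad1_def by (rule measurable_sets[OF fst_meas Z])
  have "emeasure K bad1 = emeasure (distr K W fst) ?Z"
    unfolding bad1_def by (rule emeasure_distr[OF fst_meas Z, symmetric])
  also have "\<dots> = 0"
    unfolding fstK using AE_weights_pos[OF finite_E] Z by (subst (asm) AE_iff_measurable[OF Z refl]) auto
  finally have bad1_0: "measure K bad1 = 0" by (simp add: measure_def)
  have mismatch: "mismatch k q \<in> sets K" for k q
  proof -
    note [measurable] = measurable_points[OF short_light_sets, of k q]
    have "(\<lambda>z. real (points (short_light k q) (?f (fst z)))) \<in> borel_measurable (W \<Otimes>\<^sub>M CS)"
      "(\<lambda>z. real (points (short_light k q) (snd z))) \<in> borel_measurable (W \<Otimes>\<^sub>M CS)"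
      by measurable
    then have "{z \<in> space (W \<Otimes>\<^sub>M CS). real (points (short_light k q) (?f (fst z))) \<noteq>
        real (points (short_light k q) (snd z))} \<in> sets (W \<Otimes>\<^sub>M CS)"
      by (rule borel_measurable_neq)
    then show ?thesis by (simp add: mismatch_def sK' spK space_pair_measure)
  qed
  have "(\<Union>q\<in>\<rat>. mismatch k q) \<in> sets K" for k
    by (rule sets.countable_UN'[OF countable_rat]) (use mismatch in auto)
  then have bad2: "bad2 \<in> sets K"
    unfolding bad2_def by (intro sets.countable_UN'[OF countableI_type]) auto
  have "measure K (bad1 \<union> bad2) \<le> measure K bad1 + measure K bad2"
    by (rule measure_Un_le[OF bad1 bad2])
  also have "measure K bad2 \<le> discrepancy"
    by (rule K_le[OF bad2]) (auto simp: bad2_def mismatch_def)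
  finally have small: "measure K (bad1 \<union> bad2) \<le> discrepancy" by (simp add: bad1_0)
  have good: "card {C \<in> Cs. card C = k \<and> light n w c C} = points {(C, x). card C = k \<and> x \<le> c} N"
    if wN: "(w, N) \<in> space K - (bad1 \<union> bad2)" and k: "real k \<le> L0 n" and c: "c \<le> c0" for w N k c
  proof -
    have pos: "\<forall>e\<in>E. 0 < w e" using wN by (auto simp: bad1_def spK)
    have "points (short_light k q) (?f w) = points (short_light k q) N" if "q \<in> \<rat>" for q
      using wN that by (force simp: bad2_def mismatch_def)
    then have "points (short_light k c) (?f w) = points (short_light k c) N"
      by (rule points_short_light_rat)
    moreover have "points (short_light k c) N = points {(C, x). card C = k \<and> x \<le> c} N"
    proof -
      have "set_mset N \<subseteq> space Sp" using wN by (auto simp: spK space_config_space)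
      moreover have "short_light k c = {(C, x). card C = k \<and> x \<le> c} \<inter> space Sp"
        by (auto simp: short_light_def)
      ultimately show ?thesis by (simp add: points_Int_space)
    qed
    ultimately show ?thesis using card_light_eq[OF pos k c] by simp
  qed
  have "discrepancy \<le> \<epsilon>" using discrepancy_bound[OF L0] \<epsilon> by (rule order_trans)
  then show ?thesis
    using K small good bad1 bad2 total_variation_le \<Lambda>.poisson_process_poisson_law
    by (intro exI[of _ "poisson_law \<Lambda>"] exI[of _ K] conjI bexI[of _ "bad1 \<union> bad2"]) auto
qed

end

section \<open>Complete graphs and asymptotics\<close>

lemma cas_vertices:
  "pre_digraph.cas (with_proj G) u p v \<Longrightarrow> u # map snd p = map fst p @ [v]"
proof (induction p arbitrary: u)
  case Nil
  then show ?case by (simp add: pre_digraph.cas.simps)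
next
  case (Cons e p)
  then show ?case by (simp add: pre_digraph.cas.simps)
qed

text \<open>In a closed walk the list of heads is the list of tails rotated by one. Distinctness,
  which \<open>cycle\<close> asserts for the heads, passes to the tails, and length 1 would be a
  loop.\<close>

lemma complete_cycle_vertices:
  assumes "pre_digraph.cycle (with_proj (complete_graph n)) q"
  obtains vs where "distinct vs" "set vs \<subseteq> {..<n}" "2 \<le> length vs" "length vs = length q" "set q = cyc vs"
proof -
  interpret pre_digraph "with_proj (complete_graph n)" .
  obtain u where walk: "awalk u q u" and dist: "distinct (tl (awalk_verts u q))" and ne: "q \<noteq> []"
    using assms by (auto simp: cycle_def)
  have arcs: "set q \<subseteq> parcs (complete_graph n)" and cas: "cas u q u"
    using walk by (auto simp: awalk_def)
  from cas_vertices[OF cas] have heads: "u # map snd q = map fst q @ [u]" .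
  let ?vs = "map fst q"
  obtain r where r: "?vs = u # r" using heads ne by (cases q) auto
  then have rot: "map snd q = rotate1 ?vs" using heads by simp
  have "tl (awalk_verts u q) = map snd q"
    using awalk_verts_conv'[OF cas] ne by simp
  then have "distinct ?vs" using dist rot by simp
  moreover have "set ?vs \<subseteq> {..<n}" using arcs by (auto simp: complete_graph_def)
  moreover have "2 \<le> length ?vs"
  proof (rule ccontr)
    assume "\<not> 2 \<le> length ?vs"
    then have "length q < 2" by simp
    moreover have "length q \<noteq> 0" using ne by simp
    ultimately have "length q = 1" by linarith
    then obtain e where q: "q = [e]" by (auto simp: length_Suc_conv)
    then have "fst e = snd e" using heads by simp
    then show False using arcs q by (auto simp: complete_graph_def)
  qed
  moreover have "set q = cyc ?vs"
    unfolding cyc_def rot[symmetric] by (simp add: zip_map_fst_snd)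
  ultimately show ?thesis by (intro that[of ?vs]) auto
qed

lemma card_cyc: "distinct vs \<Longrightarrow> card (cyc vs) = length vs"
  by (simp add: cyc_def distinct_card distinct_zipI1)

text \<open>Two arcs with the same unordered ends are equal or antiparallel; the latter means that
  two steps along the list return to the start, which is impossible from length 3 on.\<close>

lemma inj_on_unordered_cyc:
  assumes dist: "distinct vs" and k: "3 \<le> length vs"
  shows "inj_on (\<lambda>(u, v). {u, v}) (cyc vs)"
proof (rule inj_onI)
  let ?k = "length vs"
  let ?s = "\<lambda>i. Suc i mod ?k"
  fix a b assume "a \<in> cyc vs" "b \<in> cyc vs" and eq: "(\<lambda>(u, v). {u, v}) a = (\<lambda>(u, v). {u, v}) b"
  then obtain i j where i: "i < ?k" "a = (vs ! i, vs ! ?s i)" and j: "j < ?k" "b = (vs ! j, vs ! ?s j)"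
    by (auto simp: cyc_index)
  have s: "?s i < ?k" "?s j < ?k" using k by (auto intro: mod_less_divisor)
  have nth_eq: "vs ! x = vs ! y \<longleftrightarrow> x = y" if "x < ?k" "y < ?k" for x y
    using dist that by (simp add: nth_eq_iff_index_eq)
  have "i = j \<or> (i = ?s j \<and> ?s i = j)"
    using eq i j s by (auto simp: doubleton_eq_iff nth_eq)
  moreover have False if "i = ?s j" "?s i = j"
    using that i(1) j(1) k by (cases "Suc j = ?k"; cases "Suc i = ?k") auto
  ultimately show "a = b" using i j by auto
qed

lemma light_cycle_family_directed:
  assumes "0 < n" "0 < c0"
  shows "light_cycle_family n id (\<lambda>(u, v). {u, v}) (directed_cycles n) (directed_edges n) c0"
proof
  fix C assume "C \<in> short_cycles n (directed_cycles n)"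
  then obtain q where q: "C = set q" "pre_digraph.cycle (with_proj (complete_graph n)) q"
    by (auto simp: short_cycles_def directed_cycles_def)
  from complete_cycle_vertices[OF q(2)] obtain vs
    where "distinct vs" "set vs \<subseteq> {..<n}" "2 \<le> length vs" "set q = cyc vs" by metis
  then show "\<exists>vs. distinct vs \<and> set vs \<subseteq> {..<n} \<and> 2 \<le> length vs \<and> C = id ` cyc vs \<and> card C = length vs"
    using q by (intro exI[of _ vs]) (auto simp: card_cyc)
qed (use assms finite_edges finite_cycles cycles_subset_edges in \<open>auto\<close>)

lemma light_cycle_family_undirected:
  assumes "0 < n" "0 < c0"
  shows "light_cycle_family n (\<lambda>(u, v). {u, v}) id (undirected_cycles n) (undirected_edges n) c0"
proof
  fix C assume "C \<in> short_cycles n (undirected_cycles n)"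
  then obtain q where q: "C = (\<lambda>(u, v). {u, v}) ` set q"
      "pre_digraph.cycle (with_proj (complete_graph n)) q" "length q \<ge> 3"
    by (auto simp: short_cycles_def undirected_cycles_def)
  from complete_cycle_vertices[OF q(2)] obtain vs
    where vs: "distinct vs" "set vs \<subseteq> {..<n}" "2 \<le> length vs" "length vs = length q" "set q = cyc vs" by metis
  moreover have "card ((\<lambda>(u, v). {u, v}) ` cyc vs) = length vs"
    using inj_on_unordered_cyc[of vs] vs q(3) by (subst card_image) (auto simp: card_cyc)
  ultimately show "\<exists>vs. distinct vs \<and> set vs \<subseteq> {..<n} \<and> 2 \<le> length vs \<and>
      C = (\<lambda>(u, v). {u, v}) ` cyc vs \<and> card C = length vs"
    using q by (intro exI[of _ vs]) auto
qed (use assms finite_edges finite_cycles cycles_subset_edges in \<open>auto\<close>)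

text \<open>Here \<open>exp (a * L0 n)\<close> is \<open>n powr (a / (2 * ln (ln n)))\<close>, a
  power of \<open>n\<close> whose exponent tends to 0, and the powers of \<open>L0 n\<close> are of
  smaller order still.\<close>

lemma error_tends_to_0:
  fixes a :: real
  assumes "0 < a"
  shows "(\<lambda>n. 3 * (L0 n + 1) ^ 3 * exp (a * L0 n) / real n) \<longlonglongrightarrow> 0"
  unfolding L0_def using assms by real_asymp

lemma L0_eventually_ge: "\<forall>\<^sub>F n in sequentially. 0 \<le> L0 n"
  unfolding L0_def by real_asymp

lemma discrepancy_bound_eventually:
  fixes c0 \<epsilon> :: real
  assumes "0 < c0" "0 < \<epsilon>"
  shows "\<forall>\<^sub>F n in sequentially. 0 < n \<and> 0 \<le> L0 n \<and>
    3 * (L0 n + 1) ^ 3 * exp (2 * ln (3 * exp c0) * L0 n) / real n \<le> \<epsilon>"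
proof -
  have "1 < exp c0" using assms(1) by simp
  then have "1 < 3 * exp c0" by linarith
  then have "0 < 2 * ln (3 * exp c0)" by simp
  from order_tendstoD(2)[OF error_tends_to_0[OF this] assms(2)] L0_eventually_ge eventually_gt_at_top[of 0]
  show ?thesis by eventually_elim auto
qed

theorem theorem4p2:
  fixes c0 \<epsilon> :: real
  assumes "c0 > 0" and "\<epsilon> > 0"
  shows "(\<forall>\<^sub>F n in sequentially.
      \<exists>Q. poisson_process (light_intensity n (directed_edges n) (directed_cycles n) c0) Q \<and>
        total_variation (light_process n (directed_edges n) (directed_cycles n) c0) Q \<le> \<epsilon> \<and>
        (\<exists>K. coupling (weights (directed_edges n)) Q K \<and>
          (\<exists>bad\<in>sets K. measure K bad \<le> \<epsilon> \<and>
            (\<forall>(w, N)\<in>space K - bad. \<forall>k. real k \<le> L0 n \<longrightarrow> (\<forall>c\<le>c0.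
              card {C \<in> directed_cycles n. card C = k \<and> light n w c C} =
                points {(C, x). card C = k \<and> x \<le> c} N))))) \<and>
    (\<forall>\<^sub>F n in sequentially.
      \<exists>Q. poisson_process (light_intensity n (undirected_edges n) (undirected_cycles n) c0) Q \<and>
        total_variation (light_process n (undirected_edges n) (undirected_cycles n) c0) Q \<le> \<epsilon> \<and>
        (\<exists>K. coupling (weights (undirected_edges n)) Q K \<and>
          (\<exists>bad\<in>sets K. measure K bad \<le> \<epsilon> \<and>
            (\<forall>(w, N)\<in>space K - bad. \<forall>k. real k \<le> L0 n \<longrightarrow> (\<forall>c\<le>c0.
              card {C \<in> undirected_cycles n. card C = k \<and> light n w c C} =
                points {(C, x). card C = k \<and> x \<le> c} N)))))"
proof (intro conjI; rule eventually_mono[OF discrepancy_bound_eventually[OF assms]]; elim conjE)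
qed (rule light_cycle_family.light_poisson_approximation[OF light_cycle_family_directed]
    light_cycle_family.light_poisson_approximation[OF light_cycle_family_undirected];
    (assumption | rule assms))+

end
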